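(* Let $q\in(0,2]$ and assume the measurement model, (A3) and (A4) described in the context. Define $\hat\omega_q:=v_q(c^\star(\hat\rho_q),\hat\rho_q)$. Then as $(n_q,p)\to\infty$, $$\frac{\sqrt{n_q}}{\sqrt{\hat\omega_q}}\Big(\frac{\hat\nu_q(\hat t_{\mathrm{opt}})}{\|x\|_q^q}-1\Big)\xrightarrow{\ w\ }N(0,1),$$ and consequently for any fixed $\alpha,\alpha'\in[0,\frac12]$, $$\mathbb{P}\Big[\Big(1-\frac{\sqrt{\hat\omega_q}z_{1-\alpha}}{\sqrt{n_q}}\Big)\hat\nu_q(\hat t_{\mathrm{opt}})\le\|x\|_q^q\le\Big(1+\frac{\sqrt{\hat\omega_q}z_{1-\alpha'}}{\sqrt{n_q}}\Big)\hat\nu_q(\hat t_{\mathrm{opt}})\Big]\to1-\alpha-\alpha'.$$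
   Context: $z_{1-\alpha}$ denotes the $1-\alpha$ quantile of the standard normal distribution ($\Phi(z_{1-\alpha})=1-\alpha$). Stable laws: $\mathrm{stable}_q(\gamma)$ ($q\in(0,2]$, $\gamma>0$) has characteristic function $t\mapsto\exp(-|\gamma t|^q)$; $\mathrm{stable}_q(\gamma)^{\otimes p}$ has i.i.d. such coordinates. Model: $y_i=\langle a_i,x\rangle+\sigma\epsilon_i$, $i=1,\dots,n_q$, $x\in\mathbb{R}^p\setminus\{0\}$, $\sigma>0$, $a_i$ i.i.d. $\mathrm{stable}_q(\gamma_q)^{\otimes p}$, $\epsilon_i$ i.i.d. from $F_0$ symmetric about $0$ with $0<\mathbb{E}|\epsilon_1|<\infty$ and characteristic function $\varphi_0$ having isolated zeros; $\{a_i\}$ independent of $\{\epsilon_i\}$; $\sigma,\gamma_q,F_0$ known; $(n_q,p)\to\infty$ along an implicit index with $x,\sigma,\gamma_q,a_i$ allowed to vary, $F_0$ fixed. $\rho_q:=\sigma/(\gamma_q\|x\|_q)$; (A3): $\rho_q=\bar\rho_q+o(n_q^{-1/2})$ for a constant $\bar\rho_q\ge0$. Estimator: $\hat\Psi(t):=\frac1{n_q}\sum_ie^{\sqrt{-1}ty_i}$; $\mathrm{Log}_+(r)=\log|r|$ ($r\neq0$), $\mathrm{Log}_+(0)=1$; $\hat\nu_q(t):=\frac{-1}{\gamma_q^q|t|^q}\mathrm{Log}_+\mathrm{Re}(\hat\Psi(t)/\varphi_0(\sigma t))$ if $t\ne0$ and $\varphi_0(\sigma t)\ne0$, else $\hat\nu_q(t):=1$.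 Variance function: $v_q(c,\rho):=|c|^{-2q}\big(\frac12\varphi_0(\rho|c|)^{-2}e^{2|c|^q}+\frac12\varphi_0(2\rho|c|)\varphi_0(\rho|c|)^{-2}e^{(2-2^q)|c|^q}-1\big)$ when $c\ne0,\varphi_0(\rho c)\ne0$. Let $\varepsilon_q:=0$ for $q<2$ and $\varepsilon_2>0$ fixed; $\tilde v_q(c,\rho):=v_q(c,\rho)$ if $c\neq0$ and $\varphi_0(\rho c)\ne0$, else $+\infty$, on $[\varepsilon_q,\infty)\times[0,\infty)$; $c^\star(\rho)\in\operatorname{argmin}_{c\ge\varepsilon_q}\tilde v_q(c,\rho)$. (A4): $v_q(\cdot,\bar\rho_q)$ has at most one minimizer in $[\varepsilon_q,\infty)$. Procedure: $\hat m_q:=\mathrm{median}(|y_1|,\dots,|y_{n_q}|)$, $\hat t_{\mathrm{initial}}:=1/\hat m_q$, $\eta_0>0$ with $\varphi_0(\eta)>1/2$ on $[0,\eta_0]$, $\hat t_{\mathrm{pilot}}:=\min\{\hat t_{\mathrm{initial}},\eta_0/\sigma\}$, $\hat\rho_q:=\sigma/(\gamma_q\hat\nu_q(\hat t_{\mathrm{pilot}})^{1/q})$, $\hat t_{\mathrm{opt}}:=c^\star(\hat\rho_q)/(\gamma_q\hat\nu_q(\hat t_{\mathrm{pilot}})^{1/q})$. *)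

theory Defs
  imports "HOL-Probability.Probability"
begin

definition is_stable :: "real \<Rightarrow> real \<Rightarrow> real measure \<Rightarrow> bool" where
  "is_stable q g \<mu> \<longleftrightarrow> real_distribution \<mu> \<and>
     (\<forall>t. char \<mu> t = complex_of_real (exp (- (\<bar>g * t\<bar> powr q))))"

text \<open>Real characteristic function of the (symmetric) noise law F0.\<close>
definition phi0 :: "real measure \<Rightarrow> real \<Rightarrow> real" where
  "phi0 F0 t = Re (char F0 t)"

definition lq_pow :: "real \<Rightarrow> nat \<Rightarrow> (nat \<Rightarrow> real) \<Rightarrow> real" where
  "lq_pow q p x = (\<Sum>j<p. \<bar>x j\<bar> powr q)"

definition lq_norm :: "real \<Rightarrow> nat \<Rightarrow> (nat \<Rightarrow> real) \<Rightarrow> real" where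
  "lq_norm q p x = lq_pow q p x powr (1 / q)"

definition Log_plus :: "real \<Rightarrow> real" where
  "Log_plus r = (if r \<noteq> 0 then ln \<bar>r\<bar> else 1)"

definition Psi_hat :: "nat \<Rightarrow> (nat \<Rightarrow> real) \<Rightarrow> real \<Rightarrow> complex" where
  "Psi_hat n y t = (\<Sum>i<n. cis (t * y i)) / of_nat n"

definition nu_hat :: "real \<Rightarrow> real measure \<Rightarrow> real \<Rightarrow> real \<Rightarrow> nat \<Rightarrow> (nat \<Rightarrow> real) \<Rightarrow> real \<Rightarrow> real" where
  "nu_hat q F0 \<sigma> \<gamma> n y t =
     (if t \<noteq> 0 \<and> phi0 F0 (\<sigma> * t) \<noteq> 0
      then - 1 / (\<gamma> powr q * \<bar>t\<bar> powr q) *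
           Log_plus (Re (Psi_hat n y t / complex_of_real (phi0 F0 (\<sigma> * t))))
      else 1)"

text \<open>Variance function v_q(c,rho) (meaningful when c \<noteq> 0 and phi0(rho c) \<noteq> 0).\<close>
definition v_fun :: "real \<Rightarrow> real measure \<Rightarrow> real \<Rightarrow> real \<Rightarrow> real" where
  "v_fun q F0 c \<rho> = \<bar>c\<bar> powr (- 2 * q) *
     (1/2 * exp (2 * \<bar>c\<bar> powr q) / (phi0 F0 (\<rho> * \<bar>c\<bar>))\<^sup>2
      + 1/2 * phi0 F0 (2 * \<rho> * \<bar>c\<bar>) * exp ((2 - 2 powr q) * \<bar>c\<bar> powr q)
          / (phi0 F0 (\<rho> * \<bar>c\<bar>))\<^sup>2
      - 1)"

definition v_tilde :: "real \<Rightarrow> real measure \<Rightarrow> real \<Rightarrow> real \<Rightarrow> ereal" where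
  "v_tilde q F0 c \<rho> = (if c \<noteq> 0 \<and> phi0 F0 (\<rho> * c) \<noteq> 0 then ereal (v_fun q F0 c \<rho>) else \<infinity>)"

definition eps_q :: "real \<Rightarrow> real \<Rightarrow> real" where
  "eps_q q eps2 = (if q < 2 then 0 else eps2)"

definition is_minimizer :: "real \<Rightarrow> real measure \<Rightarrow> real \<Rightarrow> real \<Rightarrow> real \<Rightarrow> bool" where
  "is_minimizer q F0 e \<rho> c \<longleftrightarrow> c \<ge> e \<and> (\<forall>c'. c' \<ge> e \<longrightarrow> v_tilde q F0 c \<rho> \<le> v_tilde q F0 c' \<rho>)"

definition median :: "nat \<Rightarrow> (nat \<Rightarrow> real) \<Rightarrow> real" where
  "median n a = (let s = sort (map a [0..<n]) in
     if odd n then s ! (n div 2) else (s ! (n div 2 - 1) + s ! (n div 2)) / 2)"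

text \<open>Standard normal quantile z_{1-\<alpha>}, for 0 < \<alpha> < 1.\<close>
definition z_quant :: "real \<Rightarrow> real" where
  "z_quant \<alpha> = (THE z. cdf std_normal_distribution z = 1 - \<alpha>)"

definition t_pilot :: "real measure \<Rightarrow> real \<Rightarrow> real \<Rightarrow> nat \<Rightarrow> (nat \<Rightarrow> real) \<Rightarrow> real" where
  "t_pilot F0 \<eta>0 \<sigma> n y = min (1 / median n (\<lambda>i. \<bar>y i\<bar>)) (\<eta>0 / \<sigma>)"

definition rho_hat :: "real \<Rightarrow> real measure \<Rightarrow> real \<Rightarrow> real \<Rightarrow> real \<Rightarrow> nat \<Rightarrow> (nat \<Rightarrow> real) \<Rightarrow> real" where
  "rho_hat q F0 \<eta>0 \<sigma> \<gamma> n y =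
     \<sigma> / (\<gamma> * nu_hat q F0 \<sigma> \<gamma> n y (t_pilot F0 \<eta>0 \<sigma> n y) powr (1 / q))"

definition t_opt :: "real \<Rightarrow> real measure \<Rightarrow> (real \<Rightarrow> real) \<Rightarrow> real \<Rightarrow> real \<Rightarrow> real \<Rightarrow> nat \<Rightarrow> (nat \<Rightarrow> real) \<Rightarrow> real" where
  "t_opt q F0 cstar \<eta>0 \<sigma> \<gamma> n y =
     cstar (rho_hat q F0 \<eta>0 \<sigma> \<gamma> n y) /
       (\<gamma> * nu_hat q F0 \<sigma> \<gamma> n y (t_pilot F0 \<eta>0 \<sigma> n y) powr (1 / q))"

definition omega_hat :: "real \<Rightarrow> real measure \<Rightarrow> (real \<Rightarrow> real) \<Rightarrow> real \<Rightarrow> real \<Rightarrow> real \<Rightarrow> nat \<Rightarrow> (nat \<Rightarrow> real) \<Rightarrow> real" where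
  "omega_hat q F0 cstar \<eta>0 \<sigma> \<gamma> n y =
     v_fun q F0 (cstar (rho_hat q F0 \<eta>0 \<sigma> \<gamma> n y)) (rho_hat q F0 \<eta>0 \<sigma> \<gamma> n y)"

definition nu_opt :: "real \<Rightarrow> real measure \<Rightarrow> (real \<Rightarrow> real) \<Rightarrow> real \<Rightarrow> real \<Rightarrow> real \<Rightarrow> nat \<Rightarrow> (nat \<Rightarrow> real) \<Rightarrow> real" where
  "nu_opt q F0 cstar \<eta>0 \<sigma> \<gamma> n y =
     nu_hat q F0 \<sigma> \<gamma> n y (t_opt q F0 cstar \<eta>0 \<sigma> \<gamma> n y)"

end

(*
  After rescaling, Z_i = y_i / (gamma ||x||_q) has characteristic function
  psi(u) = exp(-|u|^q) phi0(rho u), and with u = gamma ||x||_q t the estimation error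
  nu(t) / ||x||_q^q - 1 is exactly -|u|^(-q) ln|1 + G(u) / (sqrt n psi(u))|, where
  G(u) = n^(-1/2) sum_i (cos(u Z_i) - psi(u)).  It therefore suffices to know that G is
  asymptotically equicontinuous, that it obeys the central limit theorem at a fixed point, and that
  the data-driven frequency converges in probability.  The Z_i need not have a first moment, so
  equicontinuity is proved by chaining with a Bernstein bound for the increments; the polynomial
  decay of 1 - psi at 0 controls the increments below the finest scale.  Convergence of the
  frequency follows from a lower bound on v_q that is free of the noise law and makes its sublevel
  sets compact, so that the minimiser depends continuously on rho wherever it is unique.
*)
theory Submission
  imports Defs "HOL-Real_Asymp.Real_Asymp"
begin

subsection \<open>The noise characteristic function and the variance function\<close>

text \<open>The increment bound has an exponential tail exp(1 - eps/s), not a Gaussian one. That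
  suffices: at dyadic level j the threshold shrinks like 2^(-beta j/4), the standard deviation like
  2^(-beta j/2), and a high enough power of the growing quotient beats the 2^j increments. The bound
  is available only while h^beta n >= 1, so the chain stops at the last such scale. The two
  frequencies need different arguments. The pilot frequency is merely tight, so its estimate is
  consistent because G / sqrt n is uniformly small on compact intervals. The final frequency
  converges to a point c, so G there may be replaced by G(c), and the linear term -c^(-q) G(c) /
  psi(c) has limiting variance exactly v_q(c, rhobar). The obstacle in the minimisation is a limit
  point at which phi0(rho c) = 0. There v_q contains phi0(2 rho c), whose sign is unknown;
  nonnegativity of the variance of a cosine bounds it from below and shows that v_q blows up. For
  the interval, the statistic is divided by nu / ||x||_q^q, which tends to one; the coverage event
  then says that this quotient lies in a fixed interval.\<close>

lemma (in real_distribution) phi0_eq_integral: "phi0 M t = (LINT x|M. cos (t * x))"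
proof -
  have "phi0 M t = (LINT x|M. Re (iexp (t * x)))"
    unfolding phi0_def char_def by (intro integral_Re[symmetric] integrable_iexp) auto
  then show ?thesis by (simp add: Re_exp)
qed

lemma (in real_distribution) integrable_cos_mult [simp]: "integrable M (\<lambda>x. cos (t * x))"
  by (rule integrable_const_bound[where B=1]) auto

lemma (in real_distribution) isCont_phi0: "isCont (phi0 M) t"
  using isCont_char[of t] unfolding phi0_def by (intro isCont_Re)

lemma (in real_distribution) phi0_measurable [measurable]: "phi0 M \<in> borel_measurable borel"
  unfolding phi0_def by measurable

lemma (in real_distribution) phi0_zero [simp]: "phi0 M 0 = 1"
  by (simp add: phi0_def char_zero)

lemma (in real_distribution) abs_phi0_le_1: "\<bar>phi0 M t\<bar> \<le> 1"
  using abs_Re_le_cmod[of "char M t"] cmod_char_le_1[of t] by (simp add: phi0_def)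

text \<open>Nonnegativity of the variance of \<open>cos (w * x)\<close> under the noise law,
  combined with the double angle formula. It eliminates the value of \<open>phi0\<close> at the
  doubled frequency from lower bounds on \<open>v_fun\<close>.\<close>

lemma (in real_distribution) phi0_double_ge: "phi0 M (2 * w) \<ge> 2 * (phi0 M w)\<^sup>2 - 1"
proof -
  have int: "integrable M (\<lambda>x. (cos (w * x))\<^sup>2)"
    by (rule integrable_const_bound[where B=1]) (auto simp: abs_square_le_1)
  have "0 \<le> (LINT x|M. (cos (w * x) - phi0 M w)\<^sup>2)" by simp
  also have "\<dots> = (LINT x|M. (cos (w * x))\<^sup>2 - 2 * phi0 M w * cos (w * x) + (phi0 M w)\<^sup>2)"
    by (intro Bochner_Integration.integral_cong) (auto simp: power2_eq_square algebra_simps)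
  also have "\<dots> = (LINT x|M. (cos (w * x))\<^sup>2) - 2 * phi0 M w * phi0 M w + (phi0 M w)\<^sup>2"
    using int prob_space by (simp add: phi0_eq_integral)
  finally have "(phi0 M w)\<^sup>2 \<le> (LINT x|M. (cos (w * x))\<^sup>2)" by (simp add: power2_eq_square)
  moreover have "phi0 M (2 * w) = (LINT x|M. 2 * (cos (w * x))\<^sup>2 - 1)"
    unfolding phi0_eq_integral by (intro Bochner_Integration.integral_cong)
      (auto simp: cos_double_cos[symmetric] mult.assoc)
  moreover have "\<dots> = 2 * (LINT x|M. (cos (w * x))\<^sup>2) - 1"
    using int prob_space by simp
  ultimately show ?thesis by simp
qed

text \<open>Linear instead of quadratic, because only a first absolute moment of the noise is
  assumed.\<close>

lemma one_minus_cos_le_abs: "1 - cos x \<le> \<bar>x\<bar>" for x :: real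
proof -
  have "1 - cos x = 2 * (sin (x/2))\<^sup>2"
    using cos_double_sin[of "x/2"] by simp
  also have "(sin (x/2))\<^sup>2 = \<bar>sin (x/2)\<bar> * \<bar>sin (x/2)\<bar>" by (simp add: power2_eq_square)
  also have "\<dots> \<le> \<bar>x/2\<bar> * 1"
    by (intro mult_mono abs_sin_x_le_abs_x) auto
  finally show ?thesis by simp
qed

lemma (in real_distribution) one_minus_phi0_le:
  assumes "integrable M abs"
  shows "1 - phi0 M t \<le> \<bar>t\<bar> * integral\<^sup>L M abs"
proof -
  have "1 - phi0 M t = (LINT x|M. 1 - cos (t * x))"
    using prob_space by (simp add: phi0_eq_integral)
  also have "\<dots> \<le> (LINT x|M. \<bar>t\<bar> * \<bar>x\<bar>)"
    using assms one_minus_cos_le_abs[of "t * _"]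
    by (intro integral_mono) (auto simp: abs_mult)
  finally show ?thesis by simp
qed

text \<open>Reflection conjugates the characteristic function, so symmetry makes it real; zeros of
  \<open>char\<close> and of \<open>phi0\<close> then coincide.\<close>

lemma (in real_distribution) char_eq_phi0:
  assumes "distr M borel uminus = M"
  shows "char M t = of_real (phi0 M t)"
proof -
  have "char M t = char (distr M borel uminus) t" by (simp add: assms)
  also have "\<dots> = (CLINT x|M. iexp (t * - x))"
    unfolding char_def by (subst integral_distr) auto
  also have "\<dots> = (CLINT x|M. cnj (iexp (t * x)))"
    by (intro Bochner_Integration.integral_cong) (auto simp: complex_eq_iff Re_exp Im_exp)
  also have "\<dots> = cnj (char M t)" unfolding char_def by (rule Bochner_Integration.integral_cnj)
  finally have "Im (char M t) = Im (cnj (char M t))" by (rule arg_cong)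
  then have "Im (char M t) = 0" by simp
  then show ?thesis by (simp add: phi0_def complex_eq_iff)
qed

text \<open>Comes from inserting \<open>phi0_double_ge\<close> for the doubled frequency. The result
  has the shape B / f^2 + D with B > 0 when \<open>q > 0\<close>, so it explodes as f =
  \<open>phi0 F0 (\<rho> * c)\<close> tends to 0; this later keeps limits of minimisers away from
  zeros of \<open>phi0\<close>.\<close>

lemma v_fun_ge:
  assumes "real_distribution F0" "c > 0" "phi0 F0 (\<rho> * c) \<noteq> 0"
  shows "v_fun q F0 c \<rho> \<ge> c powr (-2*q) *
    ((exp (2 * c powr q) - exp ((2 - 2 powr q) * c powr q)) / (2 * (phi0 F0 (\<rho> * c))\<^sup>2)
      + exp ((2 - 2 powr q) * c powr q) - 1)"
proof -
  interpret real_distribution F0 by fact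
  define f where "f = phi0 F0 (\<rho> * c)"
  define b where "b = exp ((2 - 2 powr q) * c powr q)"
  have "f\<^sup>2 > 0" using assms by (simp add: f_def)
  have "(2 * f\<^sup>2 - 1) * b \<le> phi0 F0 (2 * \<rho> * c) * b"
    using phi0_double_ge[of "\<rho> * c"] by (intro mult_right_mono) (auto simp: b_def f_def mult.assoc)
  then have "((2 * f\<^sup>2 - 1) * b) / (2 * f\<^sup>2) \<le> (phi0 F0 (2 * \<rho> * c) * b) / (2 * f\<^sup>2)"
    by (intro divide_right_mono) auto
  moreover have "((2 * f\<^sup>2 - 1) * b) / (2 * f\<^sup>2) = b - b / (2 * f\<^sup>2)"
    using \<open>f\<^sup>2 > 0\<close> by (simp add: field_simps)
  ultimately have "(exp (2 * c powr q) - b) / (2 * f\<^sup>2) + b - 1 \<le>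
     1/2 * exp (2 * c powr q) / f\<^sup>2 + 1/2 * phi0 F0 (2 * \<rho> * c) * b / f\<^sup>2 - 1"
    by (simp add: diff_divide_distrib)
  then have "c powr (-2*q) * ((exp (2 * c powr q) - b) / (2 * f\<^sup>2) + b - 1) \<le>
    c powr (-2*q) * (1/2 * exp (2 * c powr q) / f\<^sup>2 + 1/2 * phi0 F0 (2 * \<rho> * c) * b / f\<^sup>2 - 1)"
    by (rule mult_left_mono) simp
  then show ?thesis
    using assms(2) unfolding v_fun_def f_def b_def by simp
qed

text \<open>The quotient by f^2 has a nonnegative numerator and f^2 <= 1, so f may be replaced by 1.
  The right-hand side is the noiseless variance function: noise never lowers the variance.\<close>

lemma v_fun_ge':
  assumes F0: "real_distribution F0" and c: "c > 0" and f0: "phi0 F0 (\<rho> * c) \<noteq> 0"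
  shows "v_fun q F0 c \<rho> \<ge> c powr (-2*q) *
    ((exp (2 * c powr q) + exp ((2 - 2 powr q) * c powr q)) / 2 - 1)"
proof -
  interpret real_distribution F0 by fact
  define f where "f = phi0 F0 (\<rho> * c)"
  define b where "b = exp ((2 - 2 powr q) * c powr q)"
  have "0 < f\<^sup>2" "f\<^sup>2 \<le> 1"
    using assms abs_phi0_le_1[of "\<rho> * c"] by (auto simp: f_def abs_square_le_1)
  have "b \<le> exp (2 * c powr q)" unfolding b_def by (simp add: mult_right_mono)
  then have "(exp (2 * c powr q) - b) / 2 \<le> (exp (2 * c powr q) - b) / (2 * f\<^sup>2)"
    using \<open>0 < f\<^sup>2\<close> \<open>f\<^sup>2 \<le> 1\<close> by (intro divide_left_mono) auto
  then have "(exp (2 * c powr q) + b) / 2 - 1 \<le> (exp (2 * c powr q) - b) / (2 * f\<^sup>2) + b - 1"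
    by (simp add: field_simps)
  then have "c powr (-2*q) * ((exp (2 * c powr q) + b) / 2 - 1) \<le>
     c powr (-2*q) * ((exp (2 * c powr q) - b) / (2 * f\<^sup>2) + b - 1)"
    by (rule mult_left_mono) simp
  then show ?thesis
    using v_fun_ge[OF assms, of q] unfolding f_def b_def by linarith
qed

text \<open>With x = c^q the linear terms of the two exponentials add up to (4 - 2^q) x, which is
  nonnegative exactly because q <= 2. At q = 2 this sum vanishes, so strictness is taken from the
  quadratic term of the first exponential.\<close>

lemma v_fun_pos:
  assumes "real_distribution F0" "c > 0" "phi0 F0 (\<rho> * c) \<noteq> 0" "q \<le> 2"
  shows "v_fun q F0 c \<rho> > 0"
proof -
  define x where "x = c powr q"
  have "x > 0" using assms by (simp add: x_def)
  have "2 powr q \<le> 2 powr (2::real)" using assms by (intro powr_mono) auto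
  then have "2 powr q \<le> (4::real)" by simp
  have "exp (2 * x) > 1 + 2 * x"
    using exp_lower_Taylor_quadratic[of "2 * x"] \<open>x > 0\<close> by (simp add: power2_eq_square) (smt (verit) mult_pos_pos)
  moreover have "exp ((2 - 2 powr q) * x) \<ge> 1 + (2 - 2 powr q) * x"
    by (rule exp_ge_add_one_self)
  moreover have "2 * x + (2 - 2 powr q) * x = (4 - 2 powr q) * x" by (simp add: algebra_simps)
  moreover have "(4 - 2 powr q) * x \<ge> 0" using \<open>2 powr q \<le> 4\<close> \<open>x > 0\<close> by simp
  ultimately have "(exp (2 * x) + exp ((2 - 2 powr q) * x)) / 2 - 1 > 0" by argo
  then have "c powr (-2*q) * ((exp (2 * x) + exp ((2 - 2 powr q) * x)) / 2 - 1) > 0"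
    using assms by (intro mult_pos_pos) auto
  then show ?thesis using v_fun_ge'[OF assms(1-3), of q] unfolding x_def by linarith
qed

subsection \<open>Continuity of the minimiser\<close>

lemma v_fun_tendsto:
  assumes F0: "real_distribution F0"
    and c: "c > 0" and f0: "phi0 F0 (\<rho> * c) \<noteq> 0"
    and lims: "(a \<longlongrightarrow> c) F" "(r \<longlongrightarrow> \<rho>) F"
  shows "((\<lambda>m. v_fun q F0 (a m) (r m)) \<longlongrightarrow> v_fun q F0 c \<rho>) F"
proof -
  interpret real_distribution F0 by fact
  note * = isCont_tendsto_compose[OF isCont_phi0]
  show ?thesis
    unfolding v_fun_def using c f0
    by (intro tendsto_intros lims * tendsto_rabs) auto
qed

locale noise_min =
  fixes q e \<rho>bar :: real and F0 :: "real measure" and cstar :: "real \<Rightarrow> real"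
  assumes q: "0 < q" "q \<le> 2"
    and F0: "real_distribution F0"
    and symm: "distr F0 borel uminus = F0"
    and zeros: "\<And>t. char F0 t = 0 \<Longrightarrow>
        \<exists>\<delta>>0. \<forall>s. 0 < \<bar>s - t\<bar> \<and> \<bar>s - t\<bar> < \<delta> \<longrightarrow> char F0 s \<noteq> 0"
    and rbar: "\<rho>bar \<ge> 0"
    and e: "e \<ge> 0" "q = 2 \<Longrightarrow> e > 0"
    and unique: "\<And>c1 c2. is_minimizer q F0 e \<rho>bar c1 \<Longrightarrow> is_minimizer q F0 e \<rho>bar c2 \<Longrightarrow> c1 = c2"
    and cstar: "\<And>\<rho>. \<rho> \<ge> 0 \<Longrightarrow> is_minimizer q F0 e \<rho> (cstar \<rho>)"
begin

text \<open>Isolation of the zeros provides one point at which the objective is finite, even if the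
  left end \<open>e\<close> of the range happens to hit a zero. Without such a competitor a
  minimiser could sit at value infinity.\<close>

lemma ex_phi0_nonzero: "\<exists>c>0. c \<ge> e \<and> phi0 F0 (\<rho>bar * c) \<noteq> 0"
proof -
  interpret real_distribution F0 by (rule F0)
  define t where "t = \<rho>bar * e"
  have "\<exists>\<delta>>0. \<forall>s. 0 < \<bar>s - t\<bar> \<and> \<bar>s - t\<bar> < \<delta> \<longrightarrow> phi0 F0 s \<noteq> 0"
  proof (cases "phi0 F0 t = 0")
    case True
    then show ?thesis using zeros[of t] char_eq_phi0[OF symm] by simp
  next
    case False
    then have "eventually (\<lambda>s. phi0 F0 s \<noteq> 0) (at t)"
      using isCont_phi0[of t] tendsto_imp_eventually_ne unfolding isCont_def by blast
    then show ?thesis by (auto simp: eventually_at dist_real_def)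
  qed
  then obtain d where d: "d > 0" "\<And>s. 0 < \<bar>s - t\<bar> \<Longrightarrow> \<bar>s - t\<bar> < d \<Longrightarrow> phi0 F0 s \<noteq> 0" by blast
  show ?thesis
  proof (cases "\<rho>bar = 0")
    case True
    then show ?thesis using e by (intro exI[of _ "e + 1"]) auto
  next
    case False
    \<comment> \<open>The point is chosen so that \<open>\<rho>bar * c\<close> lies d/2 to the right
      of t, inside the punctured zero-free neighbourhood.\<close>
    define c where "c = e + d / (2 * \<rho>bar)"
    have "\<rho>bar * c - t = d / 2" using False by (simp add: c_def t_def field_simps)
    then have "phi0 F0 (\<rho>bar * c) \<noteq> 0" using d by (intro d(2)) auto
    moreover have "c > 0" "c \<ge> e" using d(1) False rbar e by (auto simp: c_def add_nonneg_pos)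
    ultimately show ?thesis by blast
  qed
qed

text \<open>\<open>v_tilde\<close> is infinite at the exceptional points, so a single competitor
  with finite value forces the minimiser to be a regular point.\<close>

lemma minimizer_imp_finite:
  assumes "is_minimizer q F0 e \<rho> c" "c' > 0" "c' \<ge> e" "phi0 F0 (\<rho> * c') \<noteq> 0"
  shows "c > 0" "c \<ge> e" "phi0 F0 (\<rho> * c) \<noteq> 0" "v_fun q F0 c \<rho> \<le> v_fun q F0 c' \<rho>"
proof -
  have "v_tilde q F0 c \<rho> \<le> v_tilde q F0 c' \<rho>" "c \<ge> e"
    using assms unfolding is_minimizer_def by auto
  then show "c > 0" "c \<ge> e" "phi0 F0 (\<rho> * c) \<noteq> 0" "v_fun q F0 c \<rho> \<le> v_fun q F0 c' \<rho>"
    using assms e by (auto simp: v_tilde_def split: if_splits)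
qed

lemma cstar_rbar:
  "cstar \<rho>bar > 0" "cstar \<rho>bar \<ge> e" "phi0 F0 (\<rho>bar * cstar \<rho>bar) \<noteq> 0"
proof -
  obtain c' where "c' > 0" "c' \<ge> e" "phi0 F0 (\<rho>bar * c') \<noteq> 0"
    using ex_phi0_nonzero by blast
  from minimizer_imp_finite[OF cstar[OF rbar] this]
  show "cstar \<rho>bar > 0" "cstar \<rho>bar \<ge> e" "phi0 F0 (\<rho>bar * cstar \<rho>bar) \<noteq> 0" by auto
qed

text \<open>The lower bounds on the variance function do not involve the noise law, so sublevel sets
  are compact uniformly in the noise-to-signal ratio.\<close>

lemma v_fun_le_imp_bounds:
  "\<exists>a b. 0 < a \<and> (\<forall>c \<rho>. c > 0 \<longrightarrow> c \<ge> e \<longrightarrow> phi0 F0 (\<rho> * c) \<noteq> 0 \<longrightarrow> v_fun q F0 c \<rho> \<le> V \<longrightarrow>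
      a \<le> c \<and> c \<le> b)"
proof -
  define g where "g = (\<lambda>c. c powr (-2*q) * (exp (2 * c powr q) / 2 - 1))"
  have "filterlim g at_top at_top" unfolding g_def using q by real_asymp
  then have "eventually (\<lambda>c. g c > V) at_top" by (simp add: filterlim_at_top_dense)
  then obtain b where b: "\<And>c. c \<ge> b \<Longrightarrow> g c > V" by (auto simp: eventually_at_top_linorder)
  have ub: "c \<le> b" if "c > 0" "phi0 F0 (\<rho> * c) \<noteq> 0" "v_fun q F0 c \<rho> \<le> V" for c \<rho>
  proof (rule ccontr)
    assume "\<not> c \<le> b"
    then have "V < g c" using b by simp
    also have "g c \<le> c powr (-2*q) * ((exp (2 * c powr q) + exp ((2 - 2 powr q) * c powr q)) / 2 - 1)"
      unfolding g_def by (intro mult_left_mono) auto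
    also have "\<dots> \<le> v_fun q F0 c \<rho>" using v_fun_ge'[OF F0 that(1,2)] .
    finally show False using that by simp
  qed
  have "\<exists>a>0. \<forall>c \<rho>. c > 0 \<longrightarrow> c \<ge> e \<longrightarrow> phi0 F0 (\<rho> * c) \<noteq> 0 \<longrightarrow> v_fun q F0 c \<rho> \<le> V \<longrightarrow> a \<le> c"
  proof (cases "q = 2")
    \<comment> \<open>For q = 2 the noiseless bound tends to the finite value 2 as c tends to 0 and
      cannot exclude small c; the cutoff \<open>e > 0\<close> does.\<close>
    case True
    then show ?thesis using e by (intro exI[of _ e]) auto
  next
    case False
    then have "2 powr q < 2 powr (2::real)" using q by (intro powr_less_mono) auto
    then have D: "4 - 2 powr q > 0" by simp
    \<comment> \<open>The linear part of the bound gives (4 - 2^q) / (2 x) <= |V| + 1 for x = c^q;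
      solving for c produces this value.\<close>
    define a where "a = ((4 - 2 powr q) / (2 * (\<bar>V\<bar> + 1))) powr (1/q)"
    have "a > 0" using D by (simp add: a_def)
    have "a \<le> c" if "c > 0" "phi0 F0 (\<rho> * c) \<noteq> 0" "v_fun q F0 c \<rho> \<le> V" for c \<rho>
    proof -
      define x where "x = c powr q"
      have x: "x > 0" using that by (simp add: x_def)
      have cx: "c powr (-2*q) = 1 / x\<^sup>2"
        using that by (simp add: x_def powr_minus_divide powr_powr[symmetric] mult.commute flip: powr_numeral)

      have "(4 - 2 powr q) / 2 * x \<le> (exp (2 * x) + exp ((2 - 2 powr q) * x)) / 2 - 1"
        using exp_ge_add_one_self[of "2 * x"] exp_ge_add_one_self[of "(2 - 2 powr q) * x"]
        by (simp only: algebra_simps) argo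
      then have "1 / x\<^sup>2 * ((4 - 2 powr q) / 2 * x) \<le> 1 / x\<^sup>2 * ((exp (2 * x) + exp ((2 - 2 powr q) * x)) / 2 - 1)"
        by (intro mult_left_mono) auto
      also have "\<dots> \<le> V"
        using order_trans[OF v_fun_ge'[OF F0 that(1,2), of q] that(3)] unfolding cx x_def .
      also have "V \<le> \<bar>V\<bar> + 1" by simp
      also have "1 / x\<^sup>2 * ((4 - 2 powr q) / 2 * x) = (4 - 2 powr q) / 2 / x"
        using x by (simp add: power2_eq_square)
      finally have "(4 - 2 powr q) / 2 \<le> (\<bar>V\<bar> + 1) * x" using x by (simp add: divide_le_eq)
      then have "(4 - 2 powr q) / (2 * (\<bar>V\<bar> + 1)) \<le> x"
        by (simp add: divide_le_eq mult.commute mult.left_commute)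
      then have "a \<le> x powr (1/q)" unfolding a_def using D q by (intro powr_mono2) auto
      also have "\<dots> = c" using q that by (simp add: x_def powr_powr)
      finally show ?thesis .
    qed
    then show ?thesis using \<open>a > 0\<close> by blast
  qed
  then show ?thesis using ub by blast
qed

text \<open>A subsequence of minimisers staying away from \<open>cstar \<rho>bar\<close> would have
  a limit point by compactness. That point is shown to minimise at \<open>\<rho>bar\<close>, against
  uniqueness there; no uniqueness is assumed at the approximating ratios.\<close>

lemma cstar_tendsto_sequentially:
  assumes r: "r \<longlonglongrightarrow> \<rho>bar" "\<And>m. r m \<ge> 0"
  shows "(\<lambda>m. cstar (r m)) \<longlonglongrightarrow> cstar \<rho>bar"
proof (rule ccontr)
  interpret real_distribution F0 by (rule F0)
  define c0 where "c0 = cstar \<rho>bar"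
  assume "\<not> (\<lambda>m. cstar (r m)) \<longlonglongrightarrow> cstar \<rho>bar"
  then obtain \<epsilon> where \<epsilon>: "\<epsilon> > 0" "\<not> eventually (\<lambda>m. \<bar>cstar (r m) - c0\<bar> < \<epsilon>) sequentially"
    by (auto simp: tendsto_iff dist_real_def c0_def)
  then have "\<exists>\<^sub>F m in sequentially. \<not> \<bar>cstar (r m) - c0\<bar> < \<epsilon>"
    by (simp add: frequently_def)
  then have "infinite {m. \<not> \<bar>cstar (r m) - c0\<bar> < \<epsilon>}"
    by (simp add: frequently_cofinite[symmetric] cofinite_eq_sequentially)
  from infinite_enumerate[OF this] obtain s :: "nat \<Rightarrow> nat"
    where s0: "strict_mono s" "\<forall>m. s m \<in> {m. \<not> \<bar>cstar (r m) - c0\<bar> < \<epsilon>}"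
    by blast
  then have s: "strict_mono s" "\<not> \<bar>cstar (r (s m)) - c0\<bar> < \<epsilon>" for m by auto
  define c where "c m = cstar (r (s m))" for m
  have rs: "(\<lambda>m. r (s m)) \<longlonglongrightarrow> \<rho>bar"
    using LIMSEQ_subseq_LIMSEQ[OF r(1) s(1)] by (simp add: comp_def)
  have c0: "c0 > 0" "c0 \<ge> e" "phi0 F0 (\<rho>bar * c0) \<noteq> 0" using cstar_rbar by (simp_all add: c0_def)
  have f0: "(\<lambda>m. phi0 F0 (r (s m) * c0)) \<longlonglongrightarrow> phi0 F0 (\<rho>bar * c0)"
    by (intro isCont_tendsto_compose[OF isCont_phi0] tendsto_intros rs)
  have ev0: "eventually (\<lambda>m. phi0 F0 (r (s m) * c0) \<noteq> 0) sequentially"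
    using tendsto_imp_eventually_ne[OF f0 c0(3)] .
  have v0: "(\<lambda>m. v_fun q F0 c0 (r (s m))) \<longlonglongrightarrow> v_fun q F0 c0 \<rho>bar"
    by (intro v_fun_tendsto F0 c0 rs tendsto_const)
  \<comment> \<open>The fixed competitor \<open>c0\<close> has values converging to V - 1, so the
    minimal values are eventually at most V and the minimisers stay in one compact interval.\<close>
  define V where "V = v_fun q F0 c0 \<rho>bar + 1"
  have "eventually (\<lambda>m. v_fun q F0 c0 (r (s m)) < V) sequentially"
    using v0 by (rule order_tendstoD) (simp add: V_def)
  with ev0 have ev: "eventually (\<lambda>m. c m > 0 \<and> c m \<ge> e \<and> phi0 F0 (r (s m) * c m) \<noteq> 0 \<and>
      v_fun q F0 (c m) (r (s m)) \<le> V) sequentially"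
  proof eventually_elim
    case (elim m)
    show ?case
      using minimizer_imp_finite[OF cstar[OF r(2)] c0(1,2) elim(1)] elim(2) by (auto simp: c_def)
  qed
  obtain a b where ab: "0 < a" "\<And>c \<rho>. c > 0 \<Longrightarrow> c \<ge> e \<Longrightarrow> phi0 F0 (\<rho> * c) \<noteq> 0 \<Longrightarrow>
      v_fun q F0 c \<rho> \<le> V \<Longrightarrow> a \<le> c \<and> c \<le> b"
    using v_fun_le_imp_bounds by metis
  from ev obtain m0 where m0: "\<And>m. m \<ge> m0 \<Longrightarrow> c m > 0 \<and> c m \<ge> e \<and> phi0 F0 (r (s m) * c m) \<noteq> 0 \<and>
      v_fun q F0 (c m) (r (s m)) \<le> V"
    by (auto simp: eventually_sequentially)
  have "\<forall>m. c (m + m0) \<in> {a..b}"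
    using ab(2)[of "c (m + m0)" "r (s (m + m0))" for m] m0[of "m + m0" for m] by simp
  then obtain c1 s' where s': "c1 \<in> {a..b}" "strict_mono s'" "(\<lambda>m. c (s' m + m0)) \<longlonglongrightarrow> c1"
    using seq_compactE[OF compact_imp_seq_compact[OF compact_Icc[of a b]], of "\<lambda>m. c (m + m0)"]
    by (auto simp: comp_def)
  define d where "d m = c (s' m + m0)" for m
  define \<rho> where "\<rho> m = r (s (s' m + m0))" for m
  have d: "d \<longlonglongrightarrow> c1" using s' by (simp add: d_def[abs_def])
  have \<rho>: "\<rho> \<longlonglongrightarrow> \<rho>bar"
  proof -
    have "strict_mono (\<lambda>m. s' m + m0)" using s'(2) by (simp add: strict_mono_def)
    from LIMSEQ_subseq_LIMSEQ[OF rs this] show ?thesis by (simp add: comp_def \<rho>_def[abs_def])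
  qed
  have dp: "d m > 0" "d m \<ge> e" "phi0 F0 (\<rho> m * d m) \<noteq> 0" "v_fun q F0 (d m) (\<rho> m) \<le> V" for m
    using m0[of "s' m + m0"] by (auto simp: d_def \<rho>_def)
  have c1: "c1 > 0" "c1 \<ge> e"
    using s' ab LIMSEQ_le_const[OF d] dp(2) by auto
  have fd: "(\<lambda>m. phi0 F0 (\<rho> m * d m)) \<longlonglongrightarrow> phi0 F0 (\<rho>bar * c1)"
    by (intro isCont_tendsto_compose[OF isCont_phi0] tendsto_intros \<rho> d)
  \<comment> \<open>\<open>v_fun_ge\<close> bounds B / f^2 + D by V along the sequence. After
    multiplication by f^2, a limit f = 0 would give B c1 <= 0.\<close>
  have nz: "phi0 F0 (\<rho>bar * c1) \<noteq> 0"
  proof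
    assume z: "phi0 F0 (\<rho>bar * c1) = 0"
    define B where "B c = c powr (-2*q) * ((exp (2 * c powr q) - exp ((2 - 2 powr q) * c powr q)) / 2)" for c
    define D where "D c = c powr (-2*q) * (exp ((2 - 2 powr q) * c powr q) - 1)" for c
    have B: "(\<lambda>m. B (d m)) \<longlonglongrightarrow> B c1" and D: "(\<lambda>m. D (d m)) \<longlonglongrightarrow> D c1"
      unfolding B_def D_def using c1 by (auto intro!: tendsto_intros d)
    have "B c1 > 0" unfolding B_def using c1 q by (intro mult_pos_pos) auto
    have "(\<lambda>m. (V - D (d m)) * (phi0 F0 (\<rho> m * d m))\<^sup>2) \<longlonglongrightarrow> (V - D c1) * 0\<^sup>2"
      using fd unfolding z by (intro tendsto_intros D)
    moreover have "B (d m) \<le> (V - D (d m)) * (phi0 F0 (\<rho> m * d m))\<^sup>2" for m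
    proof -
      define w where "w = (phi0 F0 (\<rho> m * d m))\<^sup>2"
      have w: "w > 0" using dp(3) by (simp add: w_def)
      have "B (d m) / w + D (d m) \<le> V"
        using v_fun_ge[OF F0 dp(1)[of m] dp(3)[of m], where q = q] dp(4)[of m]
        unfolding B_def D_def w_def[symmetric] by (simp add: algebra_simps)
      then show ?thesis using w by (simp add: field_simps w_def[symmetric])
    qed
    ultimately have "B c1 \<le> (V - D c1) * 0\<^sup>2"
      using LIMSEQ_le[OF B] by blast
    with \<open>B c1 > 0\<close> show False by simp
  qed
  have "is_minimizer q F0 e \<rho>bar c1"
    unfolding is_minimizer_def
  proof (intro conjI allI impI)
    show "c1 \<ge> e" by fact
    fix c' assume c': "c' \<ge> e"
    show "v_tilde q F0 c1 \<rho>bar \<le> v_tilde q F0 c' \<rho>bar"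
    proof (cases "c' \<noteq> 0 \<and> phi0 F0 (\<rho>bar * c') \<noteq> 0")
      case True
      then have "c' > 0" using c' e by simp
      have "(\<lambda>m. phi0 F0 (\<rho> m * c')) \<longlonglongrightarrow> phi0 F0 (\<rho>bar * c')"
        by (intro isCont_tendsto_compose[OF isCont_phi0] tendsto_intros \<rho>)
      from tendsto_imp_eventually_ne[OF this] True
      have "eventually (\<lambda>m. phi0 F0 (\<rho> m * c') \<noteq> 0) sequentially" by blast
      then have "eventually (\<lambda>m. v_fun q F0 (d m) (\<rho> m) \<le> v_fun q F0 c' (\<rho> m)) sequentially"
      proof eventually_elim
        case (elim m)
        show ?case using minimizer_imp_finite(4)[OF cstar[OF r(2)] \<open>c' > 0\<close> c'] elim
          by (simp add: d_def \<rho>_def c_def)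
      qed
      moreover have "(\<lambda>m. v_fun q F0 (d m) (\<rho> m)) \<longlonglongrightarrow> v_fun q F0 c1 \<rho>bar"
        by (intro v_fun_tendsto F0 c1 nz d \<rho>)
      moreover have "(\<lambda>m. v_fun q F0 c' (\<rho> m)) \<longlonglongrightarrow> v_fun q F0 c' \<rho>bar"
        using True by (intro v_fun_tendsto F0 \<open>c' > 0\<close> tendsto_const \<rho>) auto
      ultimately have "v_fun q F0 c1 \<rho>bar \<le> v_fun q F0 c' \<rho>bar"
        using tendsto_le[OF sequentially_bot] by blast
      then show ?thesis using c1 nz True by (simp add: v_tilde_def)
    qed (auto simp: v_tilde_def)
  qed
  from unique[OF this cstar[OF rbar]] have "c1 = c0" by (simp add: c0_def)
  have "(\<lambda>m. \<bar>d m - c0\<bar>) \<longlonglongrightarrow> \<bar>c1 - c0\<bar>" by (intro tendsto_intros d)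
  moreover have "\<epsilon> \<le> \<bar>d m - c0\<bar>" for m using s(2)[of "s' m + m0"] by (simp add: d_def c_def)
  ultimately have "\<epsilon> \<le> \<bar>c1 - c0\<bar>" by (intro LIMSEQ_le_const) auto
  then show False using \<epsilon> \<open>c1 = c0\<close> by simp
qed

lemma cstar_continuous: "continuous (at \<rho>bar within {0..}) cstar"
  unfolding continuous_within_sequentially
  using cstar_tendsto_sequentially by (auto simp: comp_def)

end

subsection \<open>Medians, and Gaussian smoothing of characteristic functions\<close>

text \<open>Order statistics are expressed through counts, which serves both the deviation bounds
  and the measurability of the median.\<close>

lemma sorted_nth_le_iff:
  fixes xs :: "'a :: linorder list"
  assumes "sorted xs" "j < length xs"
  shows "xs ! j \<le> u \<longleftrightarrow> j < length (filter (\<lambda>x. x \<le> u) xs)"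
  using assms
proof (induction xs arbitrary: j)
  case (Cons x xs)
  show ?case
  proof (cases "x \<le> u")
    case True
    then show ?thesis using Cons by (cases j) auto
  next
    case False
    then have "filter (\<lambda>x. x \<le> u) xs = []" using Cons.prems by (auto simp: filter_empty_conv)
    then show ?thesis using False Cons.prems by (cases j) (auto simp: not_le less_le_trans)
  qed
qed auto

lemma length_filter_sort: "length (filter P (sort xs)) = length (filter P xs)"
  by (metis size_mset mset_filter mset_sort)

lemma length_filter_map_upt: "length (filter P (map f [0..<n])) = card {i. i < n \<and> P (f i)}"
  by (auto simp: length_filter_conv_card intro!: arg_cong[where f=card])

lemma sort_nth_le_iff:
  fixes f :: "nat \<Rightarrow> 'a :: linorder"
  assumes "j < n"
  shows "sort (map f [0..<n]) ! j \<le> u \<longleftrightarrow> j < card {i. i < n \<and> f i \<le> u}"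
  using assms sorted_nth_le_iff[of "sort (map f [0..<n])" j u]
  unfolding length_filter_sort length_filter_map_upt by simp

text \<open>A quarter instead of a half leaves room for both middle order statistics of an even
  sample, at the cost of a factor 4 in the Markov bound on the count.\<close>

lemma median_upper:
  assumes "n \<ge> 1" "4 * card {i. i < n \<and> f i > u} < n"
  shows "median n f \<le> u"
proof -
  have "{..<n} = {i. i < n \<and> f i \<le> u} \<union> {i. i < n \<and> f i > u}" by auto
  then have "n = card {i. i < n \<and> f i \<le> u} + card {i. i < n \<and> f i > u}"
    using card_Un_disjoint[of "{i. i < n \<and> f i \<le> u}" "{i. i < n \<and> f i > u}"] card_lessThan[of n] by force
  then have *: "n div 2 < card {i. i < n \<and> f i \<le> u}" using assms by linarith
  have "sort (map f [0..<n]) ! j \<le> u" if "j \<le> n div 2" for j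
    using assms * that by (subst sort_nth_le_iff) auto
  from this[of "n div 2"] this[of "n div 2 - 1"] show ?thesis
    by (auto simp: median_def Let_def)
qed

lemma median_lower:
  assumes "n \<ge> 4" "4 * card {i. i < n \<and> f i \<le> l} < n"
  shows "median n f > l"
proof -
  have "sort (map f [0..<n]) ! j > l" if "j < n" "j \<ge> n div 2 - 1" for j
    using assms that by (subst not_le[symmetric], subst sort_nth_le_iff) auto
  from this[of "n div 2"] this[of "n div 2 - 1"]
  have "sort (map f [0..<n]) ! (n div 2) > l" "sort (map f [0..<n]) ! (n div 2 - 1) > l"
    using assms by auto
  then show ?thesis by (simp add: median_def Let_def)
qed

lemma borel_measurable_median:
  fixes f :: "nat \<Rightarrow> 'a \<Rightarrow> real"
  assumes f [measurable]: "\<And>i. i < n \<Longrightarrow> f i \<in> borel_measurable M"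
  shows "(\<lambda>\<omega>. median n (\<lambda>i. f i \<omega>)) \<in> borel_measurable M"
proof (cases "n = 0")
  case True
  then show ?thesis by (simp add: median_def)
next
  case False
  have *: "(\<lambda>\<omega>. sort (map (\<lambda>i. f i \<omega>) [0..<n]) ! j) \<in> borel_measurable M" if "j < n" for j
  proof (subst borel_measurable_iff_le, safe)
    fix a
    have "card {i. i < n \<and> f i \<omega> \<le> a} = (\<Sum>i<n. if f i \<omega> \<le> a then 1 else 0)" for \<omega>
    proof -
      have "{i. i < n \<and> f i \<omega> \<le> a} = {..<n} \<inter> {i. f i \<omega> \<le> a}" by auto
      then show ?thesis by (simp add: sum.If_cases)
    qed
    then have "{\<omega> \<in> space M. sort (map (\<lambda>i. f i \<omega>) [0..<n]) ! j \<le> a} =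
        {\<omega> \<in> space M. j < (\<Sum>i<n. if f i \<omega> \<le> a then 1 else 0)}"
      using that by (subst sort_nth_le_iff) auto
    also have "\<dots> \<in> sets M" by measurable
    finally show "{\<omega> \<in> space M. sort (map (\<lambda>i. f i \<omega>) [0..<n]) ! j \<le> a} \<in> sets M" .
  qed
  show ?thesis
    unfolding median_def Let_def using False
    by (cases "odd n") (auto intro!: * borel_measurable_divide borel_measurable_add)
qed

text \<open>Pointwise comparison of the truncated square with one minus the Gaussian kernel; for x
  in [0,1] it reduces to (1 - x/4) (1 + x/2) >= 1.\<close>

lemma one_minus_exp_ge: "1 - exp (- (y\<^sup>2 / 2)) \<ge> min 1 (y\<^sup>2) / 4" for y :: real
proof -
  define x where "x = min 1 (y\<^sup>2)"
  have x: "0 \<le> x" "x \<le> 1" "x \<le> y\<^sup>2" by (auto simp: x_def)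
  have "exp (- (y\<^sup>2 / 2)) \<le> exp (- (x / 2))" using x by simp
  also have "\<dots> = 1 / exp (x / 2)" by (simp add: exp_minus inverse_eq_divide)
  also have "\<dots> \<le> 1 / (1 + x / 2)" using x exp_ge_add_one_self[of "x / 2"] by (intro divide_left_mono) (auto simp del: exp_ge_add_one_self)
  also have "\<dots> \<le> 1 - x / 4"
  proof -
    have "x * x \<le> x * 1" using x by (intro mult_left_mono)
    then have "1 \<le> (1 - x / 4) * (1 + x / 2)" using x by (simp add: algebra_simps)
    then show ?thesis using x by (subst divide_le_eq) auto
  qed
  finally show ?thesis by (simp add: x_def)
qed

context prob_space
begin

text \<open>Integrating the characteristic function against a Gaussian law gives the Gaussian transform of
  the random variable, which controls both its tails and its concentration near zero.\<close>

lemma expectation_gauss: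
  fixes Z :: "'a \<Rightarrow> real" and \<psi> :: "real \<Rightarrow> real"
  assumes Z [measurable]: "random_variable borel Z"
    and \<psi>: "\<And>u. expectation (\<lambda>\<omega>. cos (u * Z \<omega>)) = \<psi> u"
  shows "expectation (\<lambda>\<omega>. exp (- ((a * Z \<omega>)\<^sup>2 / 2))) = (LINT w|std_normal_distribution. \<psi> (a * w))"
proof -
  interpret N: real_distribution std_normal_distribution by (rule real_dist_normal_dist)
  interpret P: pair_prob_space M std_normal_distribution ..
  have g: "(LINT w|std_normal_distribution. cos (t * w)) = exp (- (t\<^sup>2 / 2))" for t
    using N.phi0_eq_integral[of t] by (simp add: phi0_def char_std_normal_distribution Re_exp)
  have inner: "(\<integral>\<omega>. cos (a * Z \<omega> * w) \<partial>M) = \<psi> (a * w)" for w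
    using \<psi>[of "a * w"] by (simp add: mult_ac)
  have "expectation (\<lambda>\<omega>. exp (- ((a * Z \<omega>)\<^sup>2 / 2))) =
      (\<integral>\<omega>. (\<integral>w. cos (a * Z \<omega> * w) \<partial>std_normal_distribution) \<partial>M)"
    by (simp only: g)
  also have "\<dots> = (\<integral>w. (\<integral>\<omega>. cos (a * Z \<omega> * w) \<partial>M) \<partial>std_normal_distribution)"
    by (rule P.Fubini_integral[symmetric], rule P.integrable_const_bound[where B=1]) auto
  also have "\<dots> = (\<integral>w. \<psi> (a * w) \<partial>std_normal_distribution)"
    by (simp only: inner)
  finally show ?thesis .
qed

text \<open>On the event the Gaussian kernel is at least 1 - 1/2, which explains the factor 2. It
  keeps the sample median away from zero.\<close>

lemma prob_small_le_gauss:
  fixes Z :: "'a \<Rightarrow> real" and \<psi> :: "real \<Rightarrow> real"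
  assumes Z [measurable]: "random_variable borel Z"
    and \<psi>: "\<And>u. expectation (\<lambda>\<omega>. cos (u * Z \<omega>)) = \<psi> u" and "a > 0"
  shows "prob {\<omega> \<in> space M. \<bar>Z \<omega>\<bar> \<le> 1 / a} \<le> 2 * (LINT w|std_normal_distribution. \<psi> (a * w))"
proof -
  have "(1 / 2) * indicator {\<omega> \<in> space M. \<bar>Z \<omega>\<bar> \<le> 1 / a} \<omega> \<le> exp (- ((a * Z \<omega>)\<^sup>2 / 2))" for \<omega>
  proof (cases "\<omega> \<in> space M \<and> \<bar>Z \<omega>\<bar> \<le> 1 / a")
    case True
    then have "\<bar>a * Z \<omega>\<bar> \<le> 1" using \<open>a > 0\<close> by (simp add: abs_mult field_simps)
    then have "(a * Z \<omega>)\<^sup>2 \<le> 1" by (simp add: abs_square_le_1)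
    then have "1 - 1/2 \<le> 1 + - ((a * Z \<omega>)\<^sup>2 / 2)" by simp
    also have "\<dots> \<le> exp (- ((a * Z \<omega>)\<^sup>2 / 2))" by (rule exp_ge_add_one_self)
    finally show ?thesis using True by simp
  qed auto
  moreover have "integrable M (\<lambda>\<omega>. exp (- ((a * Z \<omega>)\<^sup>2 / 2)))"
    by (rule integrable_const_bound[where B=1]) auto
  moreover have "integrable M (\<lambda>\<omega>. (1 / 2) * indicator {\<omega> \<in> space M. \<bar>Z \<omega>\<bar> \<le> 1 / a} \<omega> :: real)"
    by (rule integrable_const_bound[where B=1]) (auto simp: indicator_def)
  ultimately have "expectation (\<lambda>\<omega>. (1 / 2) * indicator {\<omega> \<in> space M. \<bar>Z \<omega>\<bar> \<le> 1 / a} \<omega>) \<le>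
      expectation (\<lambda>\<omega>. exp (- ((a * Z \<omega>)\<^sup>2 / 2)))"
    by (intro integral_mono)
  then show ?thesis unfolding expectation_gauss[OF Z \<psi>] by simp
qed

text \<open>The counterpart for large values: the behaviour of 1 - \<psi> near 0 becomes a bound on
  a truncated second moment, which always exists.\<close>

lemma expectation_min_square_le_gauss:
  fixes Z :: "'a \<Rightarrow> real" and \<psi> :: "real \<Rightarrow> real"
  assumes Z [measurable]: "random_variable borel Z"
    and \<psi>: "\<And>u. expectation (\<lambda>\<omega>. cos (u * Z \<omega>)) = \<psi> u"
    and \<psi>_meas: "integrable std_normal_distribution (\<lambda>w. \<psi> (h * w))"
  shows "expectation (\<lambda>\<omega>. min 1 ((h * Z \<omega>)\<^sup>2)) \<le> 4 * (LINT w|std_normal_distribution. 1 - \<psi> (h * w))"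
proof -
  interpret N: real_distribution std_normal_distribution by (rule real_dist_normal_dist)
  have i: "integrable M (\<lambda>\<omega>. exp (- ((h * Z \<omega>)\<^sup>2 / 2)))"
    by (rule integrable_const_bound[where B=1]) auto
  have "expectation (\<lambda>\<omega>. min 1 ((h * Z \<omega>)\<^sup>2)) \<le> expectation (\<lambda>\<omega>. 4 * (1 - exp (- ((h * Z \<omega>)\<^sup>2 / 2))))"
  proof (rule integral_mono)
    show "integrable M (\<lambda>\<omega>. min 1 ((h * Z \<omega>)\<^sup>2))"
      by (rule integrable_const_bound[where B=1]) auto
    show "integrable M (\<lambda>\<omega>. 4 * (1 - exp (- ((h * Z \<omega>)\<^sup>2 / 2))))"
      using i by simp
    show "min 1 ((h * Z \<omega>)\<^sup>2) \<le> 4 * (1 - exp (- ((h * Z \<omega>)\<^sup>2 / 2)))" for \<omega>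
      using one_minus_exp_ge[of "h * Z \<omega>"] by simp
  qed
  also have "\<dots> = 4 * (1 - expectation (\<lambda>\<omega>. exp (- ((h * Z \<omega>)\<^sup>2 / 2))))"
    using i prob_space by simp
  also have "\<dots> = 4 * (LINT w|std_normal_distribution. 1 - \<psi> (h * w))"
    using \<psi>_meas N.prob_space by (simp add: expectation_gauss[OF Z \<psi>])
  finally show ?thesis .
qed

text \<open>No moments of \<^term>\<open>Z\<close> are needed: it may be a stable variable of index at most one.\<close>

lemma expectation_envelope_le:
  fixes Z :: "'a \<Rightarrow> real" and \<psi> :: "real \<Rightarrow> real"
  assumes Z [measurable]: "random_variable borel Z"
    and \<psi>: "\<And>u. expectation (\<lambda>\<omega>. cos (u * Z \<omega>)) = \<psi> u"
    and [measurable]: "\<psi> \<in> borel_measurable borel"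
    and q: "0 < q" "q \<le> 2" and K: "K \<ge> 0"
    and bnd: "\<And>u. 1 - \<psi> u \<le> \<bar>u\<bar> powr q + K * \<bar>u\<bar>"
    and h: "h > 0"
  shows "expectation (\<lambda>\<omega>. min 2 (h * \<bar>Z \<omega>\<bar>)) \<le> 8 * (1 + K) * h powr (q / 4)"
proof -
  interpret N: real_distribution std_normal_distribution by (rule real_dist_normal_dist)
  have [measurable]: "(\<lambda>w. \<psi> (h * w)) \<in> borel_measurable borel" by measurable
  have \<psi>1: "\<bar>\<psi> u\<bar> \<le> 1" for u
  proof -
    have "\<bar>expectation (\<lambda>\<omega>. cos (u * Z \<omega>))\<bar> \<le> expectation (\<lambda>\<omega>. \<bar>cos (u * Z \<omega>)\<bar>)"
      by simp
    also have "\<dots> \<le> expectation (\<lambda>\<omega>. 1)"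
      by (intro integral_mono integrable_const_bound[where B=1]) auto
    finally show ?thesis by (simp add: \<psi> prob_space)
  qed
  have env: "expectation (\<lambda>\<omega>. min 2 (h * \<bar>Z \<omega>\<bar>)) \<le> 2"
    using h by (intro integral_le_const integrable_const_bound[where B=2]) auto
  show ?thesis
  proof (cases "h \<ge> 1")
    case True
    then have "1 \<le> h powr (q / 4)" using q by (simp add: ge_one_powr_ge_zero)
    then have "8 * 1 * 1 \<le> 8 * (1 + K) * h powr (q / 4)" using K by (intro mult_mono) auto
    then show ?thesis using env by simp
  next
    case False
    \<comment> \<open>For h < 1 and q <= 2 both h^q (stable part) and h (noise part) are at most
      h^(q/2), so a single power covers both.\<close>
    define r where "r = h powr (q / 2)"
    have r: "0 < r" "r \<le> 1" unfolding r_def using h False q by (auto simp: powr_le1)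
    have hq: "h powr q \<le> r" "h \<le> r" unfolding r_def
      using h False q powr_mono'[of "q/2" q h] powr_mono'[of "q/2" 1 h] by auto
    \<comment> \<open>Growth at most quadratic makes the bound integrable against the standard
      normal law, where 1 + w^2 has mean 2.\<close>
    have w: "\<bar>w\<bar> powr q \<le> 1 + w\<^sup>2" for w :: real
    proof (cases "\<bar>w\<bar> \<le> 1")
      case True
      then have "\<bar>w\<bar> powr q \<le> 1" using q by (intro powr_le1) auto
      then show ?thesis by (simp add: add_increasing2)
    next
      case False
      then have "\<bar>w\<bar> powr q \<le> \<bar>w\<bar> powr 2" using q by (intro powr_mono) auto
      then show ?thesis using False by (simp add: powr_numeral)
    qed
    have aw: "\<bar>w\<bar> \<le> 1 + w\<^sup>2" for w :: real
      using zero_le_power2[of "\<bar>w\<bar> - 1"] by (simp add: power2_diff)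
    have pt: "1 - \<psi> (h * w) \<le> (1 + K) * r * (1 + w\<^sup>2)" for w
    proof -
      have "1 - \<psi> (h * w) \<le> \<bar>h * w\<bar> powr q + K * \<bar>h * w\<bar>" by (rule bnd)
      also have "\<dots> = h powr q * \<bar>w\<bar> powr q + K * (h * \<bar>w\<bar>)"
        using h by (simp add: abs_mult powr_mult)
      also have "\<dots> \<le> r * (1 + w\<^sup>2) + K * (r * (1 + w\<^sup>2))"
        using hq w aw K h r by (intro add_mono mult_mono mult_left_mono) auto
      finally show ?thesis by (simp add: algebra_simps)
    qed
    have w2: "integrable std_normal_distribution (\<lambda>w. w\<^sup>2)"
      by (rule integrable_std_normal_distribution_moment)
    have w2': "(LINT w|std_normal_distribution. w\<^sup>2) = 1"
      using std_normal_distribution_even_moments(1)[of 1] by (simp add: fact_numeral)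
    have i\<psi>: "integrable std_normal_distribution (\<lambda>w. \<psi> (h * w))"
      using \<psi>1 by (intro N.integrable_const_bound[where B=1]) auto
    have "(LINT w|std_normal_distribution. 1 - \<psi> (h * w)) \<le>
        (LINT w|std_normal_distribution. (1 + K) * r * (1 + w\<^sup>2))"
      using pt w2 i\<psi> by (intro integral_mono) auto
    also have "\<dots> = 2 * (1 + K) * r"
      using w2 w2' N.prob_space by simp
    finally have "expectation (\<lambda>\<omega>. min 1 ((h * Z \<omega>)\<^sup>2)) \<le> 8 * (1 + K) * r"
      using expectation_min_square_le_gauss[OF Z \<psi> i\<psi>] by argo
    \<comment> \<open>Passing from the second to the first truncated moment halves the exponent once
      more, from q/2 to q/4.\<close>
    moreover have "(expectation (\<lambda>\<omega>. min 1 (h * \<bar>Z \<omega>\<bar>)))\<^sup>2 \<le> expectation (\<lambda>\<omega>. (min 1 (h * \<bar>Z \<omega>\<bar>))\<^sup>2)"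
    proof -
      define X where "X \<omega> = min 1 (h * \<bar>Z \<omega>\<bar>)" for \<omega>
      have X [measurable]: "random_variable borel X" unfolding X_def by measurable
      have X01: "0 \<le> X \<omega>" "X \<omega> \<le> 1" for \<omega> using h by (auto simp: X_def)
      have iX: "integrable M X" "integrable M (\<lambda>\<omega>. (X \<omega>)\<^sup>2)"
        using X01 by (auto intro!: integrable_const_bound[where B=1] simp: abs_square_le_1)
      have "0 \<le> variance X" by simp
      also have "variance X = expectation (\<lambda>\<omega>. (X \<omega>)\<^sup>2) - (expectation X)\<^sup>2"
        by (rule variance_eq[OF iX])
      finally show ?thesis by (simp add: X_def[abs_def])
    qed
    moreover have "(min 1 (h * \<bar>z\<bar>))\<^sup>2 = min 1 ((h * z)\<^sup>2)" for z
    proof (cases "h * \<bar>z\<bar> \<le> 1")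
      case True
      then have "\<bar>h * z\<bar> \<le> 1" using h by (simp add: abs_mult)
      then have "(h * z)\<^sup>2 \<le> 1" by (simp add: abs_square_le_1)
      then show ?thesis using True by (simp add: power_mult_distrib)
    next
      case False
      then have "\<not> \<bar>h * z\<bar> \<le> 1" using h by (simp add: abs_mult)
      then have "\<not> (h * z)\<^sup>2 \<le> 1" by (simp add: abs_square_le_1)
      then show ?thesis using False by simp
    qed
    ultimately have "(expectation (\<lambda>\<omega>. min 1 (h * \<bar>Z \<omega>\<bar>)))\<^sup>2 \<le> 8 * (1 + K) * r" by simp
    also have "\<dots> \<le> 4\<^sup>2 * (1 + K)\<^sup>2 * r"
      using K r by (intro mult_right_mono) (auto simp: power2_eq_square algebra_simps)
    also have "\<dots> = (4 * (1 + K) * h powr (q / 4))\<^sup>2"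
    proof -
      have "(h powr (q / 4))\<^sup>2 = r" using h by (simp add: r_def powr_power)
      then have "(4 * (1 + K) * h powr (q / 4))\<^sup>2 = 4\<^sup>2 * (1 + K)\<^sup>2 * r"
        unfolding power_mult_distrib by (rule arg_cong)
      then show ?thesis by (rule sym)
    qed
    finally have "expectation (\<lambda>\<omega>. min 1 (h * \<bar>Z \<omega>\<bar>)) \<le> 4 * (1 + K) * h powr (q / 4)"
      by (rule power2_le_imp_le) (use K in simp)
    moreover have "expectation (\<lambda>\<omega>. min 2 (h * \<bar>Z \<omega>\<bar>)) \<le> expectation (\<lambda>\<omega>. 2 * min 1 (h * \<bar>Z \<omega>\<bar>))"
      using h by (intro integral_mono integrable_const_bound[where B=2]) (auto simp: min_def)
    ultimately show ?thesis by (simp only: Bochner_Integration.integral_mult_right_zero)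
  qed
qed

end

subsection \<open>Exponential tail bounds\<close>

lemma exp_le_quadratic:
  fixes x :: real
  assumes "\<bar>x\<bar> \<le> 1"
  shows "exp x \<le> 1 + x + x\<^sup>2"
proof (cases "x \<ge> 0")
  case True
  then show ?thesis using exp_bound[of x] assms by simp
next
  case False
  define y where "y = - x"
  have y: "0 \<le> y" "y \<le> 1" using False assms by (auto simp: y_def)
  have "1 \<le> (1 + y + y\<^sup>2 / 2) * (1 - y + y\<^sup>2)"
  proof -
    have "(1 + y + y\<^sup>2 / 2) * (1 - y + y\<^sup>2) = 1 + y\<^sup>2 / 2 + y ^ 3 / 2 + y ^ 4 / 2"
      by (simp add: field_simps power2_eq_square power3_eq_cube power4_eq_xxxx)
    then show ?thesis using y by simp
  qed
  also have "\<dots> \<le> exp y * (1 - y + y\<^sup>2)"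
    using y exp_lower_Taylor_quadratic[of y] by (intro mult_right_mono) (auto simp: add_increasing2)
  finally have "exp (- y) * 1 \<le> exp (- y) * (exp y * (1 - y + y\<^sup>2))"
    by (intro mult_left_mono) auto
  also have "\<dots> = 1 - y + y\<^sup>2" by (simp add: mult.assoc[symmetric] exp_minus_inverse mult.commute)
  finally show ?thesis by (simp add: y_def)
qed

text \<open>Trades an exponential for a power of freely chosen degree N, so that the union bound
  over a dyadic level becomes a geometric series.\<close>

lemma exp_minus_le_inverse_power:
  fixes x :: real
  assumes "x > 0" "N > 0"
  shows "exp (- x) \<le> (N / x) ^ N"
proof -
  have "(x / N) ^ N \<le> (1 + x / N) ^ N" using assms by (intro power_mono) auto
  also have "\<dots> \<le> exp x" using assms by (intro exp_ge_one_plus_x_over_n_power_n) auto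
  finally have "1 / exp x \<le> 1 / (x / N) ^ N" using assms by (intro divide_left_mono) auto
  then show ?thesis using assms by (simp add: exp_minus inverse_eq_divide power_divide)
qed

lemma abs_cos_diff_le: "\<bar>cos x - cos y\<bar> \<le> \<bar>x - y\<bar>" for x y :: real
proof -
  have "\<bar>cos x - cos y\<bar> = 2 * (\<bar>sin ((x + y) / 2)\<bar> * \<bar>sin ((y - x) / 2)\<bar>)"
    by (simp add: cos_diff_cos abs_mult)
  also have "\<dots> \<le> 2 * (1 * \<bar>(y - x) / 2\<bar>)"
    by (intro mult_left_mono mult_mono abs_sin_x_le_abs_x) auto
  finally show ?thesis by simp
qed

lemma abs_cos_mult_diff_le:
  fixes z :: real
  assumes "\<bar>u - v\<bar> \<le> h"
  shows "\<bar>cos (u * z) - cos (v * z)\<bar> \<le> min 2 (h * \<bar>z\<bar>)"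
proof -
  have "\<bar>cos (u * z) - cos (v * z)\<bar> \<le> \<bar>u - v\<bar> * \<bar>z\<bar>"
    using abs_cos_diff_le[of "u * z" "v * z"] by (simp add: left_diff_distrib[symmetric] abs_mult)
  also have "\<dots> \<le> h * \<bar>z\<bar>" using assms by (intro mult_right_mono) auto
  finally have "\<bar>cos (u * z) - cos (v * z)\<bar> \<le> h * \<bar>z\<bar>" .
  moreover have "\<bar>cos (u * z) - cos (v * z)\<bar> \<le> 2"
    using abs_cos_le_one[of "u * z"] abs_cos_le_one[of "v * z"] by linarith
  ultimately show ?thesis by simp
qed

text \<open>Index i at level j is reached from i div 2 at level j - 1: for even i it is the same
  point, for odd i one step of level j is added. Each level is thus paid for at most once.\<close>

lemma dyadic_chain:
  fixes g :: "real \<Rightarrow> real"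
  assumes step: "\<And>j i. j \<le> J \<Longrightarrow> i < 2 ^ j \<Longrightarrow>
      \<bar>g (a + real (Suc i) * (L / 2 ^ j)) - g (a + real i * (L / 2 ^ j))\<bar> \<le> \<eta> j"
    and nonneg: "\<And>j. \<eta> j \<ge> 0"
    and i: "i \<le> 2 ^ J"
  shows "\<bar>g (a + real i * (L / 2 ^ J)) - g a\<bar> \<le> (\<Sum>j\<le>J. \<eta> j)"
  using step i
proof (induction J arbitrary: i)
  case 0
  show ?case
  proof (cases "i = 0")
    case True
    then show ?thesis using nonneg[of 0] by simp
  next
    case False
    then have "i = 1" using 0 by simp
    then show ?thesis using 0(1)[of 0 0] by simp
  qed
next
  case (Suc J)
  define k where "k = i div 2"
  have k: "k \<le> 2 ^ J" using Suc.prems(2) by (simp add: k_def)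
  have IH: "\<bar>g (a + real k * (L / 2 ^ J)) - g a\<bar> \<le> (\<Sum>j\<le>J. \<eta> j)"
    using k Suc.prems(1) by (intro Suc.IH) auto
  have eq: "real (2 * k) * (L / 2 ^ Suc J) = real k * (L / 2 ^ J)" by simp
  show ?case
  proof (cases "even i")
    case True
    then have "i = 2 * k" by (simp add: k_def)
    then show ?thesis using IH nonneg[of "Suc J"] unfolding \<open>i = 2 * k\<close> eq by simp
  next
    case False
    then have i: "i = Suc (2 * k)" by (simp add: k_def)
    have "2 * k < 2 ^ Suc J" using Suc.prems(2) i by simp
    from Suc.prems(1)[OF order_refl this]
    have "\<bar>g (a + real i * (L / 2 ^ Suc J)) - g (a + real k * (L / 2 ^ J))\<bar> \<le> \<eta> (Suc J)"
      unfolding i eq .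
    then show ?thesis using IH by simp
  qed
qed

context prob_space
begin

text \<open>Chernoff's method with the fixed parameter l = 1 / (s sqrt n). The condition
  \<open>b \<le> s * sqrt n\<close> keeps every exponent in [-1, 1], where exp is below 1 + x + x^2;
  each factor then has mean at most exp(1/n) and the product at most e.\<close>

lemma sum_tail_exp:
  fixes X :: "nat \<Rightarrow> 'a \<Rightarrow> real"
  assumes indep: "indep_vars (\<lambda>_. borel) X {..<n}"
    and bnd: "\<And>i \<omega>. i < n \<Longrightarrow> \<bar>X i \<omega>\<bar> \<le> b"
    and mean: "\<And>i. i < n \<Longrightarrow> expectation (X i) = 0"
    and var: "\<And>i. i < n \<Longrightarrow> expectation (\<lambda>\<omega>. (X i \<omega>)\<^sup>2) \<le> s\<^sup>2"
    and s: "s > 0" and n: "n > 0" and bs: "b \<le> s * sqrt n"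
  shows "prob {\<omega> \<in> space M. (\<Sum>i<n. X i \<omega>) / sqrt n \<ge> \<epsilon>} \<le> exp (1 - \<epsilon> / s)"
proof -
  have X [measurable]: "random_variable borel (X i)" if "i < n" for i
    using indep that by (auto simp: indep_vars_def)
  have iX: "integrable M (X i)" "integrable M (\<lambda>\<omega>. (X i \<omega>)\<^sup>2)" if "i < n" for i
  proof -
    show "integrable M (X i)" using that bnd by (intro integrable_const_bound[where B=b]) auto
    show "integrable M (\<lambda>\<omega>. (X i \<omega>)\<^sup>2)"
      using that bnd[OF that] by (intro integrable_const_bound[where B="b\<^sup>2"]) (auto simp: abs_le_square_iff[symmetric] intro: order_trans[OF _ abs_ge_self])
  qed
  define l where "l = 1 / (s * sqrt n)"
  have l: "l > 0" using s n by (simp add: l_def)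
  have lb: "\<bar>l * X i \<omega>\<bar> \<le> 1" if "i < n" for i \<omega>
    using bnd[OF that, of \<omega>] bs s n by (simp add: l_def abs_mult field_simps)
  define Y where "Y i \<omega> = exp (l * X i \<omega>)" for i \<omega>
  have Yb: "\<bar>Y i \<omega>\<bar> \<le> exp 1" if "i < n" for i \<omega>
    using lb[OF that, of \<omega>] by (simp add: Y_def)
  have Y: "indep_vars (\<lambda>_. borel) Y {..<n}"
    unfolding Y_def by (rule indep_vars_compose2[OF indep]) auto
  have iY: "integrable M (Y i)" if "i < n" for i
    using Yb[OF that] that unfolding Y_def by (intro integrable_const_bound[where B="exp 1"]) auto
  have EY: "expectation (Y i) \<le> exp (1 / n)" if "i < n" for i
  proof -
    have "expectation (Y i) \<le> expectation (\<lambda>\<omega>. 1 + l * X i \<omega> + l\<^sup>2 * (X i \<omega>)\<^sup>2)"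
      using iX[OF that] iY[OF that] exp_le_quadratic[OF lb[OF that]]
      by (intro integral_mono) (auto simp: Y_def power_mult_distrib)
    also have "\<dots> = 1 + l\<^sup>2 * expectation (\<lambda>\<omega>. (X i \<omega>)\<^sup>2)"
      using iX[OF that] mean[OF that] prob_space by simp
    also have "\<dots> \<le> 1 + l\<^sup>2 * s\<^sup>2" using var[OF that] by (simp add: mult_left_mono)
    also have "l\<^sup>2 * s\<^sup>2 = 1 / n" using s n by (simp add: l_def power_divide power_mult_distrib)
    also have "1 + 1 / n \<le> exp (1 / n)" by (rule exp_ge_add_one_self)
    finally show ?thesis by simp
  qed
  have prodY: "(\<Prod>i<n. Y i \<omega>) = exp (l * (\<Sum>i<n. X i \<omega>))" for \<omega>
    by (simp add: Y_def exp_sum sum_distrib_left)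
  have iP: "integrable M (\<lambda>\<omega>. \<Prod>i<n. Y i \<omega>)"
    by (rule indep_vars_integrable) (use Y iY in auto)
  have "expectation (\<lambda>\<omega>. \<Prod>i<n. Y i \<omega>) = (\<Prod>i<n. expectation (Y i))"
    by (rule indep_vars_lebesgue_integral) (use Y iY in auto)
  also have "\<dots> \<le> (\<Prod>i<n. exp (1 / n))"
    using EY by (intro prod_mono) (auto simp: Y_def)
  also have "\<dots> = exp 1" using n by (simp add: exp_of_nat_mult[symmetric])
  finally have EP: "expectation (\<lambda>\<omega>. \<Prod>i<n. Y i \<omega>) \<le> exp 1" .
  have "{\<omega> \<in> space M. (\<Sum>i<n. X i \<omega>) / sqrt n \<ge> \<epsilon>} = {\<omega> \<in> space M. (\<Prod>i<n. Y i \<omega>) \<ge> exp (\<epsilon> / s)}"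
    using s n by (auto simp: prodY l_def field_simps)
  also have "prob \<dots> \<le> expectation (\<lambda>\<omega>. \<Prod>i<n. Y i \<omega>) / exp (\<epsilon> / s)"
    by (rule integral_Markov_inequality_measure[OF iP]) (auto simp: prodY)
  also have "\<dots> \<le> exp 1 / exp (\<epsilon> / s)" using EP by (intro divide_right_mono) auto
  finally show ?thesis by (simp add: exp_diff)
qed

lemma abs_sum_tail_exp:
  fixes X :: "nat \<Rightarrow> 'a \<Rightarrow> real"
  assumes indep: "indep_vars (\<lambda>_. borel) X {..<n}"
    and bnd: "\<And>i \<omega>. i < n \<Longrightarrow> \<bar>X i \<omega>\<bar> \<le> b"
    and mean: "\<And>i. i < n \<Longrightarrow> expectation (X i) = 0"
    and var: "\<And>i. i < n \<Longrightarrow> expectation (\<lambda>\<omega>. (X i \<omega>)\<^sup>2) \<le> s\<^sup>2"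
    and s: "s > 0" and n: "n > 0" and bs: "b \<le> s * sqrt n"
  shows "prob {\<omega> \<in> space M. \<bar>(\<Sum>i<n. X i \<omega>) / sqrt n\<bar> \<ge> \<epsilon>} \<le> 2 * exp (1 - \<epsilon> / s)"
proof -
  have X [measurable]: "random_variable borel (X i)" if "i < n" for i
    using indep that by (auto simp: indep_vars_def)
  have S [measurable]: "random_variable borel (\<lambda>\<omega>. \<Sum>i<n. X i \<omega>)"
    by (intro borel_measurable_sum X) auto
  have "indep_vars (\<lambda>_. borel) (\<lambda>i \<omega>. - X i \<omega>) {..<n}"
    by (rule indep_vars_compose2[OF indep]) auto
  then have 2: "prob {\<omega> \<in> space M. (\<Sum>i<n. - X i \<omega>) / sqrt n \<ge> \<epsilon>} \<le> exp (1 - \<epsilon> / s)"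
    by (rule sum_tail_exp[where b=b]) (use assms in auto)
  have "{\<omega> \<in> space M. \<bar>(\<Sum>i<n. X i \<omega>) / sqrt n\<bar> \<ge> \<epsilon>} =
     {\<omega> \<in> space M. (\<Sum>i<n. X i \<omega>) / sqrt n \<ge> \<epsilon>} \<union> {\<omega> \<in> space M. (\<Sum>i<n. - X i \<omega>) / sqrt n \<ge> \<epsilon>}"
    by (auto simp: sum_negf abs_if)
  also have "prob \<dots> \<le> prob {\<omega> \<in> space M. (\<Sum>i<n. X i \<omega>) / sqrt n \<ge> \<epsilon>}
     + prob {\<omega> \<in> space M. (\<Sum>i<n. - X i \<omega>) / sqrt n \<ge> \<epsilon>}"
    by (intro measure_Un_le) (auto simp: sum_negf)
  also have "\<dots> \<le> exp (1 - \<epsilon> / s) + exp (1 - \<epsilon> / s)"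
    by (intro add_mono 2 sum_tail_exp[where b=b]) (use assms in auto)
  finally show ?thesis by simp
qed

end

section \<open>The normalised empirical cosine process and its increments\<close>

definition cos_process :: "nat \<Rightarrow> (nat \<Rightarrow> 'a \<Rightarrow> real) \<Rightarrow> (real \<Rightarrow> real) \<Rightarrow> real \<Rightarrow> 'a \<Rightarrow> real" where
  "cos_process n Z \<psi> u \<omega> = (\<Sum>i<n. cos (u * Z i \<omega>) - \<psi> u) / sqrt n"

text \<open>The laws enter only through their common cosine transform and the truncated envelope,
  which stands in for a moment condition. \<open>C \<ge> 8\<close> makes 2 C >= 16, the square of
  the bound 4 on a centred increment, as Bernstein's condition asks.\<close>

locale iid_cos = prob_space +
  fixes Z :: "nat \<Rightarrow> 'a \<Rightarrow> real" and n :: nat and \<psi> :: "real \<Rightarrow> real" and C \<beta> :: real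
  assumes indep: "indep_vars (\<lambda>_. borel) Z {..<n}"
    and \<psi>: "\<And>i u. i < n \<Longrightarrow> expectation (\<lambda>\<omega>. cos (u * Z i \<omega>)) = \<psi> u"
    and envelope: "\<And>i h. i < n \<Longrightarrow> h > 0 \<Longrightarrow> expectation (\<lambda>\<omega>. min 2 (h * \<bar>Z i \<omega>\<bar>)) \<le> C * h powr \<beta>"
    and C: "C \<ge> 8" and \<beta>: "0 < \<beta>" "\<beta> \<le> 1" and n_pos: "n > 0"
begin

abbreviation "G \<equiv> cos_process n Z \<psi>"

lemmas G_def = cos_process_def

lemma Z_measurable [measurable]: "i < n \<Longrightarrow> random_variable borel (Z i)"
  using indep by (auto simp: indep_vars_def)

lemma G_measurable [measurable]: "random_variable borel (G u)"
  unfolding G_def by (intro borel_measurable_divide borel_measurable_sum) auto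

lemma integrable_cos_Z [simp]: "i < n \<Longrightarrow> integrable M (\<lambda>\<omega>. cos (u * Z i \<omega>))"
  by (rule integrable_const_bound[where B=1]) auto

lemma integrable_envelope [simp]: "i < n \<Longrightarrow> integrable M (\<lambda>\<omega>. min 2 (h * \<bar>Z i \<omega>\<bar>))" if "h > 0"
  using that by (intro integrable_const_bound[where B=2]) auto

lemma \<psi>_abs_le_1: "\<bar>\<psi> u\<bar> \<le> 1"
proof -
  have "\<bar>\<psi> u\<bar> \<le> expectation (\<lambda>\<omega>. \<bar>cos (u * Z 0 \<omega>)\<bar>)"
    using n_pos by (simp flip: \<psi>[of 0])
  also have "\<dots> \<le> expectation (\<lambda>\<omega>. 1)"
    using n_pos by (intro integral_mono) auto
  finally show ?thesis by (simp add: prob_space)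
qed

lemma \<psi>_diff_le: "\<bar>\<psi> u - \<psi> v\<bar> \<le> C * h powr \<beta>" if "h > 0" "\<bar>u - v\<bar> \<le> h"
proof -
  have "\<psi> u - \<psi> v = expectation (\<lambda>\<omega>. cos (u * Z 0 \<omega>) - cos (v * Z 0 \<omega>))"
    using n_pos by (simp add: \<psi>)
  then have "\<bar>\<psi> u - \<psi> v\<bar> \<le> expectation (\<lambda>\<omega>. \<bar>cos (u * Z 0 \<omega>) - cos (v * Z 0 \<omega>)\<bar>)"
    by simp
  also have "\<dots> \<le> expectation (\<lambda>\<omega>. min 2 (h * \<bar>Z 0 \<omega>\<bar>))"
    using n_pos that abs_cos_mult_diff_le[OF that(2)] by (intro integral_mono) auto
  also have "\<dots> \<le> C * h powr \<beta>" using n_pos that by (intro envelope) auto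
  finally show ?thesis .
qed

text \<open>Since |D| <= 2, the square of a cosine difference D is at most twice the envelope, which
  gives the variance proxy s^2 = 2 C h^\<beta>. The last condition on h is exactly what makes
  \<open>4 \<le> s * sqrt n\<close>.\<close>

lemma increment_tail:
  assumes h: "h > 0" "\<bar>u - v\<bar> \<le> h" "1 \<le> h powr \<beta> * n"
  shows "prob {\<omega> \<in> space M. \<bar>G u \<omega> - G v \<omega>\<bar> \<ge> \<epsilon>} \<le> 2 * exp (1 - \<epsilon> / sqrt (2 * C * h powr \<beta>))"
proof -
  define X where "X i \<omega> = cos (u * Z i \<omega>) - cos (v * Z i \<omega>) - (\<psi> u - \<psi> v)" for i \<omega>
  define s where "s = sqrt (2 * C * h powr \<beta>)"
  have s: "s > 0" using C h by (simp add: s_def)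
  have "G u \<omega> - G v \<omega> = (\<Sum>i<n. X i \<omega>) / sqrt n" for \<omega>
    unfolding G_def X_def diff_divide_distrib[symmetric] sum_subtractf[symmetric]
    by (intro arg_cong2[where f="(/)"] sum.cong) auto
  moreover have "prob {\<omega> \<in> space M. \<bar>(\<Sum>i<n. X i \<omega>) / sqrt n\<bar> \<ge> \<epsilon>} \<le> 2 * exp (1 - \<epsilon> / s)"
  proof (rule abs_sum_tail_exp[where b=4])
    show "indep_vars (\<lambda>_. borel) X {..<n}"
      unfolding X_def by (rule indep_vars_compose2[OF indep]) auto
    show "\<bar>X i \<omega>\<bar> \<le> 4" for i \<omega>
      using abs_cos_le_one[of "u * Z i \<omega>"] abs_cos_le_one[of "v * Z i \<omega>"] \<psi>_abs_le_1[of u] \<psi>_abs_le_1[of v]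
      unfolding X_def by linarith
    show "expectation (X i) = 0" if "i < n" for i
      using that prob_space by (simp add: X_def[abs_def] \<psi>)
    have "sqrt 16 \<le> sqrt (2 * C * (h powr \<beta> * n))"
    proof (rule real_sqrt_le_mono)
      have "16 * 1 \<le> (2 * C) * (h powr \<beta> * n)" using C h by (intro mult_mono) auto
      then show "16 \<le> 2 * C * (h powr \<beta> * n)" by simp
    qed
    then show "4 \<le> s * sqrt n"
      by (simp add: s_def real_sqrt_mult mult_ac)
    show "expectation (\<lambda>\<omega>. (X i \<omega>)\<^sup>2) \<le> s\<^sup>2" if i: "i < n" for i
    proof -
      define D where "D \<omega> = cos (u * Z i \<omega>) - cos (v * Z i \<omega>)" for \<omega>
      have [measurable]: "random_variable borel D" unfolding D_def using i by measurable
      have D2: "\<bar>D \<omega>\<bar> \<le> min 2 (h * \<bar>Z i \<omega>\<bar>)" for \<omega>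
        unfolding D_def by (rule abs_cos_mult_diff_le[OF h(2)])
      have Dsq: "(D \<omega>)\<^sup>2 \<le> 2 * min 2 (h * \<bar>Z i \<omega>\<bar>)" for \<omega>
      proof -
        have "(D \<omega>)\<^sup>2 = \<bar>D \<omega>\<bar> * \<bar>D \<omega>\<bar>" by (simp add: power2_eq_square)
        also have "\<dots> \<le> 2 * min 2 (h * \<bar>Z i \<omega>\<bar>)" using D2[of \<omega>] by (intro mult_mono) auto
        finally show ?thesis .
      qed
      have iD: "integrable M D" "integrable M (\<lambda>\<omega>. (D \<omega>)\<^sup>2)"
      proof -
        show "integrable M D" unfolding D_def using i by simp
        have "norm ((D \<omega>)\<^sup>2) \<le> 4" for \<omega> using Dsq[of \<omega>] by simp
        then show "integrable M (\<lambda>\<omega>. (D \<omega>)\<^sup>2)"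
          by (intro integrable_const_bound[where B=4]) auto
      qed
      have "\<psi> u - \<psi> v = expectation D" unfolding D_def using i by (simp add: \<psi>)
      then have "expectation (\<lambda>\<omega>. (X i \<omega>)\<^sup>2) = variance D"
        by (simp add: X_def D_def)
      also have "\<dots> \<le> expectation (\<lambda>\<omega>. (D \<omega>)\<^sup>2)"
        using variance_eq[OF iD] by simp
      also have "\<dots> \<le> expectation (\<lambda>\<omega>. 2 * min 2 (h * \<bar>Z i \<omega>\<bar>))"
        using iD Dsq h i by (intro integral_mono) auto
      also have "\<dots> \<le> 2 * (C * h powr \<beta>)" using envelope[OF i h(1)] by simp
      also have "\<dots> = s\<^sup>2" using C by (simp add: s_def)
      finally show ?thesis .
    qed
  qed (use s n_pos in auto)
  ultimately show ?thesis by (simp add: s_def)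
qed

end

subsection \<open>Chaining\<close>

context iid_cos
begin

text \<open>Threshold over standard deviation is x = (\<epsilon> / S) 2^(\<beta> j/4). Replacing
  exp(-x) by (N / x)^N with N \<beta> >= 8 yields a factor 2^(-2j): one half of it pays for the 2^j
  increments of level j, the other leaves a summable series. The constant 6 is 2 times the bound 3
  on e.\<close>

lemma level_tail_sum:
  assumes L: "L > 0" and \<epsilon>: "\<epsilon> > 0" and N: "real N * \<beta> \<ge> 8"
  defines "r \<equiv> 2 powr (- \<beta> / 4)" and "S \<equiv> sqrt (2 * C) * L powr (\<beta> / 2)"
  shows "2 ^ j * (2 * exp (1 - \<epsilon> * r ^ j / sqrt (2 * C * (L / 2 ^ j) powr \<beta>))) \<le>
     6 * (N * S / \<epsilon>) ^ N * (1 / 2) ^ j"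
proof -
  define x where "x = \<epsilon> / S * 2 powr (\<beta> / 4 * j)"
  have S: "S > 0" using L C by (simp add: S_def)
  have N0: "N > 0" using N by (cases N) auto
  have x: "x > 0" using S \<epsilon> by (simp add: x_def)
  have "sqrt (2 * C * (L / 2 ^ j) powr \<beta>) = S * 2 powr (- \<beta> / 2 * j)"
  proof -
    have "(L / 2 ^ j) powr \<beta> = L powr \<beta> / 2 powr (j * \<beta>)"
      using L by (simp add: powr_divide powr_powr flip: powr_realpow)
    moreover have "sqrt (L powr \<beta> / 2 powr (j * \<beta>)) = L powr (\<beta> / 2) * 2 powr (- \<beta> / 2 * j)"
      using L by (simp add: powr_half_sqrt[symmetric] powr_divide powr_powr powr_minus_divide mult_ac)
    moreover have "sqrt (2 * C * (L / 2 ^ j) powr \<beta>) = sqrt (2 * C) * sqrt ((L / 2 ^ j) powr \<beta>)"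
      by (rule real_sqrt_mult)
    ultimately show ?thesis by (simp only: S_def mult.assoc)
  qed
  moreover have "r ^ j = 2 powr (- \<beta> / 4 * j)"
    unfolding r_def by (simp add: powr_realpow[symmetric] powr_powr)
  moreover have "2 powr (- \<beta> / 4 * j) / 2 powr (- \<beta> / 2 * j) = 2 powr (\<beta> / 4 * j)"
    by (simp add: powr_diff[symmetric])
  ultimately have "\<epsilon> * r ^ j / sqrt (2 * C * (L / 2 ^ j) powr \<beta>) = x"
    using S by (simp add: x_def field_simps)
  then have "2 ^ j * (2 * exp (1 - \<epsilon> * r ^ j / sqrt (2 * C * (L / 2 ^ j) powr \<beta>))) = 2 ^ j * (2 * (exp 1 * exp (- x)))"
    by (simp add: exp_diff exp_minus divide_inverse)
  also have "\<dots> \<le> 2 ^ j * (2 * (3 * (N / x) ^ N))"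
    using exp_minus_le_inverse_power[OF x N0] exp_le by (intro mult_left_mono mult_mono) auto
  also have "(N / x) ^ N = (N * S / \<epsilon>) ^ N * 2 powr (- (real N * \<beta> / 4 * j))"
  proof -
    have "N / x = N * S / \<epsilon> * 2 powr (- (\<beta> / 4 * j))"
      by (simp add: x_def powr_minus_divide)
    then have "(N / x) ^ N = (N * S / \<epsilon>) ^ N * (2 powr (- (\<beta> / 4 * j))) ^ N"
      by (simp only: power_mult_distrib)
    then show ?thesis by (simp add: powr_realpow[symmetric] powr_powr mult_ac)
  qed
  also have "2 ^ j * (2 * (3 * ((N * S / \<epsilon>) ^ N * 2 powr (- (real N * \<beta> / 4 * j))))) \<le>
      2 ^ j * (2 * (3 * ((N * S / \<epsilon>) ^ N * 2 powr (- (2 * real j)))))"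
  proof -
    have "2 * real j \<le> real N * \<beta> / 4 * j" using N by (intro mult_right_mono) auto
    then show ?thesis using S \<epsilon> by (intro mult_left_mono powr_mono) auto
  qed
  also have "\<dots> = 6 * (N * S / \<epsilon>) ^ N * (2 ^ j * 2 powr (- (2 * real j)))" by simp
  also have "2 ^ j * 2 powr (- (2 * real j)) = (1 / 2) ^ j"
  proof -
    have "2 ^ j * 2 powr (- (2 * real j)) = 2 powr (real j + - (2 * real j))"
      by (simp only: powr_add powr_realpow zero_less_numeral)
    also have "\<dots> = 2 powr (- real j)" by simp
    also have "\<dots> = (1 / 2) ^ j" by (simp add: powr_minus_divide powr_realpow power_one_over)
    finally show ?thesis .
  qed
  finally show ?thesis .
qed

text \<open>Chaining along dyadic grids, stopped at the scale where the \<^term>\<open>u\<close>-free envelope of the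
  increments is already of smaller order than the normalisation \<^term>\<open>1 / sqrt n\<close>; this replaces
  moment conditions on \<^term>\<open>Z\<close>.\<close>

lemma chaining:
  assumes L: "L > 0" and \<epsilon>: "\<epsilon> > 0" and N: "real N * \<beta> \<ge> 8" and Ln: "1 \<le> L powr \<beta> * n"
  shows "\<exists>B\<in>events. prob B \<le> 12 * (N * (sqrt (2 * C) * L powr (\<beta> / 2)) / \<epsilon>) ^ N + 2 * C / (\<epsilon> * sqrt n) \<and>
    (\<forall>\<omega>\<in>space M - B. \<forall>u\<in>{a..a + L}.
        \<bar>G u \<omega> - G a \<omega>\<bar> \<le> \<epsilon> * (1 / (1 - 2 powr (- \<beta> / 4)) + 1) + 2 * C / sqrt n)"
proof -
  define r where "r = 2 powr (- \<beta> / 4)"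
  define S where "S = sqrt (2 * C) * L powr (\<beta> / 2)"
  have S: "S > 0" using L C by (simp add: S_def)
  have r: "0 < r" "r < 1" using \<beta> by (auto simp: r_def powr_less_one)
  have r': "r = 2 powr (- \<beta> / 4)" by (simp add: r_def)
  define K where "K = 6 * (N * S / \<epsilon>) ^ N"
  have K: "K \<ge> 0" using S \<epsilon> by (simp add: K_def)
  \<comment> \<open>J is the last level in the range of \<open>increment_tail\<close>. Since \<beta>
    <= 1, halving the mesh at most halves the power, so at level J the product is still below
    2.\<close>
  have "\<exists>J. (1 \<le> (L / 2 ^ J) powr \<beta> * n) \<and> (L / 2 ^ J) powr \<beta> * n < 2"
  proof -
    let ?P = "\<lambda>j::nat. (L / 2 ^ j) powr \<beta> * n < 1"
    have "(\<lambda>j::nat. (L / 2 ^ j) powr \<beta> * n) \<longlonglongrightarrow> 0 * real n"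
    proof (intro tendsto_intros)
      have "(\<lambda>j::nat. L * (1 / 2) ^ j) \<longlonglongrightarrow> L * 0"
        by (intro tendsto_intros LIMSEQ_power_zero) auto
      then have "(\<lambda>j::nat. L / 2 ^ j) \<longlonglongrightarrow> 0" by (simp add: power_divide)
      then show "(\<lambda>j::nat. (L / 2 ^ j) powr \<beta>) \<longlonglongrightarrow> 0"
        using tendsto_zero_powrI[of "\<lambda>j. L / 2 ^ j" sequentially "\<lambda>_. \<beta>" \<beta>] \<beta> L by auto
    qed
    then have "eventually ?P sequentially" by (intro order_tendstoD(2)) auto
    then obtain m where "?P m" using eventually_happens by fastforce
    moreover have "\<not> ?P 0" using Ln by simp
    ultimately obtain k where k: "\<forall>i\<le>k. \<not> ?P i" "?P (Suc k)"
      using ex_least_nat_less[of ?P m] by blast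
    have "(L / 2 ^ k) powr \<beta> = 2 powr \<beta> * (L / 2 ^ Suc k) powr \<beta>"
      using L by (simp add: powr_mult[symmetric])
    then have "(L / 2 ^ k) powr \<beta> * n = 2 powr \<beta> * ((L / 2 ^ Suc k) powr \<beta> * n)"
      by (simp only: mult.assoc)
    also have "\<dots> < 2 powr \<beta> * 1"
      using k(2) by (intro mult_strict_left_mono) auto
    also have "\<dots> \<le> 2 powr 1" using \<beta> by (simp only: mult_1_right) (intro powr_mono, auto)
    finally have "(L / 2 ^ k) powr \<beta> * n < 2" by simp
    then show ?thesis using k(1) by force
  qed
  then obtain J where J: "1 \<le> (L / 2 ^ J) powr \<beta> * n" "(L / 2 ^ J) powr \<beta> * n < 2" by blast
  define h where "h = L / 2 ^ J"
  have h: "h > 0" using L by (simp add: h_def)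
  have hC: "C * h powr \<beta> * n \<le> 2 * C" using J(2) C by (simp add: h_def mult.assoc)
  have sq: "sqrt n > 0" "real n = sqrt n * sqrt n" using n_pos by auto
  have hC': "sqrt n * (C * h powr \<beta>) \<le> 2 * C / sqrt n"
  proof -
    have "sqrt n * (C * h powr \<beta>) * sqrt n = C * h powr \<beta> * (sqrt n * sqrt n)"
      by (simp only: mult_ac)
    then have "sqrt n * (C * h powr \<beta>) * sqrt n \<le> 2 * C" using hC by (simp only: sq(2)[symmetric])
    then show ?thesis using sq(1) by (simp only: pos_le_divide_eq)
  qed
  define pt where "pt j i = a + real i * (L / 2 ^ j)" for i j :: nat
  define B1 where "B1 j i = {\<omega> \<in> space M. \<bar>G (pt j (Suc i)) \<omega> - G (pt j i) \<omega>\<bar> \<ge> \<epsilon> * r ^ j}" for i j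
  \<comment> \<open>Controls all increments inside a cell of the finest grid simultaneously; its
    mean is at most sqrt n C h^\<beta> <= 2 C / sqrt n, so Markov's inequality suffices.\<close>
  define A where "A \<omega> = (\<Sum>i<n. min 2 (h * \<bar>Z i \<omega>\<bar>)) / sqrt n" for \<omega>
  define B2 where "B2 = {\<omega> \<in> space M. A \<omega> \<ge> \<epsilon>}"
  have [measurable]: "random_variable borel A" unfolding A_def
    by (intro borel_measurable_divide borel_measurable_sum) auto
  have B1m: "B1 j i \<in> events" for i j unfolding B1_def by measurable
  have B2m: "B2 \<in> events" unfolding B2_def by measurable
  define B where "B = (\<Union>j\<in>{..J}. \<Union>i\<in>{..<2^j}. B1 j i) \<union> B2"
  have Bm: "B \<in> events" unfolding B_def using B1m B2m by auto
  have P1: "prob (B1 j i) \<le> 2 * exp (1 - \<epsilon> * r ^ j / sqrt (2 * C * (L / 2 ^ j) powr \<beta>))" if "j \<le> J" for i j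
    unfolding B1_def
  proof (rule increment_tail)
    show "L / 2 ^ j > 0" using L by simp
    show "\<bar>pt j (Suc i) - pt j i\<bar> \<le> L / 2 ^ j" using L by (simp add: pt_def field_simps)
    have "(2::real) ^ j \<le> 2 ^ J" using that by (intro power_increasing) auto
    then have "(L / 2 ^ J) powr \<beta> \<le> (L / 2 ^ j) powr \<beta>"
      using L \<beta> by (intro powr_mono2 divide_left_mono) auto
    then have "(L / 2 ^ J) powr \<beta> * n \<le> (L / 2 ^ j) powr \<beta> * n" by (intro mult_right_mono) auto
    then show "1 \<le> (L / 2 ^ j) powr \<beta> * n" using J(1) by linarith
  qed
  have P2: "prob B2 \<le> 2 * C / (\<epsilon> * sqrt n)"
  proof -
    have "integrable M A" unfolding A_def using h by (intro integrable_divide integrable_sum) auto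
    moreover have "\<forall>\<omega>. A \<omega> \<ge> 0" unfolding A_def using h by (auto intro!: divide_nonneg_nonneg sum_nonneg)
    ultimately have "prob B2 \<le> expectation A / \<epsilon>"
      unfolding B2_def by (intro integral_Markov_inequality_measure[where A="{}"]) (use \<epsilon> in auto)
    also have "expectation A = (\<Sum>i<n. expectation (\<lambda>\<omega>. min 2 (h * \<bar>Z i \<omega>\<bar>))) / sqrt n"
      unfolding A_def using h by simp
    also have "(\<Sum>i<n. expectation (\<lambda>\<omega>. min 2 (h * \<bar>Z i \<omega>\<bar>))) \<le> (\<Sum>i<n. C * h powr \<beta>)"
      using h by (intro sum_mono envelope) auto
    also have "\<dots> = sqrt n * (C * h powr \<beta>) * sqrt n" using sq by simp
    also have "\<dots> \<le> 2 * C / sqrt n * sqrt n" using hC' by (intro mult_right_mono) auto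
    finally show ?thesis using sq \<epsilon> by (simp add: field_simps divide_right_mono)
  qed
  have "prob B \<le> prob (\<Union>j\<in>{..J}. \<Union>i\<in>{..<2^j}. B1 j i) + prob B2"
    unfolding B_def using B1m B2m by (intro measure_Un_le) auto
  also have "prob (\<Union>j\<in>{..J}. \<Union>i\<in>{..<2^j}. B1 j i) \<le> (\<Sum>j\<in>{..J}. prob (\<Union>i\<in>{..<2^j}. B1 j i))"
    using B1m by (intro finite_measure_subadditive_finite) auto
  also have "\<dots> \<le> (\<Sum>j\<in>{..J}. K * (1 / 2) ^ j)"
  proof (rule sum_mono)
    fix j assume j: "j \<in> {..J}"
    have "prob (\<Union>i\<in>{..<2^j}. B1 j i) \<le> (\<Sum>i\<in>{..<2^j}. prob (B1 j i))"
      using B1m by (intro finite_measure_subadditive_finite) auto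
    also have "\<dots> \<le> (\<Sum>i\<in>{..<(2::nat)^j}. 2 * exp (1 - \<epsilon> * r ^ j / sqrt (2 * C * (L / 2 ^ j) powr \<beta>)))"
      using P1 j by (intro sum_mono) auto
    also have "\<dots> = 2 ^ j * (2 * exp (1 - \<epsilon> * r ^ j / sqrt (2 * C * (L / 2 ^ j) powr \<beta>)))" by simp
    also have "\<dots> \<le> K * (1 / 2) ^ j"
      using level_tail_sum[OF L \<epsilon> N, of j] unfolding K_def S_def r_def .
    finally show "prob (\<Union>i\<in>{..<2^j}. B1 j i) \<le> K * (1 / 2) ^ j" .
  qed
  also have "\<dots> = K * (\<Sum>j<Suc J. (1 / 2) ^ j)"
    by (simp add: sum_distrib_left lessThan_Suc_atMost)
  also have "\<dots> \<le> K * 2"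
    using K by (intro mult_left_mono) (simp_all add: sum_gp_strict del: sum.lessThan_Suc)
  finally have PB: "prob B \<le> 2 * K + 2 * C / (\<epsilon> * sqrt n)" using P2 by simp
  have "\<bar>G u \<omega> - G a \<omega>\<bar> \<le> \<epsilon> * (1 / (1 - r) + 1) + 2 * C / sqrt n"
    if \<omega>: "\<omega> \<in> space M - B" and u: "u \<in> {a..a + L}" for \<omega> u
  proof -
    \<comment> \<open>The grid point just left of u: the chain bounds the process there, and the
      envelope sum \<open>A\<close> together with the modulus of \<psi> covers the
      remainder.\<close>
    define k where "k = nat \<lfloor>(u - a) / h\<rfloor>"
    have "(u - a) / h \<ge> 0" using u h by simp
    then have k: "real k \<le> (u - a) / h" "(u - a) / h < real k + 1"
      unfolding k_def by (auto simp: of_nat_nat)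
    have "(u - a) / h \<le> 2 ^ J" using u h L by (simp add: h_def divide_le_eq)
    then have "real k \<le> real (2 ^ J)"
      using k(1) unfolding of_nat_power of_nat_numeral by linarith
    then have kJ: "k \<le> 2 ^ J" by (simp only: of_nat_le_iff)
    define v where "v = a + real k * h"
    have uv: "\<bar>u - v\<bar> \<le> h" using k h by (simp add: v_def field_simps abs_if)
    have "\<bar>G v \<omega> - G a \<omega>\<bar> \<le> (\<Sum>j\<le>J. \<epsilon> * r ^ j)"
      unfolding v_def h_def
    proof (rule dyadic_chain[OF _ _ kJ, where g="\<lambda>u. G u \<omega>"])
      fix j i assume ji: "j \<le> J" "i < (2::nat) ^ j"
      then have "\<omega> \<notin> B1 j i" using \<omega> unfolding B_def by blast
      then show "\<bar>G (a + real (Suc i) * (L / 2 ^ j)) \<omega> - G (a + real i * (L / 2 ^ j)) \<omega>\<bar> \<le> \<epsilon> * r ^ j"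
        using \<omega> by (auto simp: B1_def pt_def)
    qed (use \<epsilon> r in auto)
    also have "\<dots> = \<epsilon> * (\<Sum>j<Suc J. r ^ j)" by (simp add: sum_distrib_left lessThan_Suc_atMost)
    also have "\<dots> \<le> \<epsilon> * (1 / (1 - r))"
      using r \<epsilon> by (intro mult_left_mono) (auto simp: sum_gp_strict divide_right_mono simp del: sum.lessThan_Suc)
    finally have 1: "\<bar>G v \<omega> - G a \<omega>\<bar> \<le> \<epsilon> * (1 / (1 - r))" .
    have "G u \<omega> - G v \<omega> = (\<Sum>i<n. (cos (u * Z i \<omega>) - cos (v * Z i \<omega>)) - (\<psi> u - \<psi> v)) / sqrt n"
      unfolding G_def diff_divide_distrib[symmetric] sum_subtractf[symmetric]
      by (intro arg_cong2[where f="(/)"] sum.cong) auto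
    then have "\<bar>G u \<omega> - G v \<omega>\<bar> = \<bar>\<Sum>i<n. (cos (u * Z i \<omega>) - cos (v * Z i \<omega>)) - (\<psi> u - \<psi> v)\<bar> / sqrt n"
      by (simp add: abs_divide)
    also have "\<dots> \<le> (\<Sum>i<n. min 2 (h * \<bar>Z i \<omega>\<bar>) + C * h powr \<beta>) / sqrt n"
    proof (intro divide_right_mono order_trans[OF sum_abs] sum_mono)
      fix i assume "i \<in> {..<n}"
      show "\<bar>(cos (u * Z i \<omega>) - cos (v * Z i \<omega>)) - (\<psi> u - \<psi> v)\<bar> \<le> min 2 (h * \<bar>Z i \<omega>\<bar>) + C * h powr \<beta>"
        using abs_cos_mult_diff_le[OF uv, of "Z i \<omega>"] \<psi>_diff_le[OF h uv] by linarith
    qed auto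
    also have "\<dots> = A \<omega> + sqrt n * (C * h powr \<beta>)"
      using sq by (simp add: A_def sum.distrib add_divide_distrib) (simp add: field_simps)
    also have "\<dots> \<le> \<epsilon> + 2 * C / sqrt n"
      using \<omega> hC' by (intro add_mono) (auto simp: B_def B2_def)
    finally show ?thesis using 1 by (simp add: distrib_left)
  qed
  then show ?thesis
    using Bm PB unfolding r_def[symmetric] K_def S_def by (intro bexI[of _ B]) auto
qed

end

subsection \<open>Characteristic function and second moment of the cosine process\<close>

lemma abs_one_minus_diff_exp_le:
  fixes x :: real
  assumes "x \<ge> 0"
  shows "\<bar>(1 - x) - exp (- x)\<bar> \<le> x\<^sup>2"
proof -
  have "exp (- x) \<le> 1 - x + x\<^sup>2"
  proof (cases "x \<le> 1")
    case True
    then show ?thesis using exp_le_quadratic[of "- x"] assms by simp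
  next
    case False
    then have "x * 1 \<le> x * x" by (intro mult_left_mono) auto
    moreover have "exp (- x) \<le> 1" using assms by simp
    ultimately show ?thesis unfolding power2_eq_square by linarith
  qed
  moreover have "1 - x \<le> exp (- x)" using exp_ge_add_one_self[of "- x"] by simp
  ultimately show ?thesis by simp
qed

context iid_cos
begin

lemma integrable_cos_Z_square: "i < n \<Longrightarrow> integrable M (\<lambda>\<omega>. (cos (u * Z i \<omega>))\<^sup>2)"
  by (rule integrable_const_bound[where B=1]) (auto simp: abs_square_le_1)

text \<open>Here the doubled frequency enters, through cos^2 x = (1 + cos 2x) / 2; it is the source
  of the second term of \<open>v_fun\<close>.\<close>

lemma variance_cos:
  assumes "i < n"
  shows "variance (\<lambda>\<omega>. cos (u * Z i \<omega>) - \<psi> u) = (1 + \<psi> (2 * u)) / 2 - (\<psi> u)\<^sup>2"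
proof -
  have "\<psi> (2 * u) = expectation (\<lambda>\<omega>. 2 * (cos (u * Z i \<omega>))\<^sup>2 - 1)"
    unfolding \<psi>[OF assms, symmetric]
    by (intro Bochner_Integration.integral_cong) (auto simp: cos_double_cos[symmetric] mult.assoc)
  also have "\<dots> = 2 * expectation (\<lambda>\<omega>. (cos (u * Z i \<omega>))\<^sup>2) - 1"
    using integrable_cos_Z_square[OF assms] prob_space by simp
  finally have "expectation (\<lambda>\<omega>. (cos (u * Z i \<omega>))\<^sup>2) = (1 + \<psi> (2 * u)) / 2" by simp
  moreover have "variance (\<lambda>\<omega>. cos (u * Z i \<omega>) - \<psi> u) = variance (\<lambda>\<omega>. cos (u * Z i \<omega>))"
    using assms prob_space by (simp add: \<psi>)
  moreover have "variance (\<lambda>\<omega>. cos (u * Z i \<omega>)) = expectation (\<lambda>\<omega>. (cos (u * Z i \<omega>))\<^sup>2) - (\<psi> u)\<^sup>2"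
    using variance_eq[OF integrable_cos_Z[OF assms] integrable_cos_Z_square[OF assms]] assms
    by (simp add: \<psi>)
  ultimately show ?thesis by simp
qed

definition centred_cos where "centred_cos u i \<omega> = cos (u * Z i \<omega>) - \<psi> u"

lemma centred_cos:
  shows "indep_vars (\<lambda>_. borel) (centred_cos u) {..<n}"
    and "\<And>i. i < n \<Longrightarrow> random_variable borel (centred_cos u i)"
    and "\<And>i \<omega>. \<bar>centred_cos u i \<omega>\<bar> \<le> 2"
    and "\<And>i. i < n \<Longrightarrow> integrable M (centred_cos u i)"
    and "\<And>i. i < n \<Longrightarrow> integrable M (\<lambda>\<omega>. (centred_cos u i \<omega>)\<^sup>2)"
    and "\<And>i. i < n \<Longrightarrow> expectation (centred_cos u i) = 0"
proof -
  show "indep_vars (\<lambda>_. borel) (centred_cos u) {..<n}"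
    unfolding centred_cos_def[abs_def] by (rule indep_vars_compose2[OF indep]) auto
  then show Xm: "random_variable borel (centred_cos u i)" if "i < n" for i
    using that unfolding indep_vars_def2 by auto
  show X2: "\<bar>centred_cos u i \<omega>\<bar> \<le> 2" for i \<omega>
    using abs_cos_le_one[of "u * Z i \<omega>"] \<psi>_abs_le_1[of u] unfolding centred_cos_def[abs_def] by linarith
  show "integrable M (centred_cos u i)" if "i < n" for i
    using Xm[OF that] X2 by (intro integrable_const_bound[where B=2]) auto
  have "(centred_cos u i \<omega>)\<^sup>2 \<le> 2\<^sup>2" for i \<omega> using X2[of i \<omega>] by (simp only: abs_le_square_iff[symmetric] abs_numeral)
  then show "integrable M (\<lambda>\<omega>. (centred_cos u i \<omega>)\<^sup>2)" if "i < n" for i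
    using Xm[OF that] by (intro integrable_const_bound[where B=4]) auto
  show "expectation (centred_cos u i) = 0" if "i < n" for i
    using that prob_space by (simp add: centred_cos_def[abs_def] \<psi>)
qed

text \<open>A central limit theorem with explicit error, since the law of the summands changes with
  the row of the array. The summands are bounded by 2, so the Taylor remainder is of third order;
  products of characteristic functions are then compared factor by factor.\<close>

lemma char_G_approx:
  fixes u t a :: real
  defines "v \<equiv> (1 + \<psi> (2 * u)) / 2 - (\<psi> u)\<^sup>2" and "\<theta> \<equiv> t * a"
  shows "cmod (char (distr M borel (\<lambda>\<omega>. a * G u \<omega>)) t - exp (- (\<theta>\<^sup>2 * v / 2))) \<le>
    2 * \<bar>\<theta>\<bar> ^ 3 / sqrt n + \<theta> ^ 4 / n"
proof -
  define X where "X = centred_cos u"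
  define s where "s = \<theta> / sqrt n"
  have ss: "s\<^sup>2 = \<theta>\<^sup>2 / n" using n_pos by (simp add: s_def power_divide)
  note X = centred_cos[where u = u, folded X_def]
  have VX: "variance (X i) = v" if "i < n" for i
    unfolding X_def centred_cos_def[abs_def] v_def by (rule variance_cos[OF that])
  have v0: "v \<ge> 0" using VX[of 0] n_pos by (metis variance_positive)
  have v1: "v \<le> 1"
    using abs_le_D1[OF \<psi>_abs_le_1[of "2 * u"]] zero_le_power2[of "\<psi> u"] unfolding v_def by argo
  have "char (distr M borel (\<lambda>\<omega>. a * G u \<omega>)) t = (CLINT \<omega>|M. iexp (t * (a * G u \<omega>)))"
    unfolding char_def by (subst integral_distr) auto
  also have "\<dots> = (CLINT \<omega>|M. iexp (s * (\<Sum>i<n. X i \<omega>)))"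
    by (simp add: s_def \<theta>_def X_def centred_cos_def G_def mult_ac)
  also have "\<dots> = char (distr M borel (\<lambda>\<omega>. \<Sum>i<n. X i \<omega>)) s"
    unfolding char_def using X(2) by (subst integral_distr) (auto intro!: borel_measurable_sum)
  also have "\<dots> = (\<Prod>i<n. char (distr M borel (X i)) s)"
    by (rule char_distr_sum[OF X(1)])
  finally have char_eq: "char (distr M borel (\<lambda>\<omega>. a * G u \<omega>)) t = (\<Prod>i<n. char (distr M borel (X i)) s)" .
  define w where "w = complex_of_real (exp (- (s\<^sup>2 * v / 2)))"
  have wn: "(\<Prod>i<n. w) = exp (- (\<theta>\<^sup>2 * v / 2))"
    using n_pos by (simp add: w_def exp_of_nat_mult[symmetric] ss flip: of_real_power)
  have "cmod ((\<Prod>i<n. char (distr M borel (X i)) s) - (\<Prod>i<n. w)) \<le>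
      (\<Sum>i<n. cmod (char (distr M borel (X i)) s - w))"
  proof (rule norm_prod_diff)
    fix i assume i: "i \<in> {..<n}"
    interpret D: real_distribution "distr M borel (X i)"
      by (rule real_distribution_distr) (use i X(2) in auto)
    show "cmod (char (distr M borel (X i)) s) \<le> 1" by (rule D.cmod_char_le_1)
    show "cmod w \<le> 1" using v0 by (simp add: w_def)
  qed
  also have "\<dots> \<le> (\<Sum>i<n. (2 * \<bar>\<theta>\<bar> ^ 3 / sqrt n + \<theta> ^ 4 / n) / n)"
  proof (rule sum_mono)
    fix i assume "i \<in> {..<n}"
    then have i: "i < n" by simp
    have "cmod (char (distr M borel (X i)) s - (1 - s\<^sup>2 * v / 2)) \<le>
        (s\<^sup>2 / 6) * expectation (\<lambda>\<omega>. min (6 * (X i \<omega>)\<^sup>2) (\<bar>s\<bar> * \<bar>X i \<omega>\<bar> ^ 3))"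
      by (rule char_approx3') (use i X VX in auto)
    also have "\<dots> \<le> (s\<^sup>2 / 6) * (\<bar>s\<bar> * 8)"
    proof (intro mult_left_mono)
      have b: "min (6 * (X i \<omega>)\<^sup>2) (\<bar>s\<bar> * \<bar>X i \<omega>\<bar> ^ 3) \<le> \<bar>s\<bar> * 8" for \<omega>
      proof -
        have "\<bar>X i \<omega>\<bar> ^ 3 \<le> 2 ^ 3" using X(3) by (intro power_mono) auto
        then have "\<bar>s\<bar> * \<bar>X i \<omega>\<bar> ^ 3 \<le> \<bar>s\<bar> * 8" by (intro mult_left_mono) auto
        then show ?thesis by linarith
      qed
      then have "integrable M (\<lambda>\<omega>. min (6 * (X i \<omega>)\<^sup>2) (\<bar>s\<bar> * \<bar>X i \<omega>\<bar> ^ 3))"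
        using i X(2)[of i] by (intro integrable_const_bound[where B="\<bar>s\<bar> * 8"]) auto
      then show "expectation (\<lambda>\<omega>. min (6 * (X i \<omega>)\<^sup>2) (\<bar>s\<bar> * \<bar>X i \<omega>\<bar> ^ 3)) \<le> \<bar>s\<bar> * 8"
        using b by (intro integral_le_const) auto
    qed auto
    also have "\<dots> \<le> 2 * \<bar>\<theta>\<bar> ^ 3 / sqrt n / n"
    proof -
      have "s\<^sup>2 * \<bar>s\<bar> = \<bar>\<theta>\<bar> ^ 3 / sqrt n / n"
        unfolding ss by (simp add: s_def abs_divide power3_eq_cube power2_eq_square)
      moreover have "s\<^sup>2 / 6 * (\<bar>s\<bar> * 8) \<le> 2 * (s\<^sup>2 * \<bar>s\<bar>)" by simp
      ultimately show ?thesis by (simp only: times_divide_eq_right)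
    qed
    finally have 1: "cmod (char (distr M borel (X i)) s - (1 - s\<^sup>2 * v / 2)) \<le> 2 * \<bar>\<theta>\<bar> ^ 3 / sqrt n / n" .
    have "cmod ((1 - s\<^sup>2 * v / 2) - w) = \<bar>(1 - s\<^sup>2 * v / 2) - exp (- (s\<^sup>2 * v / 2))\<bar>"
      unfolding w_def of_real_diff[symmetric] norm_of_real by (rule refl)
    also have "\<dots> \<le> (s\<^sup>2 * v / 2)\<^sup>2"
      using v0 by (intro abs_one_minus_diff_exp_le) auto
    also have "\<dots> \<le> (s\<^sup>2)\<^sup>2"
    proof (rule power_mono)
      have "s\<^sup>2 * v \<le> s\<^sup>2 * 1" using v1 by (intro mult_left_mono) auto
      then show "s\<^sup>2 * v / 2 \<le> s\<^sup>2" using zero_le_power2[of s] by linarith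
    qed (use v0 in auto)
    also have "\<dots> = \<theta> ^ 4 / n / n"
      unfolding ss by (simp add: power_divide power2_eq_square power4_eq_xxxx)
    finally have 2: "cmod ((1 - s\<^sup>2 * v / 2) - w) \<le> \<theta> ^ 4 / n / n" .
    have "cmod (char (distr M borel (X i)) s - w) \<le> 2 * \<bar>\<theta>\<bar> ^ 3 / sqrt n / n + \<theta> ^ 4 / n / n"
      using norm_triangle_le[OF add_mono[OF 1 2]] by simp
    then show "cmod (char (distr M borel (X i)) s - w) \<le> (2 * \<bar>\<theta>\<bar> ^ 3 / sqrt n + \<theta> ^ 4 / n) / n"
      by (simp add: add_divide_distrib)
  qed
  also have "\<dots> = 2 * \<bar>\<theta>\<bar> ^ 3 / sqrt n + \<theta> ^ 4 / n" using n_pos by simp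
  finally show ?thesis unfolding char_eq wn .
qed

text \<open>Independence removes the cross terms and each variance is at most 1. The bound is
  uniform in n and u and yields tightness.\<close>

lemma G_second_moment: "integrable M (\<lambda>\<omega>. (G u \<omega>)\<^sup>2)" "expectation (\<lambda>\<omega>. (G u \<omega>)\<^sup>2) \<le> 1"
proof -
  define X where "X = centred_cos u"
  note X = centred_cos[where u = u, folded X_def]
  have iXX: "integrable M (\<lambda>\<omega>. X i \<omega> * X j \<omega>)" if "i < n" "j < n" for i j
  proof -
    have "\<bar>X i \<omega>\<bar> * \<bar>X j \<omega>\<bar> \<le> 2 * 2" for \<omega> using X(3) by (intro mult_mono) auto
    then show ?thesis using that X(2) by (intro integrable_const_bound[where B=4]) (auto simp: abs_mult)
  qed
  have cross: "expectation (\<lambda>\<omega>. X i \<omega> * X j \<omega>) = 0" if "i < n" "j < n" "i \<noteq> j" for i j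
  proof -
    have "indep_vars (\<lambda>_. borel) X {i, j}" using that by (intro indep_vars_subset[OF X(1)]) auto
    from indep_vars_lebesgue_integral[OF _ this] have
      "expectation (\<lambda>\<omega>. \<Prod>l\<in>{i, j}. X l \<omega>) = (\<Prod>l\<in>{i, j}. expectation (X l))"
      using X(4) that by auto
    then show ?thesis using X(6) that by simp
  qed
  have diag: "expectation (\<lambda>\<omega>. X i \<omega> * X i \<omega>) \<le> 1" if "i < n" for i
  proof -
    have "expectation (\<lambda>\<omega>. X i \<omega> * X i \<omega>) = variance (X i)"
      using X(6)[OF that] by (simp add: power2_eq_square)
    also have "\<dots> = (1 + \<psi> (2 * u)) / 2 - (\<psi> u)\<^sup>2"
      unfolding X_def centred_cos_def[abs_def] by (rule variance_cos[OF that])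
    also have "\<dots> \<le> 1"
      using abs_le_D1[OF \<psi>_abs_le_1[of "2 * u"]] zero_le_power2[of "\<psi> u"] by argo
    finally show ?thesis .
  qed
  have G2: "(G u \<omega>)\<^sup>2 = (\<Sum>i<n. \<Sum>j<n. X i \<omega> * X j \<omega>) / n" for \<omega>
    using n_pos by (simp add: G_def X_def centred_cos_def power_divide power2_eq_square sum_product)
  show "integrable M (\<lambda>\<omega>. (G u \<omega>)\<^sup>2)"
    unfolding G2 using iXX by (intro integrable_divide Bochner_Integration.integrable_sum) auto
  have "expectation (\<lambda>\<omega>. (G u \<omega>)\<^sup>2) = (\<Sum>i<n. \<Sum>j<n. expectation (\<lambda>\<omega>. X i \<omega> * X j \<omega>)) / n"
  proof -
    have "expectation (\<lambda>\<omega>. \<Sum>i<n. \<Sum>j<n. X i \<omega> * X j \<omega>) = (\<Sum>i<n. expectation (\<lambda>\<omega>. \<Sum>j<n. X i \<omega> * X j \<omega>))"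
      using iXX by (intro Bochner_Integration.integral_sum Bochner_Integration.integrable_sum) auto
    also have "\<dots> = (\<Sum>i<n. \<Sum>j<n. expectation (\<lambda>\<omega>. X i \<omega> * X j \<omega>))"
      using iXX by (intro sum.cong refl Bochner_Integration.integral_sum) auto
    finally show ?thesis unfolding G2 by simp
  qed
  also have "\<dots> \<le> (\<Sum>i<n. \<Sum>j<n. if i = j then 1 else 0) / n"
    using cross diag by (intro divide_right_mono sum_mono) auto
  also have "\<dots> = 1" using n_pos by simp
  finally show "expectation (\<lambda>\<omega>. (G u \<omega>)\<^sup>2) \<le> 1" .
qed

end

subsection \<open>Convergence in probability as a filter\<close>

text \<open>The statement is required outside a measurable exceptional set, so P itself may define a
  non-measurable event; quantification over whole intervals of frequencies is therefore harmless.
  The sample space may change with k.\<close>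

definition upto_prob :: "(nat \<Rightarrow> 'a measure) \<Rightarrow> real \<Rightarrow> (nat \<times> 'a \<Rightarrow> bool) \<Rightarrow> bool" where
  "upto_prob M e P \<longleftrightarrow> (\<forall>\<^sub>F k in sequentially.
     \<exists>B\<in>sets (M k). measure (M k) B \<le> e \<and> (\<forall>\<omega>\<in>space (M k) - B. P (k, \<omega>)))"

lemma upto_prob_mono:
  assumes "upto_prob M e P" and "\<And>k \<omega>. P (k, \<omega>) \<Longrightarrow> Q (k, \<omega>)"
  shows "upto_prob M e Q"
  using assms(1) unfolding upto_prob_def by (rule eventually_mono) (use assms(2) in blast)

lemma upto_prob_conj:
  assumes "upto_prob M (e / 2) P" "upto_prob M (e / 2) Q"
  shows "upto_prob M e (\<lambda>z. P z \<and> Q z)"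
  using assms unfolding upto_prob_def
proof eventually_elim
  case (elim k)
  then obtain B B' where B: "B \<in> sets (M k)" "measure (M k) B \<le> e / 2" "\<forall>\<omega>\<in>space (M k) - B. P (k, \<omega>)"
     "B' \<in> sets (M k)" "measure (M k) B' \<le> e / 2" "\<forall>\<omega>\<in>space (M k) - B'. Q (k, \<omega>)"
    by blast
  then have "measure (M k) (B \<union> B') \<le> e"
    using measure_Un_le[of B "M k" B'] by linarith
  then show ?case using B by (intro bexI[of _ "B \<union> B'"]) auto
qed

lemma upto_prob_fst:
  assumes "eventually P sequentially" "e > 0"
  shows "upto_prob M e (\<lambda>z. P (fst z))"
  using assms(1) unfolding upto_prob_def
  by (rule eventually_mono) (use assms(2) in \<open>auto intro!: bexI[of _ "{}"]\<close>)

text \<open>Convergence in probability along a sequence of probability spaces is convergence along the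
  filter of events whose probability tends to one, so the general limit calculus applies to it.\<close>

definition whp :: "(nat \<Rightarrow> 'a measure) \<Rightarrow> (nat \<times> 'a) filter" where
  "whp M = Abs_filter (\<lambda>P. \<forall>e>0. upto_prob M e P)"

lemma eventually_whp: "eventually P (whp M) \<longleftrightarrow> (\<forall>e>0. upto_prob M e P)"
  unfolding whp_def
proof (rule eventually_Abs_filter, rule is_filter.intro, goal_cases)
  case 1
  show ?case using upto_prob_fst[of "\<lambda>_. True" _ M] by simp
next
  case (2 P Q)
  then show ?case by (intro allI impI upto_prob_conj) auto
next
  case (3 P Q)
  then show ?case by (blast intro: upto_prob_mono)
qed

lemma filterlim_fst_whp: "filterlim fst sequentially (whp M)"
  unfolding filterlim_iff eventually_whp by (blast intro: upto_prob_fst)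

lemma tendsto_fst_whp:
  assumes "X \<longlonglongrightarrow> l"
  shows "((\<lambda>z. X (fst z)) \<longlongrightarrow> l) (whp M)"
  using filterlim_compose[OF assms filterlim_fst_whp] .

lemma eventually_whp_sequentially:
  "eventually P sequentially \<Longrightarrow> eventually (\<lambda>z. P (fst z)) (whp M)"
  using filterlim_fst_whp[of M] unfolding filterlim_iff by blast

text \<open>Boundedness in probability, O_P(1), demanded only for large k.\<close>

definition tight_whp :: "(nat \<Rightarrow> 'a measure) \<Rightarrow> (nat \<times> 'a \<Rightarrow> real) \<Rightarrow> bool" where
  "tight_whp M Y \<longleftrightarrow> (\<forall>e>0. \<exists>K>0. upto_prob M e (\<lambda>z. \<bar>Y z\<bar> \<le> K))"

text \<open>The rule o_P(1) O_P(1) = o_P(1).\<close>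

lemma tendsto_mult_tight_whp:
  fixes X Y :: "nat \<times> 'a \<Rightarrow> real"
  assumes X: "(X \<longlongrightarrow> 0) (whp M)" and Y: "tight_whp M Y"
  shows "((\<lambda>z. X z * Y z) \<longlongrightarrow> 0) (whp M)"
  unfolding tendsto_iff eventually_whp
proof (intro allI impI)
  fix \<epsilon> e :: real assume "\<epsilon> > 0" "e > 0"
  then have "e / 2 > 0" by simp
  then obtain K where K: "K > 0" "upto_prob M (e / 2) (\<lambda>z. \<bar>Y z\<bar> \<le> K)"
    using Y unfolding tight_whp_def by blast
  have "eventually (\<lambda>z. dist (X z) 0 < \<epsilon> / K) (whp M)"
    using X \<open>\<epsilon> > 0\<close> K(1) unfolding tendsto_iff by simp
  then have "upto_prob M (e / 2) (\<lambda>z. dist (X z) 0 < \<epsilon> / K)"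
    using \<open>e / 2 > 0\<close> unfolding eventually_whp by blast
  from upto_prob_conj[OF K(2) this] show "upto_prob M e (\<lambda>z. dist (X z * Y z) 0 < \<epsilon>)"
  proof (rule upto_prob_mono)
    fix k \<omega> assume "\<bar>Y (k, \<omega>)\<bar> \<le> K \<and> dist (X (k, \<omega>)) 0 < \<epsilon> / K"
    then have 1: "\<bar>X (k, \<omega>)\<bar> < \<epsilon> / K" "\<bar>Y (k, \<omega>)\<bar> \<le> K" by auto
    have "\<bar>X (k, \<omega>)\<bar> * \<bar>Y (k, \<omega>)\<bar> \<le> \<bar>X (k, \<omega>)\<bar> * K" using 1 by (intro mult_left_mono) auto
    also have "\<dots> < \<epsilon> / K * K" using 1 K(1) by (intro mult_strict_right_mono) auto
    also have "\<dots> = \<epsilon>" using K(1) by simp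
    finally show "dist (X (k, \<omega>) * Y (k, \<omega>)) 0 < \<epsilon>" by (simp add: abs_mult)
  qed
qed

lemma tight_whp_cmult:
  assumes "tight_whp M Y"
  shows "tight_whp M (\<lambda>z. a * Y z)"
  unfolding tight_whp_def
proof (intro allI impI)
  fix e :: real assume "e > 0"
  then obtain K where K: "K > 0" "upto_prob M e (\<lambda>z. \<bar>Y z\<bar> \<le> K)"
    using assms unfolding tight_whp_def by blast
  have "upto_prob M e (\<lambda>z. \<bar>a * Y z\<bar> \<le> (\<bar>a\<bar> + 1) * K)"
    using K(2) by (rule upto_prob_mono) (auto simp: abs_mult intro!: mult_mono)
  then show "\<exists>K>0. upto_prob M e (\<lambda>z. \<bar>a * Y z\<bar> \<le> K)"
    using K(1) by (intro exI[of _ "(\<bar>a\<bar> + 1) * K"]) (auto intro: add_nonneg_pos)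
qed

lemma tight_whp_second_moment:
  assumes M: "\<And>k. prob_space (M k)"
    and Y: "\<forall>\<^sub>F k in sequentially. (\<lambda>\<omega>. Y (k, \<omega>)) \<in> borel_measurable (M k) \<and>
      integrable (M k) (\<lambda>\<omega>. (Y (k, \<omega>))\<^sup>2) \<and> (\<integral>\<omega>. (Y (k, \<omega>))\<^sup>2 \<partial>M k) \<le> c"
  shows "tight_whp M Y"
  unfolding tight_whp_def
proof (intro allI impI)
  fix e :: real assume e: "e > 0"
  \<comment> \<open>Chosen so that Chebyshev's inequality returns exactly e; the added 1 keeps K
    positive.\<close>
  define K where "K = sqrt ((\<bar>c\<bar> + 1) / e)"
  have K: "K > 0" using e by (simp add: K_def)
  have K2: "K\<^sup>2 = (\<bar>c\<bar> + 1) / e" using e by (simp add: K_def)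
  have "upto_prob M e (\<lambda>z. \<bar>Y z\<bar> \<le> K)"
    using Y unfolding upto_prob_def
  proof eventually_elim
    case (elim k)
    then have [measurable]: "(\<lambda>\<omega>. Y (k, \<omega>)) \<in> borel_measurable (M k)" by simp
    define B where "B = {\<omega> \<in> space (M k). (Y (k, \<omega>))\<^sup>2 \<ge> K\<^sup>2}"
    have B: "B \<in> sets (M k)" unfolding B_def by measurable
    have "measure (M k) B \<le> (\<integral>\<omega>. (Y (k, \<omega>))\<^sup>2 \<partial>M k) / K\<^sup>2"
      unfolding B_def using elim K by (intro integral_Markov_inequality_measure[where A="{}"]) auto
    also have "\<dots> \<le> (\<bar>c\<bar> + 1) / K\<^sup>2" using elim by (intro divide_right_mono) auto
    also have "\<dots> = e" using e K2 by simp
    finally have "measure (M k) B \<le> e" .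
    moreover have "\<bar>Y (k, \<omega>)\<bar> \<le> K" if "\<omega> \<in> space (M k) - B" for \<omega>
      using that K by (auto simp: B_def not_le intro!: power2_le_imp_le[of "\<bar>Y (k, \<omega>)\<bar>" K])
    ultimately show ?case using B by blast
  qed
  then show "\<exists>K>0. upto_prob M e (\<lambda>z. \<bar>Y z\<bar> \<le> K)" using K by blast
qed

lemma measure_tendsto_cong_whp:
  assumes M: "\<And>k. prob_space (M k)"
    and A: "\<And>k. A k \<in> sets (M k)" and A': "\<And>k. A' k \<in> sets (M k)"
    and eq: "eventually (\<lambda>(k, \<omega>). \<omega> \<in> A k \<longleftrightarrow> \<omega> \<in> A' k) (whp M)"
    and lim: "(\<lambda>k. measure (M k) (A k)) \<longlonglongrightarrow> l"
  shows "(\<lambda>k. measure (M k) (A' k)) \<longlonglongrightarrow> l"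
proof -
  have "(\<lambda>k. measure (M k) (A' k) - measure (M k) (A k)) \<longlonglongrightarrow> 0"
    unfolding tendsto_iff
  proof (intro allI impI)
    fix \<epsilon> :: real assume "\<epsilon> > 0"
    then have "\<epsilon> / 2 > 0" by simp
    with eq have "upto_prob M (\<epsilon> / 2) (\<lambda>(k, \<omega>). \<omega> \<in> A k \<longleftrightarrow> \<omega> \<in> A' k)"
      unfolding eventually_whp by blast
    then show "\<forall>\<^sub>F k in sequentially. dist (measure (M k) (A' k) - measure (M k) (A k)) 0 < \<epsilon>"
      unfolding upto_prob_def prod.case
    proof eventually_elim
      case (elim k)
      then obtain B where B: "B \<in> sets (M k)" "measure (M k) B \<le> \<epsilon> / 2" "\<forall>\<omega>\<in>space (M k) - B. \<omega> \<in> A k \<longleftrightarrow> \<omega> \<in> A' k"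
        by blast
      interpret prob_space "M k" by (rule M)
      have sub: "A k \<subseteq> space (M k)" "A' k \<subseteq> space (M k)" using A A' sets.sets_into_space by blast+
      have "prob (A' k) \<le> prob (A k \<union> B)" using B A sub by (intro finite_measure_mono) auto
      also have "\<dots> \<le> prob (A k) + prob B" using B A by (intro measure_Un_le) auto
      finally have 1: "prob (A' k) \<le> prob (A k) + prob B" .
      have "prob (A k) \<le> prob (A' k \<union> B)" using B A' sub by (intro finite_measure_mono) auto
      also have "\<dots> \<le> prob (A' k) + prob B" using B A' by (intro measure_Un_le) auto
      finally show ?case using 1 B(2) \<open>\<epsilon> > 0\<close> by (simp add: dist_real_def)
    qed
  qed
  from tendsto_add[OF this lim] show ?thesis by simp
qed

lemma cmod_iexp_diff_le: "cmod (iexp x - iexp y) \<le> \<bar>x - y\<bar>"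
proof -
  have "iexp x - iexp y = iexp y * (iexp (x - y) - 1)"
    by (simp add: algebra_simps flip: exp_add)
  then have "cmod (iexp x - iexp y) = cmod (iexp (x - y) - 1)"
    by (simp add: norm_mult)
  also have "\<dots> \<le> \<bar>x - y\<bar>" using iexp_approx1[of "x - y" 0] by simp
  finally show ?thesis .
qed

text \<open>Proved with characteristic functions: the integrands differ by at most |t| |T - W| off
  the exceptional set and by 2 on it. Levy's continuity theorem then applies although every k has
  its own sample space.\<close>

lemma slutsky_whp:
  assumes M: "\<And>k. prob_space (M k)"
    and W: "\<And>k. W k \<in> borel_measurable (M k)" and T: "\<And>k. T k \<in> borel_measurable (M k)"
    and diff: "((\<lambda>(k, \<omega>). T k \<omega> - W k \<omega>) \<longlongrightarrow> 0) (whp M)"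
    and \<mu>: "real_distribution \<mu>"
    and conv: "weak_conv_m (\<lambda>k. distr (M k) borel (W k)) \<mu>"
  shows "weak_conv_m (\<lambda>k. distr (M k) borel (T k)) \<mu>"
proof (rule levy_continuity)
  show rd: "real_distribution (distr (M k) borel (T k))" for k
    using prob_space.real_distribution_distr[OF M T] .
  show "real_distribution \<mu>" by fact
  fix t
  have cW: "(\<lambda>k. char (distr (M k) borel (W k)) t) \<longlonglongrightarrow> char \<mu> t"
    by (rule levy_continuity1[OF _ \<mu> conv]) (rule prob_space.real_distribution_distr[OF M W])
  have "(\<lambda>k. char (distr (M k) borel (T k)) t - char (distr (M k) borel (W k)) t) \<longlonglongrightarrow> 0"
    unfolding tendsto_iff
  proof (intro allI impI)
    fix \<epsilon> :: real assume \<epsilon>: "\<epsilon> > 0"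
    \<comment> \<open>The good part contributes at most \<epsilon>/4 and the exceptional set 2
      \<epsilon>/4, in total less than \<epsilon>.\<close>
    define \<delta> where "\<delta> = \<epsilon> / (4 * (\<bar>t\<bar> + 1))"
    have \<delta>: "\<delta> > 0" using \<epsilon> by (simp add: \<delta>_def)
    have t\<delta>: "\<bar>t\<bar> * \<delta> \<le> \<epsilon> / 4"
    proof -
      have "\<bar>t\<bar> * \<delta> \<le> (\<bar>t\<bar> + 1) * \<delta>" using \<delta> by (intro mult_right_mono) auto
      also have "\<dots> = \<epsilon> / 4"
        unfolding \<delta>_def by (simp add: field_simps add_nonneg_eq_0_iff)
      finally show ?thesis .
    qed
    have "eventually (\<lambda>z. dist (case z of (k, \<omega>) \<Rightarrow> T k \<omega> - W k \<omega>) 0 < \<delta>) (whp M)"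
      using diff \<delta> unfolding tendsto_iff by blast
    moreover have "\<epsilon> / 4 > 0" using \<epsilon> by simp
    ultimately have "upto_prob M (\<epsilon> / 4) (\<lambda>z. dist (case z of (k, \<omega>) \<Rightarrow> T k \<omega> - W k \<omega>) 0 < \<delta>)"
      unfolding eventually_whp by blast
    then show "\<forall>\<^sub>F k in sequentially. dist (char (distr (M k) borel (T k)) t - char (distr (M k) borel (W k)) t) 0 < \<epsilon>"
      unfolding upto_prob_def prod.case dist_real_def diff_0_right
    proof eventually_elim
      case (elim k)
      then obtain B where B: "B \<in> sets (M k)" "measure (M k) B \<le> \<epsilon> / 4" "\<forall>\<omega>\<in>space (M k) - B. \<bar>T k \<omega> - W k \<omega>\<bar> < \<delta>"
        by blast
      interpret prob_space "M k" by (rule M)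
      note [measurable] = W[of k] T[of k] B(1)
      have i: "integrable (M k) (\<lambda>\<omega>. iexp (t * T k \<omega>))" "integrable (M k) (\<lambda>\<omega>. iexp (t * W k \<omega>))"
        by (rule integrable_iexp; simp)+
      have "char (distr (M k) borel (T k)) t - char (distr (M k) borel (W k)) t =
          (CLINT \<omega>|M k. iexp (t * T k \<omega>) - iexp (t * W k \<omega>))"
        unfolding char_def using i by (simp add: integral_distr Bochner_Integration.integral_diff)
      also have "cmod \<dots> \<le> (\<integral>\<omega>. cmod (iexp (t * T k \<omega>) - iexp (t * W k \<omega>)) \<partial>M k)"
        by (rule integral_norm_bound)
      also have "\<dots> \<le> (\<integral>\<omega>. \<bar>t\<bar> * \<delta> + 2 * indicator B \<omega> \<partial>M k)"
      proof (rule integral_mono)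
        show "integrable (M k) (\<lambda>\<omega>. cmod (iexp (t * T k \<omega>) - iexp (t * W k \<omega>)))" using i by simp
        show "integrable (M k) (\<lambda>\<omega>. \<bar>t\<bar> * \<delta> + 2 * indicator B \<omega>)"
          using B(1) by (auto simp: integrable_indicator_iff emeasure_eq_measure)
        fix \<omega> assume \<omega>: "\<omega> \<in> space (M k)"
        show "cmod (iexp (t * T k \<omega>) - iexp (t * W k \<omega>)) \<le> \<bar>t\<bar> * \<delta> + 2 * indicator B \<omega>"
        proof (cases "\<omega> \<in> B")
          case True
          have "cmod (iexp (t * T k \<omega>) - iexp (t * W k \<omega>)) \<le> cmod (iexp (t * T k \<omega>)) + cmod (iexp (t * W k \<omega>))"
            by (rule norm_triangle_ineq4)
          also have "\<dots> = 2" by (simp only: norm_exp_i_times)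
          finally show ?thesis using True \<delta> by (simp add: add_increasing)
        next
          case False
          have "cmod (iexp (t * T k \<omega>) - iexp (t * W k \<omega>)) \<le> \<bar>t\<bar> * \<bar>T k \<omega> - W k \<omega>\<bar>"
            using cmod_iexp_diff_le[of "t * T k \<omega>" "t * W k \<omega>"] by (simp only: abs_mult right_diff_distrib[symmetric])
          also have "\<dots> \<le> \<bar>t\<bar> * \<delta>" using B(3) False \<omega> by (intro mult_left_mono) (auto intro: less_imp_le)
          finally show ?thesis using False by simp
        qed
      qed
      also have "\<dots> = \<bar>t\<bar> * \<delta> + 2 * prob B"
        using B(1) prob_space by (simp add: Bochner_Integration.integral_add integrable_indicator_iff emeasure_eq_measure)
      also have "\<dots> \<le> \<epsilon> / 4 + 2 * (\<epsilon> / 4)" using B(2) t\<delta> by simp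
      also have "\<dots> < \<epsilon>" using \<epsilon> by simp
      finally show ?case by simp
    qed
  qed
  from tendsto_add[OF this cW] show "(\<lambda>k. char (distr (M k) borel (T k)) t) \<longlonglongrightarrow> char \<mu> t" by simp
qed

subsection \<open>Triangular arrays\<close>

lemma inverse_sqrt_tendsto_0:
  fixes n :: "nat \<Rightarrow> nat"
  assumes "filterlim n at_top sequentially"
  shows "(\<lambda>k. c / sqrt (n k)) \<longlonglongrightarrow> 0"
  using assms
  by (intro real_tendsto_divide_at_top[OF tendsto_const] filterlim_compose[OF sqrt_at_top]
      filterlim_compose[OF filterlim_real_sequentially])

text \<open>One \<open>iid_cos\<close> situation per row, with \<open>C\<close> and \<beta> common
  to all rows: this uniformity turns the finite-sample bounds into limit statements.\<close>

locale cos_array =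
  fixes M :: "nat \<Rightarrow> 'a measure" and n :: "nat \<Rightarrow> nat" and Z :: "nat \<Rightarrow> nat \<Rightarrow> 'a \<Rightarrow> real"
    and \<psi> :: "nat \<Rightarrow> real \<Rightarrow> real" and C \<beta> :: real
  assumes M: "\<And>k. prob_space (M k)"
    and indep: "\<And>k. prob_space.indep_vars (M k) (\<lambda>_. borel) (Z k) {..<n k}"
    and \<psi>: "\<And>k i u. i < n k \<Longrightarrow> (\<integral>\<omega>. cos (u * Z k i \<omega>) \<partial>M k) = \<psi> k u"
    and envelope: "\<And>k i h. i < n k \<Longrightarrow> h > 0 \<Longrightarrow> (\<integral>\<omega>. min 2 (h * \<bar>Z k i \<omega>\<bar>) \<partial>M k) \<le> C * h powr \<beta>"
    and C: "C \<ge> 8" and \<beta>: "0 < \<beta>" "\<beta> \<le> 1"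
    and n_lim: "filterlim n at_top sequentially"
begin

abbreviation "Gk k \<equiv> cos_process (n k) (Z k) (\<psi> k)"

lemma iid: "n k > 0 \<Longrightarrow> iid_cos (M k) (Z k) (n k) (\<psi> k) C \<beta>"
  unfolding iid_cos_def iid_cos_axioms_def using M indep \<psi> envelope C \<beta> by auto

lemma eventually_n_pos: "\<forall>\<^sub>F k in sequentially. n k > 0"
  using n_lim[unfolded filterlim_at_top, THEN spec, of 1] by eventually_elim simp

lemma Z_measurable: "i < n k \<Longrightarrow> Z k i \<in> borel_measurable (M k)"
  using indep[of k] unfolding prob_space.indep_vars_def2[OF M] by auto

lemma G_measurable: "Gk k u \<in> borel_measurable (M k)"
  unfolding cos_process_def
proof (intro borel_measurable_divide borel_measurable_sum)
  fix i assume "i \<in> {..<n k}"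
  then have [measurable]: "Z k i \<in> borel_measurable (M k)" using Z_measurable by simp
  show "(\<lambda>x. cos (u * Z k i x) - \<psi> k u) \<in> borel_measurable (M k)" by measurable
qed auto

lemma G_tight: "tight_whp M (\<lambda>(k, \<omega>). Gk k u \<omega>)"
proof (rule tight_whp_second_moment[OF M])
  show "\<forall>\<^sub>F k in sequentially. (\<lambda>\<omega>. case (k, \<omega>) of (k, \<omega>) \<Rightarrow> Gk k u \<omega>) \<in> borel_measurable (M k) \<and>
      integrable (M k) (\<lambda>\<omega>. (case (k, \<omega>) of (k, \<omega>) \<Rightarrow> Gk k u \<omega>)\<^sup>2) \<and>
      (\<integral>\<omega>. (case (k, \<omega>) of (k, \<omega>) \<Rightarrow> Gk k u \<omega>)\<^sup>2 \<partial>M k) \<le> 1"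
    using eventually_n_pos
  proof eventually_elim
    case (elim k)
    interpret iid_cos "M k" "Z k" "n k" "\<psi> k" C \<beta> by (rule iid[OF elim])
    show ?case using G_second_moment G_measurable by simp
  qed
qed

lemma eventually_scale:
  assumes "L > 0"
  shows "\<forall>\<^sub>F k in sequentially. 1 \<le> L powr \<beta> * n k"
proof -
  have "\<forall>\<^sub>F k in sequentially. n k \<ge> nat \<lceil>1 / L powr \<beta>\<rceil>"
    using n_lim unfolding filterlim_at_top by blast
  then show ?thesis
  proof eventually_elim
    case (elim k)
    then have "1 / L powr \<beta> \<le> n k" by linarith
    then show ?case using assms by (simp add: field_simps)
  qed
qed

text \<open>The geometric series of the chaining thresholds, plus 1 for the increment below the
  finest scale.\<close>

definition chain_const where "chain_const = 1 / (1 - 2 powr (- \<beta> / 4)) + 1"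

lemma chain_const_pos: "chain_const > 0"
proof -
  have "2 powr (- \<beta> / 4) < 1" using \<beta> by (simp add: powr_less_one)
  then show ?thesis unfolding chain_const_def by (simp add: add_pos_pos)
qed

lemma ex_power: "\<exists>N::nat. real N * \<beta> \<ge> 8 \<and> N > 0"
proof -
  obtain N :: nat where "8 / \<beta> < real N" using reals_Archimedean2 by blast
  moreover from this have "N > 0" using \<beta> by (cases N) (auto simp: field_simps)
  ultimately show ?thesis using \<beta> by (intro exI[of _ N]) (auto simp: field_simps)
qed

text \<open>The length L is fixed first, making the term of order L^(\<beta> N/2) in the probability
  small; the terms of order 1 / sqrt n then vanish for large k. Both u and c are compared with the
  left end of the interval, which costs twice \<epsilon>/8 + \<epsilon>/8.\<close>

lemma G_modulus:
  assumes \<epsilon>: "\<epsilon> > 0" and e: "e > 0"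
  shows "\<exists>L>0. upto_prob M e (\<lambda>(k, \<omega>). \<forall>u\<in>{c - L..c + L}. \<bar>Gk k u \<omega> - Gk k c \<omega>\<bar> < \<epsilon>)"
proof -
  define \<eta> where "\<eta> = \<epsilon> / (8 * chain_const)"
  have \<eta>: "\<eta> > 0" using \<epsilon> chain_const_pos by (simp add: \<eta>_def)
  obtain N :: nat where N: "real N * \<beta> \<ge> 8" "N > 0" using ex_power by blast
  have "((\<lambda>L. 12 * (N * (sqrt (2 * C) * L powr (\<beta> / 2)) / \<eta>) ^ N) \<longlongrightarrow> 12 * (N * (sqrt (2 * C) * 0) / \<eta>) ^ N) (at_right 0)"
  proof (intro tendsto_intros)
    show "((\<lambda>L. L powr (\<beta> / 2)) \<longlongrightarrow> 0) (at_right 0)" using \<beta> by real_asymp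
  qed (use \<eta> in auto)
  then have "\<forall>\<^sub>F L in at_right 0. 12 * (N * (sqrt (2 * C) * L powr (\<beta> / 2)) / \<eta>) ^ N < e / 2"
    by (rule order_tendstoD(2)) (use e N in \<open>simp add: zero_power\<close>)
  then have "\<forall>\<^sub>F L in at_right 0. 12 * (N * (sqrt (2 * C) * L powr (\<beta> / 2)) / \<eta>) ^ N < e / 2 \<and> L > 0"
    using eventually_at_right_less[of 0] by eventually_elim auto
  then obtain L where L: "12 * (N * (sqrt (2 * C) * L powr (\<beta> / 2)) / \<eta>) ^ N < e / 2" "L > 0"
    using eventually_happens'[OF trivial_limit_at_right_real] by blast
  have ev1: "\<forall>\<^sub>F k in sequentially. 2 * C / \<eta> / sqrt (n k) < e / 2"
    by (rule order_tendstoD(2)[OF inverse_sqrt_tendsto_0[OF n_lim]]) (use e in simp)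
  have ev2: "\<forall>\<^sub>F k in sequentially. 2 * C / sqrt (n k) < \<epsilon> / 8"
    by (rule order_tendstoD(2)[OF inverse_sqrt_tendsto_0[OF n_lim]]) (use \<epsilon> in simp)
  have "upto_prob M e (\<lambda>(k, \<omega>). \<forall>u\<in>{c - L / 2..c + L / 2}. \<bar>Gk k u \<omega> - Gk k c \<omega>\<bar> < \<epsilon>)"
    unfolding upto_prob_def prod.case
    using ev1 ev2 eventually_scale[OF L(2)] eventually_n_pos
  proof eventually_elim
    case (elim k)
    interpret iid_cos "M k" "Z k" "n k" "\<psi> k" C \<beta> by (rule iid[OF elim(4)])
    from chaining[OF L(2) \<eta> N(1) elim(3), of "c - L / 2"]
    obtain B where B: "B \<in> events"
      "prob B \<le> 12 * (N * (sqrt (2 * C) * L powr (\<beta> / 2)) / \<eta>) ^ N + 2 * C / (\<eta> * sqrt (n k))"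
      "\<And>\<omega> u. \<omega> \<in> space (M k) - B \<Longrightarrow> u \<in> {c - L / 2..c - L / 2 + L} \<Longrightarrow>
        \<bar>Gk k u \<omega> - Gk k (c - L / 2) \<omega>\<bar> \<le> \<eta> * chain_const + 2 * C / sqrt (n k)"
      unfolding chain_const_def by blast
    have "prob B \<le> e" using B(2) L(1) elim(1) by simp
    moreover have "\<bar>Gk k u \<omega> - Gk k c \<omega>\<bar> < \<epsilon>" if "\<omega> \<in> space (M k) - B" "u \<in> {c - L / 2..c + L / 2}" for \<omega> u
    proof -
      have "\<bar>Gk k u \<omega> - Gk k (c - L / 2) \<omega>\<bar> \<le> \<eta> * chain_const + 2 * C / sqrt (n k)"
        using B(3)[of \<omega> u] that by auto
      moreover have "\<bar>Gk k c \<omega> - Gk k (c - L / 2) \<omega>\<bar> \<le> \<eta> * chain_const + 2 * C / sqrt (n k)"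
        using B(3)[of \<omega> c] that L(2) by auto
      moreover have "\<eta> * chain_const = \<epsilon> / 8" using chain_const_pos by (simp add: \<eta>_def)
      ultimately show ?thesis using elim(2) \<epsilon> by linarith
    qed
    ultimately show ?case using B(1) by blast
  qed
  then show ?thesis using L(2) by (intro exI[of _ "L / 2"]) auto
qed

text \<open>The frequency may be any function of the same sample; this is what makes a data-driven
  frequency admissible.\<close>

lemma G_equicontinuous:
  assumes U: "(U \<longlongrightarrow> c) (whp M)"
  shows "((\<lambda>(k, \<omega>). Gk k (U (k, \<omega>)) \<omega> - Gk k c \<omega>) \<longlongrightarrow> 0) (whp M)"
  unfolding tendsto_iff eventually_whp
proof (intro allI impI)
  fix \<epsilon> e :: real assume "\<epsilon> > 0" and "e > 0"
  then have "e / 2 > 0" by simp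
  with \<open>\<epsilon> > 0\<close> obtain L where L: "L > 0"
    "upto_prob M (e / 2) (\<lambda>(k, \<omega>). \<forall>u\<in>{c - L..c + L}. \<bar>Gk k u \<omega> - Gk k c \<omega>\<bar> < \<epsilon>)"
    using G_modulus by blast
  have "upto_prob M (e / 2) (\<lambda>z. dist (U z) c < L)"
    using U L(1) \<open>e / 2 > 0\<close> unfolding tendsto_iff eventually_whp by blast
  from upto_prob_conj[OF L(2) this]
  show "upto_prob M e (\<lambda>z. dist (case z of (k, \<omega>) \<Rightarrow> Gk k (U (k, \<omega>)) \<omega> - Gk k c \<omega>) 0 < \<epsilon>)"
    by (rule upto_prob_mono) (force simp: dist_real_def abs_less_iff)
qed

text \<open>A uniform law of large numbers: chaining on an interval of fixed length with the
  threshold inflated by sqrt n, started at u = 0 where the process vanishes.\<close>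

lemma G_uniform:
  assumes b: "b > 0" and \<delta>: "\<delta> > 0"
  shows "eventually (\<lambda>(k, \<omega>). \<forall>u\<in>{0..b}. \<bar>Gk k u \<omega> / sqrt (n k)\<bar> \<le> \<delta>) (whp M)"
  unfolding eventually_whp
proof (intro allI impI)
  fix e :: real assume e: "e > 0"
  define \<eta> where "\<eta> = \<delta> / (2 * chain_const)"
  have \<eta>: "\<eta> > 0" using \<delta> chain_const_pos by (simp add: \<eta>_def)
  obtain N :: nat where N: "real N * \<beta> \<ge> 8" "N > 0" using ex_power by blast
  note inv = inverse_sqrt_tendsto_0[OF n_lim]
  have "(\<lambda>k. 12 * ((N * (sqrt (2 * C) * b powr (\<beta> / 2)) / \<eta>) / sqrt (n k)) ^ N
      + (2 * C / \<eta>) / sqrt (n k) * (1 / sqrt (n k))) \<longlonglongrightarrow> 12 * 0 ^ N + 0 * 0"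
    by (intro tendsto_intros inv)
  then have ev1: "\<forall>\<^sub>F k in sequentially. 12 * ((N * (sqrt (2 * C) * b powr (\<beta> / 2)) / \<eta>) / sqrt (n k)) ^ N
      + (2 * C / \<eta>) / sqrt (n k) * (1 / sqrt (n k)) < e"
    by (rule order_tendstoD(2)) (use e N in \<open>simp add: zero_power\<close>)
  have "(\<lambda>k. 2 * C / sqrt (n k) * (1 / sqrt (n k))) \<longlonglongrightarrow> 0 * 0"
    by (intro tendsto_intros inv)
  then have ev2: "\<forall>\<^sub>F k in sequentially. 2 * C / sqrt (n k) * (1 / sqrt (n k)) < \<delta> / 2"
    by (rule order_tendstoD(2)) (use \<delta> in simp)
  show "upto_prob M e (\<lambda>(k, \<omega>). \<forall>u\<in>{0..b}. \<bar>Gk k u \<omega> / sqrt (n k)\<bar> \<le> \<delta>)"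
    unfolding upto_prob_def prod.case
    using ev1 ev2 eventually_scale[OF b] eventually_n_pos
  proof eventually_elim
    case (elim k)
    interpret iid_cos "M k" "Z k" "n k" "\<psi> k" C \<beta> by (rule iid[OF elim(4)])
    have sq: "sqrt (n k) > 0" using elim(4) by simp
    then have "\<eta> * sqrt (n k) > 0" using \<eta> by simp
    from chaining[OF b this N(1) elim(3), of 0]
    obtain B where B: "B \<in> events"
      "prob B \<le> 12 * (N * (sqrt (2 * C) * b powr (\<beta> / 2)) / (\<eta> * sqrt (n k))) ^ N + 2 * C / (\<eta> * sqrt (n k) * sqrt (n k))"
      "\<And>\<omega> u. \<omega> \<in> space (M k) - B \<Longrightarrow> u \<in> {0..0 + b} \<Longrightarrow>
        \<bar>Gk k u \<omega> - Gk k 0 \<omega>\<bar> \<le> \<eta> * sqrt (n k) * chain_const + 2 * C / sqrt (n k)"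
      unfolding chain_const_def by blast
    have "\<psi> k 0 = 1" using \<psi>[of 0 0] elim(4) prob_space by simp
    then have G0: "Gk k 0 \<omega> = 0" for \<omega> by (simp add: cos_process_def)
    have "\<bar>Gk k u \<omega> / sqrt (n k)\<bar> \<le> \<delta>" if "\<omega> \<in> space (M k) - B" "u \<in> {0..b}" for \<omega> u
    proof -
      have "\<bar>Gk k u \<omega> / sqrt (n k)\<bar> = \<bar>Gk k u \<omega>\<bar> / sqrt (n k)" by simp
      also have "\<dots> \<le> (\<eta> * sqrt (n k) * chain_const + 2 * C / sqrt (n k)) / sqrt (n k)"
        using B(3)[of \<omega> u] that G0 by (intro divide_right_mono) auto
      also have "\<dots> = \<eta> * chain_const + 2 * C / sqrt (n k) * (1 / sqrt (n k))"
        using sq by (simp add: add_divide_distrib)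
      also have "\<eta> * chain_const = \<delta> / 2" using chain_const_pos by (simp add: \<eta>_def)
      finally show ?thesis using elim(2) by linarith
    qed
    moreover have "prob B \<le> e" using B(2) elim(1) by (simp add: field_simps)
    ultimately show ?case using B(1) by auto
  qed
qed

lemma G_clt:
  assumes p: "(\<lambda>k. \<psi> k u) \<longlonglongrightarrow> p" and p2: "(\<lambda>k. \<psi> k (2 * u)) \<longlonglongrightarrow> p2"
    and a: "a\<^sup>2 * ((1 + p2) / 2 - p\<^sup>2) = 1"
  shows "weak_conv_m (\<lambda>k. distr (M k) borel (\<lambda>\<omega>. a * Gk k u \<omega>)) std_normal_distribution"
proof (rule levy_continuity)
  show "real_distribution (distr (M k) borel (\<lambda>\<omega>. a * Gk k u \<omega>))" for k
    using G_measurable by (intro prob_space.real_distribution_distr[OF M]) auto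
  show "real_distribution std_normal_distribution" by (rule real_dist_normal_dist)
  fix t
  define \<theta> where "\<theta> = t * a"
  define E where "E k = complex_of_real (exp (- (\<theta>\<^sup>2 * ((1 + \<psi> k (2 * u)) / 2 - (\<psi> k u)\<^sup>2) / 2)))" for k
  have "E \<longlonglongrightarrow> complex_of_real (exp (- (\<theta>\<^sup>2 * ((1 + p2) / 2 - p\<^sup>2) / 2)))"
    unfolding E_def by (intro tendsto_intros p p2) auto
  also have "\<theta>\<^sup>2 * ((1 + p2) / 2 - p\<^sup>2) = t\<^sup>2" using a by (simp add: \<theta>_def power_mult_distrib)
  finally have E: "E \<longlonglongrightarrow> char std_normal_distribution t"
    by (simp add: char_std_normal_distribution)
  have "(\<lambda>k. char (distr (M k) borel (\<lambda>\<omega>. a * Gk k u \<omega>)) t - E k) \<longlonglongrightarrow> 0"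
  proof (rule Lim_null_comparison)
    show "\<forall>\<^sub>F k in sequentially. cmod (char (distr (M k) borel (\<lambda>\<omega>. a * Gk k u \<omega>)) t - E k) \<le>
        2 * \<bar>\<theta>\<bar> ^ 3 / sqrt (n k) + \<theta> ^ 4 / sqrt (n k) * (1 / sqrt (n k))"
      using eventually_n_pos
    proof eventually_elim
      case (elim k)
      interpret iid_cos "M k" "Z k" "n k" "\<psi> k" C \<beta> by (rule iid[OF elim])
      show ?case using char_G_approx[of a u t] by (simp add: E_def \<theta>_def)
    qed
    have "(\<lambda>k. 2 * \<bar>\<theta>\<bar> ^ 3 / sqrt (n k) + \<theta> ^ 4 / sqrt (n k) * (1 / sqrt (n k))) \<longlonglongrightarrow> 0 + 0 * 0"
      by (intro tendsto_intros inverse_sqrt_tendsto_0[OF n_lim])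
    then show "(\<lambda>k. 2 * \<bar>\<theta>\<bar> ^ 3 / sqrt (n k) + \<theta> ^ 4 / sqrt (n k) * (1 / sqrt (n k))) \<longlonglongrightarrow> 0" by simp
  qed
  from tendsto_add[OF this E]
  show "(\<lambda>k. char (distr (M k) borel (\<lambda>\<omega>. a * Gk k u \<omega>)) t) \<longlonglongrightarrow> char std_normal_distribution t" by simp
qed

end

subsection \<open>The pilot frequency\<close>

text \<open>Markov's inequality for the number of indices satisfying P, whose mean is at most n p,
  at level n/4.\<close>

lemma (in prob_space) prob_quarter_count_le:
  assumes A: "\<And>i. i < n \<Longrightarrow> {\<omega> \<in> space M. P i \<omega>} \<in> events"
    and p: "\<And>i. i < n \<Longrightarrow> prob {\<omega> \<in> space M. P i \<omega>} \<le> p" and n: "n > 0"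
  shows "\<exists>B\<in>events. prob B \<le> 4 * p \<and> (\<forall>\<omega>\<in>space M - B. 4 * card {i. i < n \<and> P i \<omega>} < n)"
proof -
  define S where "S \<omega> = (\<Sum>i<n. indicator {\<omega> \<in> space M. P i \<omega>} \<omega> :: real)" for \<omega>
  have card: "S \<omega> = card {i. i < n \<and> P i \<omega>}" if "\<omega> \<in> space M" for \<omega>
  proof -
    have "{i. i < n \<and> P i \<omega>} = {..<n} \<inter> {i. P i \<omega>}" by auto
    then show ?thesis using that by (simp add: S_def indicator_def of_bool_def sum.If_cases)
  qed
  have int: "integrable M S"
    unfolding S_def using A
    by (intro Bochner_Integration.integrable_sum) (auto simp: integrable_indicator_iff emeasure_eq_measure)
  define B where "B = {\<omega> \<in> space M. S \<omega> \<ge> n / 4}"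
  have Sm [measurable]: "S \<in> borel_measurable M" using int by simp
  have "prob B \<le> expectation S / (n / 4)"
    unfolding B_def using n
    by (intro integral_Markov_inequality_measure[where A="{}", OF int]) (auto simp: S_def intro!: sum_nonneg)
  also have "expectation S = (\<Sum>i<n. prob {\<omega> \<in> space M. P i \<omega>})"
    unfolding S_def using A
    by (subst Bochner_Integration.integral_sum) (auto simp: integrable_indicator_iff emeasure_eq_measure)
  also have "\<dots> / (n / 4) \<le> (\<Sum>i<n. p) / (n / 4)"
    using p n by (intro divide_right_mono sum_mono) auto
  also have "\<dots> = 4 * p" using n by simp
  finally have "prob B \<le> 4 * p" .
  moreover have "B \<in> events" unfolding B_def by measurable
  moreover have "4 * card {i. i < n \<and> P i \<omega>} < n" if "\<omega> \<in> space M - B" for \<omega>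
  proof -
    have "real (card {i. i < n \<and> P i \<omega>}) < n / 4"
      using that card[of \<omega>] by (auto simp: B_def)
    then have "real (4 * card {i. i < n \<and> P i \<omega>}) < real n" by simp
    then show ?thesis by (simp only: of_nat_less_iff)
  qed
  ultimately show ?thesis by blast
qed

text \<open>The integrand vanishes in the limit except at w = 0, a null set of the normal law. With
  \<open>prob_small_le_gauss\<close> this says that stable variables do not concentrate at
  0.\<close>

lemma stable_gauss_tendsto_0:
  assumes "q > 0"
  shows "(\<lambda>m. LINT w|std_normal_distribution. exp (- (\<bar>real m * w\<bar> powr q))) \<longlonglongrightarrow> 0"
proof -
  interpret N: real_distribution std_normal_distribution by (rule real_dist_normal_dist)
  have "(\<lambda>m. LINT w|std_normal_distribution. exp (- (\<bar>real m * w\<bar> powr q))) \<longlonglongrightarrow> (LINT w|std_normal_distribution. 0)"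
  proof (rule integral_dominated_convergence[where w = "\<lambda>_. 1"])
    have "(\<lambda>m. exp (- (\<bar>real m * w\<bar> powr q))) \<longlonglongrightarrow> 0" if "w \<noteq> 0" for w :: real
    proof -
      have "filterlim (\<lambda>m. \<bar>real m * w\<bar> powr q) at_top sequentially"
        using that assms unfolding abs_mult by real_asymp
      then show ?thesis
        by (intro filterlim_compose[OF exp_at_bot] filterlim_uminus_at_top[THEN iffD1])
    qed
    moreover have "AE w in std_normal_distribution. w \<noteq> 0"
      by (subst AE_density) (use AE_lborel_singleton[of "0::real"] in auto)
    ultimately show "AE w in std_normal_distribution. (\<lambda>m. exp (- (\<bar>real m * w\<bar> powr q))) \<longlonglongrightarrow> 0"
      by auto
  qed auto
  then show ?thesis by simp
qed

text \<open>In normalised form \<open>s\<close> is the scale gamma ||x||_q, \<open>\<rho>\<close> is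
  sigma / s, and the observations are s Z. The noise level therefore appears as
  \<open>\<rho> k * s k\<close> throughout.\<close>

locale stable_model = noise_min q e \<rho>bar F0 cstar
  for q e \<rho>bar :: real and F0 :: "real measure" and cstar :: "real \<Rightarrow> real" +
  fixes M :: "nat \<Rightarrow> 'a measure" and n :: "nat \<Rightarrow> nat" and Z :: "nat \<Rightarrow> nat \<Rightarrow> 'a \<Rightarrow> real"
    and s \<gamma> \<rho> :: "nat \<Rightarrow> real" and \<eta>0 :: real
  assumes prob: "\<And>k. prob_space (M k)"
    and indep_Z: "\<And>k. prob_space.indep_vars (M k) (\<lambda>_. borel) (Z k) {..<n k}"
    and char_Z: "\<And>k i u. i < n k \<Longrightarrow>
      (\<integral>\<omega>. cos (u * Z k i \<omega>) \<partial>M k) = exp (- (\<bar>u\<bar> powr q)) * phi0 F0 (\<rho> k * u)"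
    and n_infty: "filterlim n at_top sequentially"
    and s: "\<And>k. s k > 0" and \<gamma>: "\<And>k. \<gamma> k > 0" and \<rho>: "\<And>k. \<rho> k > 0" "\<rho> \<longlonglongrightarrow> \<rho>bar"
    and F0_abs: "integrable F0 abs"
    and \<eta>0: "\<eta>0 > 0" "\<And>\<eta>. 0 \<le> \<eta> \<Longrightarrow> \<eta> \<le> \<eta>0 \<Longrightarrow> phi0 F0 \<eta> > 1/2"
begin

definition \<psi> where "\<psi> k u = exp (- (\<bar>u\<bar> powr q)) * phi0 F0 (\<rho> k * u)"

text \<open>The constant of \<open>expectation_envelope_le\<close> with K = sup \<rho> times the
  absolute noise moment; the supremum makes it uniform in k.\<close>

definition C0 where "C0 = 8 * (1 + (SUP k. \<rho> k) * integral\<^sup>L F0 abs)"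

lemma \<rho>_le_Sup: "\<rho> k \<le> (SUP k. \<rho> k)"
  using \<rho>(2) by (intro cSUP_upper bounded_imp_bdd_above)
    (auto simp: convergent_imp_bounded convergentI)

text \<open>Writing 1 - x f = (1 - x) + x (1 - f) separates the stable factor, which contributes
  |u|^q, from the noise factor, which contributes a linear term.\<close>

lemma one_minus_\<psi>_le: "1 - \<psi> k u \<le> \<bar>u\<bar> powr q + (SUP k. \<rho> k) * integral\<^sup>L F0 abs * \<bar>u\<bar>"
proof -
  interpret F: real_distribution F0 by (rule F0)
  define x where "x = exp (- (\<bar>u\<bar> powr q))"
  have x: "1 - x \<le> \<bar>u\<bar> powr q" "0 \<le> x" "x \<le> 1"
    using exp_ge_add_one_self[of "- (\<bar>u\<bar> powr q)"] by (simp_all add: x_def)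
  define f where "f = phi0 F0 (\<rho> k * u)"
  have m: "integral\<^sup>L F0 abs \<ge> 0" by simp
  have f: "1 - f \<le> \<bar>\<rho> k * u\<bar> * integral\<^sup>L F0 abs" "f \<le> 1"
    using F.one_minus_phi0_le[OF F0_abs] F.abs_phi0_le_1[of "\<rho> k * u"] by (simp_all add: f_def)
  have "1 - x * f = (1 - x) + x * (1 - f)" by (simp add: algebra_simps)
  also have "x * (1 - f) \<le> 1 * (1 - f)" using x f by (intro mult_right_mono) auto
  also have "1 * (1 - f) \<le> \<rho> k * \<bar>u\<bar> * integral\<^sup>L F0 abs" using f(1) \<rho>(1)[of k] by (simp add: abs_mult)
  also have "\<dots> \<le> (SUP k. \<rho> k) * \<bar>u\<bar> * integral\<^sup>L F0 abs"
    using \<rho>_le_Sup m by (intro mult_right_mono) auto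
  finally show ?thesis using x(1) by (simp add: \<psi>_def x_def f_def mult_ac)
qed

lemma Z_rv: "i < n k \<Longrightarrow> Z k i \<in> borel_measurable (M k)"
  using indep_Z[of k] unfolding prob_space.indep_vars_def2[OF prob] by auto

lemma \<psi>_measurable: "\<psi> k \<in> borel_measurable borel"
proof -
  interpret F: real_distribution F0 by (rule F0)
  show ?thesis unfolding \<psi>_def by measurable
qed

lemma Sup_\<rho>_moment_nonneg: "(SUP k. \<rho> k) * integral\<^sup>L F0 abs \<ge> 0"
  using \<rho>(1)[of 0] \<rho>_le_Sup[of 0] by (intro mult_nonneg_nonneg) auto

sublocale cos_array M n Z \<psi> C0 "q / 4"
proof (rule cos_array.intro)
  show "prob_space (M k)" for k by (rule prob)
  show "prob_space.indep_vars (M k) (\<lambda>_. borel) (Z k) {..<n k}" for k by (rule indep_Z)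
  show "(\<integral>\<omega>. cos (u * Z k i \<omega>) \<partial>M k) = \<psi> k u" if "i < n k" for k i u
    using char_Z[OF that] by (simp add: \<psi>_def)
  show "(\<integral>\<omega>. min 2 (h * \<bar>Z k i \<omega>\<bar>) \<partial>M k) \<le> C0 * h powr (q / 4)" if "i < n k" "h > 0" for k i h
    unfolding C0_def
  proof (rule prob_space.expectation_envelope_le[OF prob, where \<psi> = "\<psi> k"])
    show "(\<integral>\<omega>. cos (u * Z k i \<omega>) \<partial>M k) = \<psi> k u" for u
      using char_Z[OF that(1)] by (simp add: \<psi>_def)
  qed (use Z_rv[OF that(1)] \<psi>_measurable q that Sup_\<rho>_moment_nonneg one_minus_\<psi>_le in auto)
  show "8 \<le> C0" using Sup_\<rho>_moment_nonneg by (simp add: C0_def)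
  show "0 < q / 4" "q / 4 \<le> 1" using q by auto
  show "filterlim n at_top sequentially" by (rule n_infty)
qed

definition y where "y k \<omega> i = s k * Z k i \<omega>"

definition med where "med k \<omega> = median (n k) (\<lambda>i. \<bar>y k \<omega> i\<bar>)"

text \<open>As |phi0| <= 1, the noiseless transform dominates \<psi>, so the small-ball bound is the
  same for every row.\<close>

lemma med_lower_whp:
  assumes "d > 0"
  shows "\<exists>a>0. upto_prob M d (\<lambda>(k, \<omega>). s k * a < med k \<omega>)"
proof -
  define g where "g m = (LINT w|std_normal_distribution. exp (- (\<bar>real m * w\<bar> powr q)))" for m
  interpret N: real_distribution std_normal_distribution by (rule real_dist_normal_dist)
  interpret F: real_distribution F0 by (rule F0)
  \<comment> \<open>The eighth is spent on a factor 2 in \<open>prob_small_le_gauss\<close> and a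
    factor 4 in \<open>prob_quarter_count_le\<close>.\<close>
  have "\<forall>\<^sub>F m in sequentially. g m < d / 8"
    using stable_gauss_tendsto_0[OF q(1)] assms unfolding g_def by (intro order_tendstoD(2)) auto
  then have "\<forall>\<^sub>F m in sequentially. g m < d / 8 \<and> m > 0"
    using eventually_gt_at_top[of "0::nat"] by eventually_elim auto
  then obtain m where m: "g m < d / 8" "m > 0"
    using eventually_happens'[OF sequentially_bot] by blast
  have small: "measure (M k) {\<omega> \<in> space (M k). \<bar>Z k i \<omega>\<bar> \<le> 1 / m} \<le> d / 4" if i: "i < n k" for i k
  proof -
    interpret prob_space "M k" by (rule prob)
    have "prob {\<omega> \<in> space (M k). \<bar>Z k i \<omega>\<bar> \<le> 1 / m} \<le> 2 * (LINT w|std_normal_distribution. \<psi> k (real m * w))"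
      using i m Z_rv char_Z by (intro prob_small_le_gauss) (auto simp: \<psi>_def)
    also have "(LINT w|std_normal_distribution. \<psi> k (real m * w)) \<le> g m"
      unfolding g_def
    proof (rule integral_mono)
      have b: "\<bar>\<psi> k u\<bar> \<le> exp (- (\<bar>u\<bar> powr q))" for u
        using F.abs_phi0_le_1[of "\<rho> k * u"] by (simp add: \<psi>_def abs_mult mult_left_le)
      have "\<bar>\<psi> k u\<bar> \<le> 1" for u using order_trans[OF b[of u]] by simp
      moreover have "(\<lambda>w. \<psi> k (real m * w)) \<in> borel_measurable borel"
        by (rule measurable_compose[OF _ \<psi>_measurable]) simp
      ultimately show "integrable std_normal_distribution (\<lambda>w. \<psi> k (real m * w))"
        by (intro N.integrable_const_bound[where B=1]) auto
      show "integrable std_normal_distribution (\<lambda>w. exp (- (\<bar>real m * w\<bar> powr q)))"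
        by (intro N.integrable_const_bound[where B=1]) auto
      show "\<psi> k (real m * w) \<le> exp (- (\<bar>real m * w\<bar> powr q))" for w using b[of "real m * w"] by simp
    qed
    finally show ?thesis using m by simp
  qed
  have "\<forall>\<^sub>F k in sequentially. n k \<ge> 4" using n_infty unfolding filterlim_at_top by blast
  then have "upto_prob M d (\<lambda>(k, \<omega>). s k * (1 / m) < med k \<omega>)"
    unfolding upto_prob_def prod.case
  proof eventually_elim
    case (elim k)
    interpret prob_space "M k" by (rule prob)
    have "\<exists>B\<in>events. prob B \<le> 4 * (d / 4) \<and> (\<forall>\<omega>\<in>space (M k) - B. 4 * card {i. i < n k \<and> \<bar>Z k i \<omega>\<bar> \<le> 1 / m} < n k)"
      using small elim Z_rv by (intro prob_quarter_count_le) auto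
    then obtain B where B: "B \<in> events" "prob B \<le> d"
      "\<And>\<omega>. \<omega> \<in> space (M k) - B \<Longrightarrow> 4 * card {i. i < n k \<and> \<bar>Z k i \<omega>\<bar> \<le> 1 / m} < n k"
      by auto
    have "s k * (1 / m) < med k \<omega>" if "\<omega> \<in> space (M k) - B" for \<omega>
      unfolding med_def
    proof (rule median_lower[OF elim])
      have "{i. i < n k \<and> \<bar>y k \<omega> i\<bar> \<le> s k * (1 / m)} = {i. i < n k \<and> \<bar>Z k i \<omega>\<bar> \<le> 1 / m}"
        using s[of k] by (simp add: y_def abs_mult del: times_divide_eq_right)
      then show "4 * card {i. i < n k \<and> \<bar>y k \<omega> i\<bar> \<le> s k * (1 / m)} < n k" using B(3)[OF that] by simp
    qed
    then show ?case using B by blast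
  qed
  then show ?thesis using m(2) by (intro exI[of _ "1 / m"]) auto
qed

text \<open>The event |Z| > 2/h lies in the set where the envelope has saturated at 2, so Markov's
  inequality gives a tail bound without moments.\<close>

lemma med_upper_whp:
  assumes "d > 0"
  shows "\<exists>b>0. upto_prob M d (\<lambda>(k, \<omega>). med k \<omega> \<le> s k * b)"
proof -
  have "((\<lambda>h. C0 * h powr (q / 4) / 2) \<longlongrightarrow> C0 * 0 / 2) (at_right 0)"
  proof (intro tendsto_intros)
    show "((\<lambda>h. h powr (q / 4)) \<longlongrightarrow> 0) (at_right 0)" using q by real_asymp
  qed auto
  then have "\<forall>\<^sub>F h in at_right 0. C0 * h powr (q / 4) / 2 < d / 4"
    using assms by (intro order_tendstoD(2)) auto
  then have "\<forall>\<^sub>F h in at_right 0. C0 * h powr (q / 4) / 2 < d / 4 \<and> h > 0"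
    using eventually_at_right_less[of 0] by eventually_elim auto
  then obtain h where h: "C0 * h powr (q / 4) / 2 < d / 4" "h > 0"
    using eventually_happens'[OF trivial_limit_at_right_real] by blast
  have small: "measure (M k) {\<omega> \<in> space (M k). \<bar>Z k i \<omega>\<bar> > 2 / h} \<le> d / 4" if i: "i < n k" for i k
  proof -
    interpret prob_space "M k" by (rule prob)
    note [measurable] = Z_rv[OF i]
    have "prob {\<omega> \<in> space (M k). \<bar>Z k i \<omega>\<bar> > 2 / h} \<le> prob {\<omega> \<in> space (M k). min 2 (h * \<bar>Z k i \<omega>\<bar>) \<ge> 2}"
      using h(2) by (intro finite_measure_mono) (auto simp: field_simps)
    also have "\<dots> \<le> expectation (\<lambda>\<omega>. min 2 (h * \<bar>Z k i \<omega>\<bar>)) / 2"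
      using h(2) by (intro integral_Markov_inequality_measure[where A="{}"] integrable_const_bound[where B=2]) auto
    also have "\<dots> \<le> C0 * h powr (q / 4) / 2"
      using envelope[OF i h(2)] by simp
    finally show ?thesis using h(1) by simp
  qed
  have "upto_prob M d (\<lambda>(k, \<omega>). med k \<omega> \<le> s k * (2 / h))"
    unfolding upto_prob_def prod.case
    using eventually_n_pos
  proof eventually_elim
    case (elim k)
    interpret prob_space "M k" by (rule prob)
    have "\<exists>B\<in>events. prob B \<le> 4 * (d / 4) \<and> (\<forall>\<omega>\<in>space (M k) - B. 4 * card {i. i < n k \<and> \<bar>Z k i \<omega>\<bar> > 2 / h} < n k)"
      using small elim Z_rv by (intro prob_quarter_count_le) auto
    then obtain B where B: "B \<in> events" "prob B \<le> d"
      "\<And>\<omega>. \<omega> \<in> space (M k) - B \<Longrightarrow> 4 * card {i. i < n k \<and> \<bar>Z k i \<omega>\<bar> > 2 / h} < n k"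
      by auto
    have "med k \<omega> \<le> s k * (2 / h)" if "\<omega> \<in> space (M k) - B" for \<omega>
      unfolding med_def
    proof (rule median_upper)
      have "{i. i < n k \<and> \<bar>y k \<omega> i\<bar> > s k * (2 / h)} = {i. i < n k \<and> \<bar>Z k i \<omega>\<bar> > 2 / h}"
        using s[of k] by (simp add: y_def abs_mult del: times_divide_eq_right)
      then show "4 * card {i. i < n k \<and> \<bar>y k \<omega> i\<bar> > s k * (2 / h)} < n k" using B(3)[OF that] by simp
    qed (use elim in auto)
    then show ?case using B by blast
  qed
  then show ?thesis using h(2) by (intro exI[of _ "2 / h"]) auto
qed

text \<open>The pilot frequency on the scale of the normalised sample, u = s t.\<close>

definition u_pilot where "u_pilot k \<omega> = s k * t_pilot F0 \<eta>0 (\<rho> k * s k) (n k) (y k \<omega>)"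

lemma u_pilot_eq: "u_pilot k \<omega> = min (s k / med k \<omega>) (\<eta>0 / \<rho> k)"
  using s[of k] by (simp add: u_pilot_def t_pilot_def med_def min_mult_distrib_left)

lemma u_pilot_bounds_whp:
  assumes "d > 0"
  shows "\<exists>lo>0. \<exists>hi>0. upto_prob M d (\<lambda>(k, \<omega>). lo \<le> u_pilot k \<omega> \<and> u_pilot k \<omega> \<le> hi)"
proof -
  define R where "R = (SUP k. \<rho> k)"
  have R: "\<rho> k \<le> R" for k unfolding R_def by (rule \<rho>_le_Sup)
  have R0: "R > 0" using R[of 0] \<rho>(1)[of 0] by linarith
  have "d / 2 > 0" using assms by simp
  obtain a where a: "a > 0" "upto_prob M (d / 2) (\<lambda>(k, \<omega>). s k * a < med k \<omega>)"
    using med_lower_whp[OF \<open>d / 2 > 0\<close>] by blast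
  obtain b where b: "b > 0" "upto_prob M (d / 2) (\<lambda>(k, \<omega>). med k \<omega> \<le> s k * b)"
    using med_upper_whp[OF \<open>d / 2 > 0\<close>] by blast
  \<comment> \<open>The first entry comes from the upper bound on the median; the second bounds the
    cap \<eta>0 / \<rho> from below, using that \<rho> is bounded.\<close>
  define lo where "lo = min (1 / b) (\<eta>0 / R)"
  have "lo > 0" using b(1) \<eta>0 R0 by (simp add: lo_def)
  moreover have "upto_prob M d (\<lambda>(k, \<omega>). lo \<le> u_pilot k \<omega> \<and> u_pilot k \<omega> \<le> 1 / a)"
    using upto_prob_conj[OF a(2) b(2)]
  proof (rule upto_prob_mono, unfold prod.case)
    fix k \<omega> assume m: "s k * a < med k \<omega> \<and> med k \<omega> \<le> s k * b"
    have "s k * a > 0" using s[of k] a(1) by simp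
    then have m0: "med k \<omega> > 0" using m by linarith
    have "s k / med k \<omega> \<le> 1 / a" using m m0 a(1) by (simp add: field_simps)
    moreover have "1 / b \<le> s k / med k \<omega>" using m m0 b(1) by (simp add: field_simps)
    moreover have "\<eta>0 / R \<le> \<eta>0 / \<rho> k" using R \<rho>(1) R0 \<eta>0 by (intro divide_left_mono) auto
    ultimately show "lo \<le> u_pilot k \<omega> \<and> u_pilot k \<omega> \<le> 1 / a" unfolding u_pilot_eq lo_def by auto
  qed
  ultimately show ?thesis using a(1) by (intro exI[of _ lo] exI[of _ "1 / a"] conjI) auto
qed

lemma u_pilot_pos_whp: "eventually (\<lambda>(k, \<omega>). u_pilot k \<omega> > 0) (whp M)"
  unfolding eventually_whp
proof (intro allI impI)
  fix d :: real assume "d > 0"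
  from u_pilot_bounds_whp[OF this] obtain lo hi where "lo > 0"
    and "upto_prob M d (\<lambda>(k, \<omega>). lo \<le> u_pilot k \<omega> \<and> u_pilot k \<omega> \<le> hi)" by blast
  from this(2) show "upto_prob M d (\<lambda>(k, \<omega>). u_pilot k \<omega> > 0)"
    by (rule upto_prob_mono) (use \<open>lo > 0\<close> in auto)
qed

lemma phi0_u_pilot: "u_pilot k \<omega> > 0 \<Longrightarrow> phi0 F0 (\<rho> k * u_pilot k \<omega>) > 1 / 2"
proof (rule \<eta>0(2))
  assume "u_pilot k \<omega> > 0"
  then show "0 \<le> \<rho> k * u_pilot k \<omega>" using \<rho>(1)[of k] by simp
  have "u_pilot k \<omega> \<le> \<eta>0 / \<rho> k" by (simp add: u_pilot_eq)
  then show "\<rho> k * u_pilot k \<omega> \<le> \<eta>0" using \<rho>(1)[of k] by (simp add: field_simps)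
qed

text \<open>Only two-sided bounds are known for the pilot frequency, not a limit, so smallness is
  taken from \<open>G_uniform\<close> on the interval up to the upper bound.\<close>

lemma G_u_pilot: "((\<lambda>(k, \<omega>). Gk k (u_pilot k \<omega>) \<omega> / sqrt (n k)) \<longlongrightarrow> 0) (whp M)"
  unfolding tendsto_iff eventually_whp
proof (intro allI impI)
  fix \<epsilon> d :: real assume \<epsilon>: "\<epsilon> > 0" and "d > 0"
  then have d2: "d / 2 > 0" "\<epsilon> / 2 > 0" by simp_all
  from u_pilot_bounds_whp[OF d2(1)] obtain lo hi where lo: "lo > 0" "hi > 0" and
    ev: "upto_prob M (d / 2) (\<lambda>(k, \<omega>). lo \<le> u_pilot k \<omega> \<and> u_pilot k \<omega> \<le> hi)" by blast
  have ev': "upto_prob M (d / 2) (\<lambda>(k, \<omega>). \<forall>u\<in>{0..hi}. \<bar>Gk k u \<omega> / sqrt (n k)\<bar> \<le> \<epsilon> / 2)"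
    using G_uniform[OF lo(2) d2(2)] d2(1) unfolding eventually_whp by blast
  from upto_prob_conj[OF ev ev']
  show "upto_prob M d (\<lambda>z. dist (case z of (k, \<omega>) \<Rightarrow> Gk k (u_pilot k \<omega>) \<omega> / sqrt (n k)) 0 < \<epsilon>)"
  proof (rule upto_prob_mono, unfold prod.case)
    fix k \<omega>
    assume *: "(lo \<le> u_pilot k \<omega> \<and> u_pilot k \<omega> \<le> hi) \<and> (\<forall>u\<in>{0..hi}. \<bar>Gk k u \<omega> / sqrt (n k)\<bar> \<le> \<epsilon> / 2)"
    then have "u_pilot k \<omega> \<in> {0..hi}" using lo by auto
    then have "\<bar>Gk k (u_pilot k \<omega>) \<omega> / sqrt (n k)\<bar> \<le> \<epsilon> / 2" using * by blast
    then show "dist (Gk k (u_pilot k \<omega>) \<omega> / sqrt (n k)) 0 < \<epsilon>"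
      using \<epsilon> unfolding dist_real_def diff_0_right by linarith
  qed
qed

lemma u_pilot_tight:
  "tight_whp M (\<lambda>(k, \<omega>). 1 / \<psi> k (u_pilot k \<omega>))" (is ?A)
  "tight_whp M (\<lambda>(k, \<omega>). u_pilot k \<omega> powr (- q))" (is ?B)
proof -
  have "(\<exists>K>0. upto_prob M d (\<lambda>z. \<bar>case z of (k, \<omega>) \<Rightarrow> 1 / \<psi> k (u_pilot k \<omega>)\<bar> \<le> K)) \<and>
    (\<exists>K>0. upto_prob M d (\<lambda>z. \<bar>case z of (k, \<omega>) \<Rightarrow> u_pilot k \<omega> powr (- q)\<bar> \<le> K))"
    if "d > 0" for d
  proof -
    from u_pilot_bounds_whp[OF that] obtain lo hi where lo: "lo > 0" and
      ev: "upto_prob M d (\<lambda>(k, \<omega>). lo \<le> u_pilot k \<omega> \<and> u_pilot k \<omega> \<le> hi)" by blast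
    have 1: "\<bar>1 / \<psi> k (u_pilot k \<omega>)\<bar> \<le> 2 * exp (hi powr q)" if "lo \<le> u_pilot k \<omega>" "u_pilot k \<omega> \<le> hi" for k \<omega>
    proof -
      define u where "u = u_pilot k \<omega>"
      have u: "u > 0" "u \<le> hi" using that lo by (auto simp: u_def)
      have f: "phi0 F0 (\<rho> k * u) > 1 / 2" using phi0_u_pilot[of k \<omega>] u by (simp add: u_def)
      have "exp (- (hi powr q)) * (1 / 2) \<le> exp (- (\<bar>u\<bar> powr q)) * phi0 F0 (\<rho> k * u)"
        using u f q by (intro mult_mono) (auto intro!: powr_mono2)
      then have "exp (- (hi powr q)) * (1 / 2) \<le> \<psi> k u" by (simp add: \<psi>_def)
      moreover have "exp (- (hi powr q)) * (1 / 2) > 0" by simp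
      ultimately have "\<psi> k u > 0" "1 / \<psi> k u \<le> 1 / (exp (- (hi powr q)) * (1 / 2))"
        by (linarith, intro divide_left_mono mult_pos_pos) linarith+
      then show ?thesis by (simp add: u_def exp_minus inverse_eq_divide)
    qed
    have "upto_prob M d (\<lambda>z. \<bar>case z of (k, \<omega>) \<Rightarrow> 1 / \<psi> k (u_pilot k \<omega>)\<bar> \<le> 2 * exp (hi powr q))"
      using ev by (rule upto_prob_mono) (use 1 in force)
    moreover have "upto_prob M d (\<lambda>z. \<bar>case z of (k, \<omega>) \<Rightarrow> u_pilot k \<omega> powr (- q)\<bar> \<le> lo powr (- q))"
      using ev by (rule upto_prob_mono) (use lo q in \<open>auto intro!: powr_mono2'\<close>)
    moreover have "2 * exp (hi powr q) > 0" "lo powr (- q) > 0" using lo by auto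
    ultimately show ?thesis by blast
  qed
  then show ?A ?B unfolding tight_whp_def by simp_all
qed

end

subsection \<open>The estimator at the estimated optimal frequency\<close>

text \<open>From the decomposition A Y - a V = A (Y - V) + (A - a) V. It is applied with V the
  process at the fixed frequency and Y at the random one.\<close>

lemma tight_whp_diff_tendsto_0:
  fixes A Y V :: "nat \<times> 'a \<Rightarrow> real"
  assumes A: "(A \<longlongrightarrow> a) (whp M)" and V: "tight_whp M V" and Y: "((\<lambda>z. Y z - V z) \<longlongrightarrow> 0) (whp M)"
  shows "((\<lambda>z. A z * Y z - a * V z) \<longlongrightarrow> 0) (whp M)"
proof -
  have "((\<lambda>z. A z * (Y z - V z) + (A z - a) * V z) \<longlongrightarrow> a * 0 + 0) (whp M)"
  proof (intro tendsto_add tendsto_mult A Y tendsto_mult_tight_whp V)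
    show "((\<lambda>z. A z - a) \<longlongrightarrow> 0) (whp M)" using A by (simp add: LIM_zero)
  qed
  then show ?thesis by (simp add: algebra_simps)
qed

text \<open>The difference quotient of ln|1 + w| at 0, extended by its limit. It makes the
  linearisation of the logarithm an exact product, also where the process vanishes.\<close>

definition log_quot :: "real \<Rightarrow> real" where
  "log_quot w = (if w = 0 then 1 else ln \<bar>1 + w\<bar> / w)"

lemma log_quot_mult: "w * log_quot w = ln \<bar>1 + w\<bar>"
  by (simp add: log_quot_def)

lemma isCont_log_quot_0: "isCont log_quot 0"
proof -
  have "((\<lambda>w::real. ln \<bar>1 + w\<bar> / w) \<longlongrightarrow> 1) (at 0)" by real_asymp
  then have "(log_quot \<longlongrightarrow> 1) (at 0)"
    by (rule Lim_transform_eventually) (auto simp: log_quot_def eventually_at intro!: exI[of _ 1])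
  then show ?thesis by (simp add: isCont_def log_quot_def)
qed

lemma Re_Psi_hat_divide:
  "Re (Psi_hat n Y t / complex_of_real a) = (\<Sum>i<n. cos (t * Y i)) / n / a"
  by (simp add: Psi_hat_def Re_divide_of_nat Re_divide_of_real)

lemma borel_measurable_nu_hat:
  assumes F0: "real_distribution F0"
    and Y: "\<And>i. i < n \<Longrightarrow> (\<lambda>\<omega>. Y \<omega> i) \<in> borel_measurable M" and t [measurable]: "t \<in> borel_measurable M"
  shows "(\<lambda>\<omega>. nu_hat q F0 \<sigma> \<gamma> n (Y \<omega>) (t \<omega>)) \<in> borel_measurable M"
proof -
  interpret F: real_distribution F0 by (rule F0)
  have [measurable]: "(\<lambda>\<omega>. \<Sum>i<n. cos (t \<omega> * Y \<omega> i)) \<in> borel_measurable M"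
  proof (rule borel_measurable_sum)
    fix i assume "i \<in> {..<n}"
    then have [measurable]: "(\<lambda>\<omega>. Y \<omega> i) \<in> borel_measurable M" using Y by simp
    show "(\<lambda>\<omega>. cos (t \<omega> * Y \<omega> i)) \<in> borel_measurable M" by measurable
  qed
  show ?thesis unfolding nu_hat_def Re_Psi_hat_divide Log_plus_def by measurable
qed

lemma borel_measurable_v_fun:
  assumes F0: "real_distribution F0"
    and [measurable]: "a \<in> borel_measurable M" "b \<in> borel_measurable M"
  shows "(\<lambda>\<omega>. v_fun q F0 (a \<omega>) (b \<omega>)) \<in> borel_measurable M"
proof -
  interpret F: real_distribution F0 by (rule F0)
  show ?thesis unfolding v_fun_def by measurable
qed

context
  fixes n :: nat and Y :: "'a \<Rightarrow> nat \<Rightarrow> real" and M :: "'a measure" and F0 and cstar :: "real \<Rightarrow> real"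
  assumes F0: "real_distribution F0" and Y: "\<And>i. i < n \<Longrightarrow> (\<lambda>\<omega>. Y \<omega> i) \<in> borel_measurable M"
    and cstar [measurable]: "cstar \<in> borel_measurable borel"
begin

lemma borel_measurable_nu_pilot [measurable]:
  "(\<lambda>\<omega>. nu_hat q F0 \<sigma> \<gamma> n (Y \<omega>) (t_pilot F0 \<eta>0 \<sigma> n (Y \<omega>))) \<in> borel_measurable M"
proof (rule borel_measurable_nu_hat[OF F0 Y])
  have [measurable]: "(\<lambda>\<omega>. median n (\<lambda>i. \<bar>Y \<omega> i\<bar>)) \<in> borel_measurable M"
    using Y by (intro borel_measurable_median borel_measurable_abs)
  show "(\<lambda>\<omega>. t_pilot F0 \<eta>0 \<sigma> n (Y \<omega>)) \<in> borel_measurable M"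
    unfolding t_pilot_def by measurable
qed

lemma borel_measurable_rho_hat [measurable]:
  "(\<lambda>\<omega>. rho_hat q F0 \<eta>0 \<sigma> \<gamma> n (Y \<omega>)) \<in> borel_measurable M"
  unfolding rho_hat_def by measurable

lemma borel_measurable_nu_opt:
  "(\<lambda>\<omega>. nu_opt q F0 cstar \<eta>0 \<sigma> \<gamma> n (Y \<omega>)) \<in> borel_measurable M"
  unfolding nu_opt_def
  by (rule borel_measurable_nu_hat[OF F0 Y]) (simp_all add: t_opt_def)

lemma borel_measurable_omega_hat:
  "(\<lambda>\<omega>. omega_hat q F0 cstar \<eta>0 \<sigma> \<gamma> n (Y \<omega>)) \<in> borel_measurable M"
  unfolding omega_hat_def by (rule borel_measurable_v_fun[OF F0]) simp_all

end

context stable_model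
begin

text \<open>With s = gamma ||x||_q this is the target ||x||_q^q.\<close>

definition X where "X k = (s k / \<gamma> k) powr q"

lemma X_pos: "X k > 0"
  using s[of k] \<gamma>[of k] by (simp add: X_def)

text \<open>The relative error of the real part of the empirical characteristic function with
  respect to \<psi>.\<close>

definition w where "w k u \<omega> = Gk k u \<omega> / (sqrt (n k) * \<psi> k u)"

text \<open>The factor exp(-u^q) inside the logarithm reproduces the target exactly, so the error is
  a single logarithm. The side conditions exclude the default branches of \<open>nu_hat\<close> and
  \<open>Log_plus\<close>.\<close>

lemma nu_hat_eq:
  assumes n: "n k > 0" and u: "u > 0" and f: "phi0 F0 (\<rho> k * u) \<noteq> 0" and w: "1 + w k u \<omega> \<noteq> 0"
  shows "nu_hat q F0 (\<rho> k * s k) (\<gamma> k) (n k) (y k \<omega>) (u / s k) =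
    X k * (1 - u powr (- q) * ln \<bar>1 + w k u \<omega>\<bar>)"
proof -
  note sg = s[of k] \<gamma>[of k]
  define t where "t = u / s k"
  have t: "t > 0" "\<rho> k * s k * t = \<rho> k * u" using u sg by (simp_all add: t_def)
  define f where "f = phi0 F0 (\<rho> k * u)"
  have f0: "f \<noteq> 0" using f by (simp add: f_def)
  have sq: "sqrt (n k) \<noteq> 0" "real (n k) = sqrt (n k) * sqrt (n k)" using n by auto
  have "t * y k \<omega> i = u * Z k i \<omega>" for i using sg by (simp add: t_def y_def)
  then have "Re (Psi_hat (n k) (y k \<omega>) t / complex_of_real f) = (\<Sum>i<n k. cos (u * Z k i \<omega>)) / n k / f"
    unfolding Re_Psi_hat_divide by simp
  also have "(\<Sum>i<n k. cos (u * Z k i \<omega>)) / n k = \<psi> k u + Gk k u \<omega> / sqrt (n k)"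
    using n by (simp add: cos_process_def sum_subtractf diff_divide_distrib)
  also have "\<dots> / f = exp (- (u powr q)) * (1 + w k u \<omega>)"
  proof -
    have "\<psi> k u = exp (- (u powr q)) * f" using u by (simp add: \<psi>_def f_def)
    then show ?thesis using f0 sq(1) by (simp add: w_def field_simps)
  qed
  finally have Re: "Re (Psi_hat (n k) (y k \<omega>) t / complex_of_real f) = exp (- (u powr q)) * (1 + w k u \<omega>)" .
  have "Log_plus (exp (- (u powr q)) * (1 + w k u \<omega>)) = - (u powr q) + ln \<bar>1 + w k u \<omega>\<bar>"
    using w by (simp add: Log_plus_def abs_mult ln_mult)
  moreover have "\<gamma> k powr q * \<bar>t\<bar> powr q = u powr q / X k"
    using sg u by (simp add: t_def X_def powr_divide)
  ultimately have "nu_hat q F0 (\<rho> k * s k) (\<gamma> k) (n k) (y k \<omega>) t =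
      - 1 / (u powr q / X k) * (- (u powr q) + ln \<bar>1 + w k u \<omega>\<bar>)"
    using t(1) f0 unfolding nu_hat_def t(2) f_def[symmetric] Re by simp
  also have "\<dots> = X k * (1 - u powr (- q) * ln \<bar>1 + w k u \<omega>\<bar>)"
    using u X_pos[of k] by (simp add: powr_minus_divide field_simps)
  finally show ?thesis unfolding t_def .
qed

definition nu_pilot where
  "nu_pilot k \<omega> = nu_hat q F0 (\<rho> k * s k) (\<gamma> k) (n k) (y k \<omega>) (t_pilot F0 \<eta>0 (\<rho> k * s k) (n k) (y k \<omega>))"

abbreviation "pilot_ratio z \<equiv> nu_pilot (fst z) (snd z) / X (fst z)"

lemma eventually_one_plus_nonzero:
  assumes "((\<lambda>z. W z) \<longlongrightarrow> (0::real)) (whp M)"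
  shows "eventually (\<lambda>z. 1 + W z \<noteq> 0) (whp M)"
proof -
  have "((\<lambda>z. 1 + W z) \<longlongrightarrow> 1 + 0) (whp M)" by (intro tendsto_intros assms)
  from tendsto_imp_eventually_ne[OF this] show ?thesis by simp
qed

lemma ln_abs_one_plus_tendsto_0:
  assumes "(W \<longlongrightarrow> (0::real)) (whp M)"
  shows "((\<lambda>z. ln \<bar>1 + W z\<bar>) \<longlongrightarrow> 0) (whp M)"
proof -
  have "((\<lambda>z. ln \<bar>1 + W z\<bar>) \<longlongrightarrow> ln \<bar>1 + 0\<bar>) (whp M)"
    by (intro tendsto_intros assms) auto
  then show ?thesis by simp
qed

text \<open>\<open>w\<close> at the pilot frequency is the vanishing process of
  \<open>G_u_pilot\<close> times the tight factor 1/\<psi>; the remaining factor u^(-q) is tight as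
  well.\<close>

lemma nu_pilot_consistent: "((\<lambda>z. pilot_ratio z) \<longlongrightarrow> 1) (whp M)"
proof -
  define u where "u z = u_pilot (fst z) (snd z)" for z
  define W where "W z = w (fst z) (u z) (snd z)" for z
  have "((\<lambda>z. Gk (fst z) (u z) (snd z) / sqrt (n (fst z)) * (1 / \<psi> (fst z) (u z))) \<longlongrightarrow> 0) (whp M)"
    using tendsto_mult_tight_whp[OF G_u_pilot u_pilot_tight(1)] by (simp add: case_prod_beta' u_def)
  then have W: "(W \<longlongrightarrow> 0) (whp M)" by (simp add: W_def[abs_def] w_def)
  have "((\<lambda>z. ln \<bar>1 + W z\<bar> * u z powr (- q)) \<longlongrightarrow> 0) (whp M)"
    using tendsto_mult_tight_whp[OF ln_abs_one_plus_tendsto_0[OF W] u_pilot_tight(2)] by (simp add: case_prod_beta' u_def)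
  from tendsto_diff[OF tendsto_const this]
  have "((\<lambda>z. 1 - u z powr (- q) * ln \<bar>1 + W z\<bar>) \<longlongrightarrow> 1) (whp M)" by (simp add: mult.commute)
  moreover have "\<forall>\<^sub>F z in whp M. 1 - u z powr (- q) * ln \<bar>1 + W z\<bar> = pilot_ratio z"
    using eventually_one_plus_nonzero[OF W] eventually_whp_sequentially[OF eventually_n_pos] u_pilot_pos_whp
  proof eventually_elim
    case (elim z)
    have u: "u z > 0" using elim(3) by (simp add: u_def case_prod_beta')
    have f: "phi0 F0 (\<rho> (fst z) * u z) \<noteq> 0"
      using phi0_u_pilot[of "fst z" "snd z"] u unfolding u_def by linarith
    have "t_pilot F0 \<eta>0 (\<rho> (fst z) * s (fst z)) (n (fst z)) (y (fst z) (snd z)) = u z / s (fst z)"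
      using s[of "fst z"] by (simp add: u_def u_pilot_def)
    then have "nu_pilot (fst z) (snd z) = X (fst z) * (1 - u z powr (- q) * ln \<bar>1 + W z\<bar>)"
      unfolding nu_pilot_def W_def using nu_hat_eq[OF elim(2) u f] elim(1) by (simp add: W_def)
    then show ?case using X_pos[of "fst z"] by simp
  qed
  ultimately show ?thesis by (rule Lim_transform_eventually)
qed

definition rhoh where "rhoh k \<omega> = rho_hat q F0 \<eta>0 (\<rho> k * s k) (\<gamma> k) (n k) (y k \<omega>)"

definition u_opt where
  "u_opt k \<omega> = s k * t_opt q F0 cstar \<eta>0 (\<rho> k * s k) (\<gamma> k) (n k) (y k \<omega>)"

text \<open>The estimated scale is the true scale s times a factor tending to 1; \<open>rhoh\<close>
  and \<open>u_opt\<close> inherit their limits from this.\<close>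

lemma scale_nu_pilot:
  assumes "nu_pilot k \<omega> / X k > 0"
  shows "\<gamma> k * nu_pilot k \<omega> powr (1 / q) = s k * (nu_pilot k \<omega> / X k) powr (1 / q)"
proof -
  define N where "N = nu_pilot k \<omega> / X k"
  have N: "N > 0" "nu_pilot k \<omega> = X k * N" using X_pos[of k] assms by (simp_all add: N_def)
  then have "nu_pilot k \<omega> powr (1 / q) = X k powr (1 / q) * N powr (1 / q)"
    unfolding N(2) using X_pos[of k] N(1) by (simp add: powr_mult)
  also have "X k powr (1 / q) = s k / \<gamma> k"
    using q s[of k] \<gamma>[of k] by (simp add: X_def powr_powr)
  finally show ?thesis using \<gamma>[of k] by (simp add: N_def)
qed

text \<open>Needed for every sample, since \<open>cstar\<close> is known to be continuous at
  \<open>\<rho>bar\<close> only within the half-line \<open>{0..}\<close>.\<close>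

lemma rhoh_nonneg: "rhoh k \<omega> \<ge> 0"
  unfolding rhoh_def rho_hat_def using s[of k] \<gamma>[of k] \<rho>(1)[of k]
  by (intro divide_nonneg_nonneg mult_nonneg_nonneg) auto

lemma nu_pilot_powr_tendsto: "((\<lambda>z. (pilot_ratio z) powr (1 / q)) \<longlongrightarrow> 1) (whp M)"
proof -
  have "((\<lambda>z. (pilot_ratio z) powr (1 / q)) \<longlongrightarrow> 1 powr (1 / q)) (whp M)"
    by (intro tendsto_intros nu_pilot_consistent) auto
  then show ?thesis by simp
qed

lemma nu_pilot_pos_whp: "\<forall>\<^sub>F z in whp M. pilot_ratio z > 0"
  using nu_pilot_consistent by (rule order_tendstoD) simp

lemma rhoh_tendsto: "((\<lambda>z. rhoh (fst z) (snd z)) \<longlongrightarrow> \<rho>bar) (whp M)"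
proof -
  have "((\<lambda>z. \<rho> (fst z) / (pilot_ratio z) powr (1 / q)) \<longlongrightarrow> \<rho>bar / 1) (whp M)"
    by (intro tendsto_divide nu_pilot_powr_tendsto tendsto_fst_whp \<rho>(2)) simp
  moreover have "\<forall>\<^sub>F z in whp M. \<rho> (fst z) / (pilot_ratio z) powr (1 / q) = rhoh (fst z) (snd z)"
    using nu_pilot_pos_whp
  proof eventually_elim
    case (elim z)
    show ?case
      using scale_nu_pilot[OF elim] s[of "fst z"]
      unfolding rhoh_def rho_hat_def nu_pilot_def[symmetric] by simp
  qed
  ultimately show ?thesis by (simp add: Lim_transform_eventually)
qed

lemma cstar_rhoh_tendsto: "((\<lambda>z. cstar (rhoh (fst z) (snd z))) \<longlongrightarrow> cstar \<rho>bar) (whp M)"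
  using rhoh_nonneg by (intro continuous_within_tendsto_compose'[OF cstar_continuous _ rhoh_tendsto]) auto

abbreviation "freq z \<equiv> u_opt (fst z) (snd z)"

lemma u_opt_tendsto: "((\<lambda>z. freq z) \<longlongrightarrow> cstar \<rho>bar) (whp M)"
proof -
  have "((\<lambda>z. cstar (rhoh (fst z) (snd z)) / (pilot_ratio z) powr (1 / q)) \<longlongrightarrow> cstar \<rho>bar / 1) (whp M)"
    by (intro tendsto_divide nu_pilot_powr_tendsto cstar_rhoh_tendsto) simp
  moreover have "\<forall>\<^sub>F z in whp M. cstar (rhoh (fst z) (snd z)) / (pilot_ratio z) powr (1 / q) = freq z"
    using nu_pilot_pos_whp
  proof eventually_elim
    case (elim z)
    show ?case
      using scale_nu_pilot[OF elim] s[of "fst z"]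
      unfolding u_opt_def t_opt_def rhoh_def nu_pilot_def[symmetric] by simp
  qed
  ultimately show ?thesis by (simp add: Lim_transform_eventually)
qed

definition \<nu> where "\<nu> k \<omega> = nu_opt q F0 cstar \<eta>0 (\<rho> k * s k) (\<gamma> k) (n k) (y k \<omega>)"

abbreviation "ratio z \<equiv> \<nu> (fst z) (snd z) / X (fst z)"

definition \<Omega> where "\<Omega> k \<omega> = omega_hat q F0 cstar \<eta>0 (\<rho> k * s k) (\<gamma> k) (n k) (y k \<omega>)"

abbreviation "c \<equiv> cstar \<rho>bar"

definition \<psi>_lim where "\<psi>_lim u = exp (- (\<bar>u\<bar> powr q)) * phi0 F0 (\<rho>bar * u)"

definition \<omega>_lim where "\<omega>_lim = v_fun q F0 c \<rho>bar"

lemma \<omega>_lim_pos: "\<omega>_lim > 0"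
  unfolding \<omega>_lim_def using v_fun_pos[OF F0 cstar_rbar(1,3) q(2)] .

lemma \<psi>_lim_c_nonzero: "\<psi>_lim c \<noteq> 0"
  using cstar_rbar by (simp add: \<psi>_lim_def)

lemma \<Omega>_tendsto: "((\<lambda>z. \<Omega> (fst z) (snd z)) \<longlongrightarrow> \<omega>_lim) (whp M)"
  unfolding \<Omega>_def omega_hat_def \<omega>_lim_def rhoh_def[symmetric]
  by (intro v_fun_tendsto F0 cstar_rbar cstar_rhoh_tendsto rhoh_tendsto)

lemma \<psi>_tendsto:
  assumes "(U \<longlongrightarrow> u) F" "((\<lambda>z. \<rho> (j z)) \<longlongrightarrow> \<rho>bar) F"
  shows "((\<lambda>z. \<psi> (j z) (U z)) \<longlongrightarrow> \<psi>_lim u) F"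
proof -
  interpret F: real_distribution F0 by (rule F0)
  show ?thesis unfolding \<psi>_def \<psi>_lim_def
    using q by (intro tendsto_intros isCont_tendsto_compose[OF F.isCont_phi0] assms) auto
qed

lemma \<psi>_u_opt_tendsto: "((\<lambda>z. \<psi> (fst z) (freq z)) \<longlongrightarrow> \<psi>_lim c) (whp M)"
  by (intro \<psi>_tendsto u_opt_tendsto tendsto_fst_whp \<rho>(2))

lemma G_diff_tendsto:
  "((\<lambda>z. Gk (fst z) (freq z) (snd z) - Gk (fst z) c (snd z)) \<longlongrightarrow> 0) (whp M)"
  using G_equicontinuous[OF u_opt_tendsto] by (simp add: case_prod_beta')

lemma G_c_tight: "tight_whp M (\<lambda>z. Gk (fst z) c (snd z))"
  using G_tight[of c] by (simp add: case_prod_beta')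

lemma w_u_opt_tendsto: "((\<lambda>z. w (fst z) (freq z) (snd z)) \<longlongrightarrow> 0) (whp M)"
proof -
  define A where "A z = 1 / sqrt (n (fst z)) / \<psi> (fst z) (freq z)" for z
  have "((\<lambda>z. 1 / sqrt (n (fst z)) / \<psi> (fst z) (freq z)) \<longlongrightarrow> 0 / \<psi>_lim c) (whp M)"
    using \<psi>_lim_c_nonzero
    by (intro tendsto_divide \<psi>_u_opt_tendsto tendsto_fst_whp[of "\<lambda>k. 1 / sqrt (n k)"] inverse_sqrt_tendsto_0 n_infty)
  then have A: "(A \<longlongrightarrow> 0) (whp M)" by (simp add: A_def[abs_def])
  from tight_whp_diff_tendsto_0[OF A G_c_tight G_diff_tendsto]
  show ?thesis by (simp add: A_def w_def)
qed

lemma nu_ratio_eq_whp: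
  "\<forall>\<^sub>F z in whp M. ratio z =
     1 - freq z powr (- q) * ln \<bar>1 + w (fst z) (freq z) (snd z)\<bar>"
proof -
  interpret F: real_distribution F0 by (rule F0)
  have "\<forall>\<^sub>F z in whp M. freq z > 0"
    using u_opt_tendsto cstar_rbar(1) by (rule order_tendstoD)
  moreover have "((\<lambda>z. phi0 F0 (\<rho> (fst z) * freq z)) \<longlongrightarrow> phi0 F0 (\<rho>bar * c)) (whp M)"
    by (intro isCont_tendsto_compose[OF F.isCont_phi0] tendsto_mult u_opt_tendsto tendsto_fst_whp \<rho>(2))
  from tendsto_imp_eventually_ne[OF this cstar_rbar(3)]
  have "\<forall>\<^sub>F z in whp M. phi0 F0 (\<rho> (fst z) * freq z) \<noteq> 0" .
  ultimately show ?thesis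
    using eventually_one_plus_nonzero[OF w_u_opt_tendsto] eventually_whp_sequentially[OF eventually_n_pos]
  proof eventually_elim
    case (elim z)
    have "t_opt q F0 cstar \<eta>0 (\<rho> (fst z) * s (fst z)) (\<gamma> (fst z)) (n (fst z)) (y (fst z) (snd z)) =
        freq z / s (fst z)"
      using s[of "fst z"] by (simp add: u_opt_def)
    then have "\<nu> (fst z) (snd z) = X (fst z) *
       (1 - freq z powr (- q) * ln \<bar>1 + w (fst z) (freq z) (snd z)\<bar>)"
      unfolding \<nu>_def nu_opt_def using nu_hat_eq[OF elim(4,1,2,3)] by simp
    then show ?case using X_pos[of "fst z"] by simp
  qed
qed

lemma nu_ratio_tendsto: "((\<lambda>z. ratio z) \<longlongrightarrow> 1) (whp M)"
proof -
  have "((\<lambda>z. 1 - freq z powr (- q) * ln \<bar>1 + w (fst z) (freq z) (snd z)\<bar>)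
      \<longlongrightarrow> 1 - c powr (- q) * 0) (whp M)"
    using cstar_rbar(1) by (intro tendsto_intros u_opt_tendsto ln_abs_one_plus_tendsto_0 w_u_opt_tendsto) auto
  then have "((\<lambda>z. 1 - freq z powr (- q) * ln \<bar>1 + w (fst z) (freq z) (snd z)\<bar>)
      \<longlongrightarrow> 1) (whp M)" by simp
  then show ?thesis
    by (rule Lim_transform_eventually) (use nu_ratio_eq_whp in \<open>eventually_elim, simp\<close>)
qed

text \<open>The limiting coefficient of the process in the expansion of \<open>T\<close>: -c^(-q) /
  \<psi>(c) from the logarithm, divided by the studentising factor.\<close>

definition a_lim where "a_lim = - (c powr (- q)) / (sqrt \<omega>_lim * \<psi>_lim c)"

definition T where "T k \<omega> = sqrt (n k) / sqrt (\<Omega> k \<omega>) * (\<nu> k \<omega> / X k - 1)"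

text \<open>With high probability \<open>T\<close> equals a random coefficient A times the process
  at the data-driven frequency, without remainder. A tends to \<open>a_lim\<close>, and
  equicontinuity moves the process to c.\<close>

lemma T_approx: "((\<lambda>z. T (fst z) (snd z) - a_lim * Gk (fst z) c (snd z)) \<longlongrightarrow> 0) (whp M)"
proof -
  define u where "u z = freq z" for z
  define W where "W z = w (fst z) (u z) (snd z)" for z
  have u: "(u \<longlongrightarrow> c) (whp M)" using u_opt_tendsto by (simp add: u_def[abs_def])
  have W: "(W \<longlongrightarrow> 0) (whp M)" using w_u_opt_tendsto by (simp add: W_def[abs_def] u_def)
  define A where "A z = - (u z powr (- q)) * log_quot (W z) / (sqrt (\<Omega> (fst z) (snd z)) * \<psi> (fst z) (u z))" for z
  have "(A \<longlongrightarrow> - (c powr (- q)) * log_quot 0 / (sqrt \<omega>_lim * \<psi>_lim c)) (whp M)"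
    unfolding A_def using cstar_rbar(1) \<omega>_lim_pos \<psi>_lim_c_nonzero
    by (intro tendsto_intros u isCont_tendsto_compose[OF isCont_log_quot_0 W] \<Omega>_tendsto
        \<psi>_u_opt_tendsto[folded u_def]) auto
  then have A: "(A \<longlongrightarrow> a_lim) (whp M)" by (simp add: a_lim_def log_quot_def)
  have "((\<lambda>z. A z * Gk (fst z) (u z) (snd z) - a_lim * Gk (fst z) c (snd z)) \<longlongrightarrow> 0) (whp M)"
    by (rule tight_whp_diff_tendsto_0[OF A G_c_tight G_diff_tendsto[folded u_def]])
  moreover have "\<forall>\<^sub>F z in whp M. A z * Gk (fst z) (u z) (snd z) = T (fst z) (snd z)"
    using nu_ratio_eq_whp eventually_whp_sequentially[OF eventually_n_pos]
  proof eventually_elim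
    case (elim z)
    have "ln \<bar>1 + W z\<bar> = Gk (fst z) (u z) (snd z) / (sqrt (n (fst z)) * \<psi> (fst z) (u z)) * log_quot (W z)"
      using log_quot_mult[of "W z"] by (simp add: W_def w_def)
    then have "ratio z - 1 =
        - (u z powr (- q)) * (Gk (fst z) (u z) (snd z) / (sqrt (n (fst z)) * \<psi> (fst z) (u z)) * log_quot (W z))"
      using elim(1) by (simp add: u_def W_def)
    then show ?case using elim(2) unfolding T_def A_def by (simp add: mult_ac)
  qed
  then have "\<forall>\<^sub>F z in whp M. A z * Gk (fst z) (u z) (snd z) - a_lim * Gk (fst z) c (snd z) =
      T (fst z) (snd z) - a_lim * Gk (fst z) c (snd z)"
    by eventually_elim simp
  ultimately show ?thesis by (rule Lim_transform_eventually)
qed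

text \<open>This identity reveals the origin of \<open>v_fun\<close>: it is c^(-2q) times the
  variance of cos(c Z), divided by \<psi>(c)^2.\<close>

lemma a_lim_variance: "a_lim\<^sup>2 * ((1 + \<psi>_lim (2 * c)) / 2 - (\<psi>_lim c)\<^sup>2) = 1"
proof -
  define x where "x = c powr q"
  define f where "f = phi0 F0 (\<rho>bar * c)"
  define f2 where "f2 = phi0 F0 (2 * \<rho>bar * c)"
  define b where "b = 2 powr q"
  have c: "c > 0" and f: "f \<noteq> 0" using cstar_rbar by (auto simp: f_def)
  have p: "\<psi>_lim c = exp (- x) * f" using c by (simp add: \<psi>_lim_def x_def f_def)
  have p2: "\<psi>_lim (2 * c) = exp (- (b * x)) * f2"
    using c by (simp add: \<psi>_lim_def x_def f2_def b_def powr_mult mult_ac)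
  have om: "\<omega>_lim = (c powr (- q))\<^sup>2 * (1/2 * exp (2 * x) / f\<^sup>2 + 1/2 * f2 * exp ((2 - b) * x) / f\<^sup>2 - 1)"
    using c by (simp add: \<omega>_lim_def v_fun_def x_def f_def f2_def b_def powr_power mult.commute)
  have e2: "exp (2 * x) * (exp (- x))\<^sup>2 = 1"
    by (simp add: power2_eq_square flip: exp_add)
  have eb: "exp ((2 - b) * x) * (exp (- x))\<^sup>2 = exp (- (b * x))"
    by (simp add: power2_eq_square algebra_simps flip: exp_add)
  have "(1/2 * exp (2 * x) / f\<^sup>2 + 1/2 * f2 * exp ((2 - b) * x) / f\<^sup>2 - 1) * (\<psi>_lim c)\<^sup>2 =
     1/2 * (exp (2 * x) * (exp (- x))\<^sup>2) + 1/2 * f2 * (exp ((2 - b) * x) * (exp (- x))\<^sup>2) - (exp (- x) * f)\<^sup>2"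
    using f unfolding p power_mult_distrib by (simp add: field_simps)
  also have "\<dots> = (1 + \<psi>_lim (2 * c)) / 2 - (\<psi>_lim c)\<^sup>2"
    unfolding e2 eb p p2 by simp
  finally have "\<omega>_lim * (\<psi>_lim c)\<^sup>2 = (c powr (- q))\<^sup>2 * ((1 + \<psi>_lim (2 * c)) / 2 - (\<psi>_lim c)\<^sup>2)"
    unfolding om by (simp only: mult.assoc)
  moreover have "a_lim\<^sup>2 = (c powr (- q))\<^sup>2 / (\<omega>_lim * (\<psi>_lim c)\<^sup>2)"
    using \<omega>_lim_pos by (simp add: a_lim_def power_divide power_mult_distrib)
  moreover have "\<omega>_lim * (\<psi>_lim c)\<^sup>2 \<noteq> 0" using \<omega>_lim_pos \<psi>_lim_c_nonzero by simp
  ultimately show ?thesis by (metis divide_self times_divide_eq_left)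
qed

lemma G_c_clt: "weak_conv_m (\<lambda>k. distr (M k) borel (\<lambda>\<omega>. a_lim * Gk k c \<omega>)) std_normal_distribution"
  using \<psi>_tendsto[OF tendsto_const \<rho>(2), of c] \<psi>_tendsto[OF tendsto_const \<rho>(2), of "2 * c"] a_lim_variance
  by (rule G_clt)

text \<open>Dividing by the ratio replaces the unknown target in the denominator by its estimate,
  which gives the pivot inverted by the confidence interval.\<close>

lemma T_ratio_approx:
  "((\<lambda>z. T (fst z) (snd z) / (ratio z) - a_lim * Gk (fst z) c (snd z)) \<longlongrightarrow> 0) (whp M)"
proof -
  have "((\<lambda>z. 1 / (ratio z)) \<longlongrightarrow> 1 / 1) (whp M)"
    by (intro tendsto_divide tendsto_const nu_ratio_tendsto) simp
  then have r: "((\<lambda>z. 1 / (ratio z)) \<longlongrightarrow> 1) (whp M)" by simp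
  from tight_whp_diff_tendsto_0[OF r tight_whp_cmult[OF G_c_tight] T_approx] show ?thesis by (simp add: mult.commute)
qed

end

subsection \<open>Confidence intervals\<close>

interpretation std_normal: real_distribution std_normal_distribution
  by (rule real_dist_normal_dist)

lemma measure_std_normal_singleton: "measure std_normal_distribution {x} = 0"
proof -
  have "(\<integral>\<^sup>+ y. ennreal (std_normal_density y) * indicator {x} y \<partial>lborel) = (\<integral>\<^sup>+ y. 0 \<partial>(lborel :: real measure))"
    by (rule nn_integral_cong_AE) (use AE_lborel_singleton[of x] in \<open>eventually_elim, simp\<close>)
  then have "emeasure std_normal_distribution {x} = 0"
    by (subst emeasure_density) auto
  then show ?thesis by (simp add: measure_def)
qed

lemma isCont_cdf_std_normal: "isCont (cdf std_normal_distribution) x"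
  using std_normal.finite_borel_measure_M measure_std_normal_singleton
  by (simp add: finite_borel_measure.isCont_cdf)

text \<open>A positive density charges every interval. Strictness is what makes the definite
  description in \<open>z_quant\<close> meaningful.\<close>

lemma cdf_std_normal_strict_mono:
  assumes "a < b"
  shows "cdf std_normal_distribution a < cdf std_normal_distribution b"
proof (rule ccontr)
  assume "\<not> ?thesis"
  then have "measure std_normal_distribution {a<..b} = 0"
    using finite_borel_measure.cdf_diff_eq[OF std_normal.finite_borel_measure_M assms]
      measure_nonneg[of std_normal_distribution "{a<..b}"] by linarith
  then have "emeasure std_normal_distribution {a<..b} = 0"
    by (simp add: std_normal.emeasure_eq_measure)
  then have "AE y in lborel. ennreal (std_normal_density y) * indicator {a<..b} y = 0"
    by (subst (asm) emeasure_density) (auto simp: nn_integral_0_iff_AE)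
  then have "AE y in lborel. y \<notin> {a<..b}"
    by (rule AE_mp) (use normal_density_pos[of 1 0] in \<open>auto simp: indicator_def ennreal_eq_0_iff less_le_not_le split: if_splits\<close>)
  then have "emeasure lborel {a<..b} = 0"
    by (subst (asm) AE_iff_measurable[of "{a<..b}"]) auto
  then show False using assms by simp
qed

lemma cdf_z_quant:
  assumes "0 < \<alpha>" "\<alpha> < 1"
  shows "cdf std_normal_distribution (z_quant \<alpha>) = 1 - \<alpha>"
proof -
  let ?F = "cdf std_normal_distribution"
  have "eventually (\<lambda>x. ?F x < 1 - \<alpha>) at_bot"
    using finite_borel_measure.cdf_lim_at_bot[OF std_normal.finite_borel_measure_M] assms by (intro order_tendstoD(2)) auto
  then obtain l where l: "\<And>x. x \<le> l \<Longrightarrow> ?F x < 1 - \<alpha>" unfolding eventually_at_bot_linorder by blast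
  have "eventually (\<lambda>x. ?F x > 1 - \<alpha>) at_top"
    using std_normal.cdf_lim_at_top_prob assms by (intro order_tendstoD(1)) auto
  then obtain h where h: "\<And>x. x \<ge> h \<Longrightarrow> ?F x > 1 - \<alpha>" unfolding eventually_at_top_linorder by blast
  \<comment> \<open>The minimum guarantees that the left end does not exceed h, as the intermediate
    value theorem requires.\<close>
  have "\<exists>z. min l h \<le> z \<and> z \<le> h \<and> ?F z = 1 - \<alpha>"
    using l[of "min l h"] h[of h] isCont_cdf_std_normal by (intro IVT) auto
  then obtain z where z: "?F z = 1 - \<alpha>" by blast
  have "x = z" if "?F x = 1 - \<alpha>" for x
    using cdf_std_normal_strict_mono[of x z] cdf_std_normal_strict_mono[of z x] z that
    by (cases x z rule: linorder_cases) auto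
  then show ?thesis unfolding z_quant_def using z by (intro theI[of "\<lambda>z. ?F z = 1 - \<alpha>" z])
qed

lemma std_normal_uminus: "distr std_normal_distribution borel uminus = std_normal_distribution"
proof (rule Levy_uniqueness)
  show "real_distribution (distr std_normal_distribution borel uminus)"
    by (rule std_normal.real_distribution_distr) simp
  show "real_distribution std_normal_distribution" by (rule real_dist_normal_dist)
  show "char (distr std_normal_distribution borel uminus) = char std_normal_distribution"
  proof
    fix t
    have "char (distr std_normal_distribution borel uminus) t = char std_normal_distribution (- t)"
      unfolding char_def by (subst integral_distr) auto
    then show "char (distr std_normal_distribution borel uminus) t = char std_normal_distribution t"
      by (simp add: char_std_normal_distribution)
  qed
qed

lemma measure_std_normal_lessThan_uminus:
  "measure std_normal_distribution {..< - z} = measure std_normal_distribution {z<..}"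
proof -
  have "measure std_normal_distribution {..< - z} = measure (distr std_normal_distribution borel uminus) {..< - z}"
    by (simp only: std_normal_uminus)
  also have "\<dots> = measure std_normal_distribution (uminus -` {..< - z} \<inter> space std_normal_distribution)"
    by (rule measure_distr) auto
  also have "uminus -` {..< - z} \<inter> space std_normal_distribution = {z<..}" by auto
  finally show ?thesis .
qed

lemma measure_std_normal_greaterThan: "measure std_normal_distribution {z<..} = 1 - cdf std_normal_distribution z"
proof -
  have "{z<..} = space std_normal_distribution - {..z}" by auto
  then show ?thesis using std_normal.prob_compl[of "{..z}"] by (simp add: cdf_def)
qed

lemma z_quant_nonneg:
  assumes "0 < \<alpha>" "\<alpha> \<le> 1 / 2"
  shows "z_quant \<alpha> \<ge> 0"
proof (rule ccontr)
  assume "\<not> ?thesis"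
  then have "cdf std_normal_distribution (z_quant \<alpha>) < cdf std_normal_distribution 0"
    by (intro cdf_std_normal_strict_mono) simp
  moreover have "cdf std_normal_distribution 0 = 1 / 2"
  proof -
    have "cdf std_normal_distribution 0 = measure std_normal_distribution ({..<0} \<union> {0})"
      unfolding cdf_def by (rule arg_cong[where f="measure _"]) auto
    also have "\<dots> = measure std_normal_distribution {..<0} + measure std_normal_distribution {0}"
      by (rule std_normal.finite_measure_Union) auto
    finally show ?thesis
      using measure_std_normal_lessThan_uminus[of 0] measure_std_normal_greaterThan[of 0]
      by (simp add: measure_std_normal_singleton)
  qed
  ultimately show False using cdf_z_quant[of \<alpha>] assms by simp
qed

text \<open>The portmanteau theorem applies because the frontier of \<open>S\<close> has at most two
  points. Levels at most 1/2 make the quantiles nonnegative, so the two excluded tails are disjoint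
  and their masses add.\<close>

lemma weak_conv_confidence_interval:
  assumes \<mu>: "\<And>k. real_distribution (\<mu> k)" and conv: "weak_conv_m \<mu> std_normal_distribution"
    and \<alpha>: "0 \<le> \<alpha>" "\<alpha> \<le> 1 / 2" and \<alpha>': "0 \<le> \<alpha>'" "\<alpha>' \<le> 1 / 2"
  defines "S \<equiv> {x. (\<alpha> = 0 \<or> x \<le> z_quant \<alpha>) \<and> (\<alpha>' = 0 \<or> - z_quant \<alpha>' \<le> x)}"
  shows "(\<lambda>k. measure (\<mu> k) S) \<longlonglongrightarrow> 1 - \<alpha> - \<alpha>'" "S \<in> sets borel"
proof -
  define U1 where "U1 = (if \<alpha> = 0 then {} else {z_quant \<alpha><..})"
  define U2 where "U2 = (if \<alpha>' = 0 then {} else {..< - z_quant \<alpha>'})"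
  have S: "S = UNIV - (U1 \<union> U2)" by (auto simp: S_def U1_def U2_def)
  have meas: "U1 \<in> sets borel" "U2 \<in> sets borel" by (auto simp: U1_def U2_def)
  show Sm: "S \<in> sets borel" unfolding S using meas by auto
  have "measure std_normal_distribution U1 = \<alpha>"
    using \<alpha> cdf_z_quant[of \<alpha>] by (auto simp: U1_def measure_std_normal_greaterThan)
  moreover have "measure std_normal_distribution U2 = \<alpha>'"
    using \<alpha>' cdf_z_quant[of \<alpha>'] by (auto simp: U2_def measure_std_normal_lessThan_uminus measure_std_normal_greaterThan)
  moreover have "U1 \<inter> U2 = {}"
    using z_quant_nonneg[of \<alpha>] z_quant_nonneg[of \<alpha>'] \<alpha> \<alpha>'
    by (cases "\<alpha> = 0"; cases "\<alpha>' = 0") (auto simp: U1_def U2_def)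
  ultimately have "measure std_normal_distribution (U1 \<union> U2) = \<alpha> + \<alpha>'"
    using meas by (subst std_normal.finite_measure_Union) auto
  then have mS: "measure std_normal_distribution S = 1 - \<alpha> - \<alpha>'"
    unfolding S using std_normal.prob_compl[of "U1 \<union> U2"] meas by simp
  have "frontier S \<subseteq> {z_quant \<alpha>, - z_quant \<alpha>'}"
  proof -
    have f1: "frontier U1 \<subseteq> {z_quant \<alpha>}" "frontier U2 \<subseteq> {- z_quant \<alpha>'}"
      by (auto simp: U1_def U2_def frontier_def interior_open)
    have "frontier S = frontier (U1 \<union> U2)"
      unfolding S Compl_eq_Diff_UNIV[symmetric] by (rule frontier_complement)
    then show ?thesis using f1 frontier_Un_subset[of U1 U2] by blast
  qed
  moreover have "measure std_normal_distribution {z_quant \<alpha>, - z_quant \<alpha>'} = 0"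
    using measure_Un_le[of "{z_quant \<alpha>}" std_normal_distribution "{- z_quant \<alpha>'}"]
      measure_nonneg[of std_normal_distribution "{z_quant \<alpha>, - z_quant \<alpha>'}"]
    by (intro antisym) (simp_all add: measure_std_normal_singleton insert_commute)
  ultimately have "measure std_normal_distribution (frontier S) = 0"
    using std_normal.finite_measure_mono[of "frontier S" "{z_quant \<alpha>, - z_quant \<alpha>'}"]
      measure_nonneg[of std_normal_distribution "frontier S"] by simp
  then have "emeasure std_normal_distribution (frontier S) = 0"
    by (simp add: std_normal.emeasure_eq_measure)
  from weak_conv_imp_continuity_set_conv[OF \<mu> real_dist_normal_dist conv Sm this] mS
  show "(\<lambda>k. measure (\<mu> k) S) \<longlonglongrightarrow> 1 - \<alpha> - \<alpha>'" by simp
qed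

context stable_model
begin

lemma y_measurable: "i < n k \<Longrightarrow> (\<lambda>\<omega>. y k \<omega> i) \<in> borel_measurable (M k)"
  using Z_rv[of i k] unfolding y_def by simp

context
  assumes cstar_meas: "cstar \<in> borel_measurable borel"
begin

lemma \<nu>_measurable [measurable]: "\<nu> k \<in> borel_measurable (M k)"
  unfolding \<nu>_def by (rule borel_measurable_nu_opt[OF F0 y_measurable cstar_meas])

lemma \<Omega>_measurable [measurable]: "\<Omega> k \<in> borel_measurable (M k)"
  unfolding \<Omega>_def by (rule borel_measurable_omega_hat[OF F0 y_measurable cstar_meas])

lemma T_measurable [measurable]: "T k \<in> borel_measurable (M k)"
  unfolding T_def by measurable

lemma T_weak_conv: "weak_conv_m (\<lambda>k. distr (M k) borel (T k)) std_normal_distribution"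
  by (rule slutsky_whp[OF prob _ T_measurable _ real_dist_normal_dist G_c_clt])
     (use G_measurable T_approx in \<open>auto simp: case_prod_beta'\<close>)

lemma T_ratio_weak_conv:
  "weak_conv_m (\<lambda>k. distr (M k) borel (\<lambda>\<omega>. T k \<omega> / (\<nu> k \<omega> / X k))) std_normal_distribution"
  by (rule slutsky_whp[OF prob _ _ _ real_dist_normal_dist G_c_clt])
     (use G_measurable T_ratio_approx in \<open>auto simp: case_prod_beta'\<close>)

text \<open>Once \<Omega> and \<nu> are positive, solving the two inequalities for the target shows
  that coverage is the event that the pivot \<open>R\<close> lies in the fixed set \<open>S\<close>.
  Both positivity conditions hold with high probability.\<close>

lemma confidence_interval:
  assumes \<alpha>: "0 \<le> \<alpha>" "\<alpha> \<le> 1 / 2" and \<alpha>': "0 \<le> \<alpha>'" "\<alpha>' \<le> 1 / 2"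
  shows "(\<lambda>k. measure (M k) {\<omega> \<in> space (M k).
      (\<alpha> = 0 \<or> (1 - sqrt (\<Omega> k \<omega>) * z_quant \<alpha> / sqrt (n k)) * \<nu> k \<omega> \<le> X k) \<and>
      (\<alpha>' = 0 \<or> X k \<le> (1 + sqrt (\<Omega> k \<omega>) * z_quant \<alpha>' / sqrt (n k)) * \<nu> k \<omega>)})
    \<longlonglongrightarrow> 1 - \<alpha> - \<alpha>'"
proof -
  define R where "R k \<omega> = T k \<omega> / (\<nu> k \<omega> / X k)" for k \<omega>
  have [measurable]: "R k \<in> borel_measurable (M k)" for k unfolding R_def by measurable
  define S where "S = {x. (\<alpha> = 0 \<or> x \<le> z_quant \<alpha>) \<and> (\<alpha>' = 0 \<or> - z_quant \<alpha>' \<le> x)}"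
  note ci = weak_conv_confidence_interval[OF prob_space.real_distribution_distr[OF prob] T_ratio_weak_conv \<alpha> \<alpha>',
      folded S_def R_def]
  have Sm [measurable]: "S \<in> sets borel" by (rule ci(2)) simp
  have lim: "(\<lambda>k. measure (distr (M k) borel (R k)) S) \<longlonglongrightarrow> 1 - \<alpha> - \<alpha>'"
    by (rule ci(1)) simp
  have eq: "measure (distr (M k) borel (R k)) S = measure (M k) {\<omega> \<in> space (M k). R k \<omega> \<in> S}" for k
    by (subst measure_distr) (auto intro!: arg_cong[where f="measure _"])
  show ?thesis
  proof (rule measure_tendsto_cong_whp[OF prob _ _ _ lim[unfolded eq]])
    show "{\<omega> \<in> space (M k). R k \<omega> \<in> S} \<in> sets (M k)" for k by measurable
    show "{\<omega> \<in> space (M k).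
      (\<alpha> = 0 \<or> (1 - sqrt (\<Omega> k \<omega>) * z_quant \<alpha> / sqrt (n k)) * \<nu> k \<omega> \<le> X k) \<and>
      (\<alpha>' = 0 \<or> X k \<le> (1 + sqrt (\<Omega> k \<omega>) * z_quant \<alpha>' / sqrt (n k)) * \<nu> k \<omega>)} \<in> sets (M k)" for k
      by measurable
    have "\<forall>\<^sub>F z in whp M. \<Omega> (fst z) (snd z) > 0"
      using \<Omega>_tendsto \<omega>_lim_pos by (rule order_tendstoD)
    moreover have "\<forall>\<^sub>F z in whp M. ratio z > 0"
      using nu_ratio_tendsto by (rule order_tendstoD) simp
    ultimately have "\<forall>\<^sub>F z in whp M. R (fst z) (snd z) \<in> S \<longleftrightarrow>
        (\<alpha> = 0 \<or> (1 - sqrt (\<Omega> (fst z) (snd z)) * z_quant \<alpha> / sqrt (n (fst z))) * \<nu> (fst z) (snd z) \<le> X (fst z)) \<and>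
        (\<alpha>' = 0 \<or> X (fst z) \<le> (1 + sqrt (\<Omega> (fst z) (snd z)) * z_quant \<alpha>' / sqrt (n (fst z))) * \<nu> (fst z) (snd z))"
      using eventually_whp_sequentially[OF eventually_n_pos]
    proof eventually_elim
      case (elim z)
      define b where "b = sqrt (n (fst z)) / sqrt (\<Omega> (fst z) (snd z))"
      define N where "N = \<nu> (fst z) (snd z)"
      define x where "x = X (fst z)"
      have b: "b > 0" using elim by (simp add: b_def)
      have x: "x > 0" by (simp add: x_def X_pos)
      have N: "N > 0" using elim(2) x by (simp add: N_def x_def zero_less_divide_iff)
      have R: "R (fst z) (snd z) = b * (N - x) / N"
      proof -
        have "b * (N / x - 1) / (N / x) = b * (N - x) / N" using x N by (simp add: field_simps)
        then show ?thesis by (simp only: R_def T_def b_def N_def x_def)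
      qed
      have ib: "sqrt (\<Omega> (fst z) (snd z)) * q' / sqrt (n (fst z)) = q' / b" for q'
        by (simp add: b_def)
      have 1: "b * (N - x) / N \<le> q' \<longleftrightarrow> (1 - q' / b) * N \<le> x" for q'
        using b N by (simp add: field_simps)
      have 2: "- q' \<le> b * (N - x) / N \<longleftrightarrow> x \<le> (1 + q' / b) * N" for q'
        using b N by (simp add: field_simps)
      show ?case unfolding S_def R ib N_def[symmetric] x_def[symmetric] mem_Collect_eq 1 2 ..
    qed
    then show "\<forall>\<^sub>F (k, \<omega>) in whp M. \<omega> \<in> {\<omega> \<in> space (M k). R k \<omega> \<in> S} \<longleftrightarrow>
      \<omega> \<in> {\<omega> \<in> space (M k).
      (\<alpha> = 0 \<or> (1 - sqrt (\<Omega> k \<omega>) * z_quant \<alpha> / sqrt (n k)) * \<nu> k \<omega> \<le> X k) \<and>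
      (\<alpha>' = 0 \<or> X k \<le> (1 + sqrt (\<Omega> k \<omega>) * z_quant \<alpha>' / sqrt (n k)) * \<nu> k \<omega>)}"
      by eventually_elim (auto simp: case_prod_beta)
  qed
qed

end

end

section \<open>Reduction of the linear model to the normalised sample\<close>

context prob_space
begin

text \<open>Stability: the exponents of the coordinates add up to gamma^q ||x||_q^q |u|^q / s^q, and
  s is chosen so that this equals |u|^q. The noise factor only has its argument rescaled.\<close>

lemma linear_model:
  fixes A :: "nat \<Rightarrow> nat \<Rightarrow> 'a \<Rightarrow> real" and E :: "nat \<Rightarrow> 'a \<Rightarrow> real" and x :: "nat \<Rightarrow> real"
  assumes q: "0 < q"
    and x_nz: "\<exists>j < p. x j \<noteq> 0" and \<sigma>: "\<sigma> > 0" and \<gamma>: "\<gamma> > 0"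
    and A_stable: "\<And>i j. i < n \<Longrightarrow> j < p \<Longrightarrow> is_stable q \<gamma> (distr M borel (A i j))"
    and E_dist: "\<And>i. i < n \<Longrightarrow> distr M borel (E i) = F0"
    and indep: "indep_vars (\<lambda>_. borel)
        (\<lambda>u. case u of Inl (i, j) \<Rightarrow> A i j | Inr i \<Rightarrow> E i)
        ({Inl (i, j) | i j. i < n \<and> j < p} \<union> {Inr i | i. i < n})"
  defines "s \<equiv> \<gamma> * lq_norm q p x"
  defines "Z \<equiv> \<lambda>i \<omega>. ((\<Sum>j<p. A i j \<omega> * x j) + \<sigma> * E i \<omega>) / s"
  shows "lq_pow q p x > 0" "s > 0" "indep_vars (\<lambda>_. borel) Z {..<n}"
    "\<And>i u. i < n \<Longrightarrow> expectation (\<lambda>\<omega>. cos (u * Z i \<omega>)) = exp (- (\<bar>u\<bar> powr q)) * phi0 F0 (\<sigma> / s * u)"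
proof -
  let ?V = "\<lambda>u. case u of Inl (i, j) \<Rightarrow> A i j | Inr i \<Rightarrow> E i"
  let ?I = "{Inl (i, j) | i j. i < n \<and> j < p} \<union> {Inr i | i. i < n}"
  \<comment> \<open>The block of variables entering measurement i. Blocks of different measurements
    are disjoint, which yields independence of the \<open>Z i\<close>.\<close>
  define K where "K i = (\<lambda>j. Inl (i, j)) ` {..<p} \<union> {Inr i}" for i :: nat
  have K: "K i \<subseteq> ?I" if "i < n" for i using that by (auto simp: K_def)
  have "finite (K i)" for i by (simp add: K_def)
  show pow: "lq_pow q p x > 0"
  proof -
    obtain j where j: "j < p" "x j \<noteq> 0" using x_nz by blast
    then have "\<bar>x j\<bar> powr q > 0" by simp
    also have "\<bar>x j\<bar> powr q \<le> lq_pow q p x"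
      unfolding lq_pow_def using j by (intro member_le_sum) auto
    finally show ?thesis .
  qed
  then show s: "s > 0" using \<gamma> by (simp add: s_def lq_norm_def)
  have sq: "s powr q = \<gamma> powr q * lq_pow q p x"
    using pow \<gamma> q by (simp add: s_def lq_norm_def powr_mult powr_powr)
  define W where "W u \<omega> = (case u of Inl (i, j) \<Rightarrow> x j / s | Inr i \<Rightarrow> \<sigma> / s) * ?V u \<omega>" for u :: "nat \<times> nat + nat" and \<omega>
  have W: "indep_vars (\<lambda>_. borel) W ?I"
    unfolding W_def by (rule indep_vars_compose2[OF indep]) auto
  have sumK: "(\<Sum>u\<in>K i. f u) = (\<Sum>j<p. f (Inl (i, j))) + f (Inr i)" for i and f :: "nat \<times> nat + nat \<Rightarrow> real"
    unfolding K_def by (subst sum.union_disjoint) (auto simp: sum.reindex inj_on_def)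
  have prodK: "(\<Prod>u\<in>K i. f u) = (\<Prod>j<p. f (Inl (i, j))) * f (Inr i)" for i and f :: "nat \<times> nat + nat \<Rightarrow> complex"
    unfolding K_def by (subst prod.union_disjoint) (auto simp: prod.reindex inj_on_def)
  have Z: "Z i \<omega> = (\<Sum>u\<in>K i. W u \<omega>)" for i \<omega>
    unfolding sumK by (simp add: Z_def W_def add_divide_distrib sum_divide_distrib mult.commute)
  have "indep_vars (\<lambda>i. PiM (K i) (\<lambda>_. borel)) (\<lambda>i \<omega>. restrict (\<lambda>u. W u \<omega>) (K i)) {..<n}"
    by (rule indep_vars_restrict[OF W]) (use K in \<open>auto simp: disjoint_family_on_def K_def\<close>)
  then have "indep_vars (\<lambda>_. borel) (\<lambda>i \<omega>. (\<lambda>v. \<Sum>u\<in>K i. v u) (restrict (\<lambda>u. W u \<omega>) (K i))) {..<n}"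
    by (rule indep_vars_compose2) (auto intro!: borel_measurable_sum)
  then show "indep_vars (\<lambda>_. borel) Z {..<n}"
    by (rule indep_vars_cong[THEN iffD1, rotated 3]) (auto simp: Z)
  fix i u assume i: "i < n"
  have Wm: "random_variable borel (W v)" if "v \<in> K i" for v
    using W K[OF i] that unfolding indep_vars_def2 by blast
  have Vm: "random_variable borel (?V v)" if "v \<in> K i" for v
    using indep K[OF i] that unfolding indep_vars_def2 by blast
  have Zm: "random_variable borel (Z i)"
    unfolding Z[abs_def] using Wm by (intro borel_measurable_sum) auto
  have scale: "char (distr M borel (\<lambda>\<omega>. a * Y \<omega>)) u = char (distr M borel Y) (a * u)"
    if [measurable]: "random_variable borel Y" for a :: real and Y
    unfolding char_def by (subst (1 2) integral_distr) (auto simp: mult_ac)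
  have "char (distr M borel (Z i)) u = (\<Prod>v\<in>K i. char (distr M borel (W v)) u)"
    unfolding Z[abs_def] by (rule char_distr_sum[OF indep_vars_subset[OF W K[OF i]]])
  also have "\<dots> = (\<Prod>j<p. char (distr M borel (W (Inl (i, j)))) u) * char (distr M borel (W (Inr i))) u"
    by (rule prodK)
  also have "char (distr M borel (W (Inr i))) u = char F0 (\<sigma> / s * u)"
    using scale[of "E i" "\<sigma> / s"] Vm[of "Inr i"] E_dist[OF i] by (simp add: W_def[abs_def] K_def)
  also have "(\<Prod>j<p. char (distr M borel (W (Inl (i, j)))) u) =
      (\<Prod>j<p. complex_of_real (exp (- (\<bar>\<gamma> * (x j / s * u)\<bar> powr q))))"
  proof (rule prod.cong)
    fix j assume j: "j \<in> {..<p}"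
    show "char (distr M borel (W (Inl (i, j)))) u = complex_of_real (exp (- (\<bar>\<gamma> * (x j / s * u)\<bar> powr q)))"
      using scale[of "A i j" "x j / s"] Vm[of "Inl (i, j)"] A_stable[OF i, of j] j
      by (simp add: W_def[abs_def] K_def is_stable_def)
  qed simp
  also have "\<dots> = complex_of_real (exp (- (\<Sum>j<p. \<bar>\<gamma> * (x j / s * u)\<bar> powr q)))"
    by (simp add: exp_sum sum_negf[symmetric])
  also have "(\<Sum>j<p. \<bar>\<gamma> * (x j / s * u)\<bar> powr q) = \<bar>u\<bar> powr q"
  proof -
    have "\<bar>\<gamma> * (x j / s * u)\<bar> powr q = \<gamma> powr q * \<bar>u\<bar> powr q / s powr q * \<bar>x j\<bar> powr q" for j
      using \<gamma> s by (simp add: abs_mult powr_mult powr_divide)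
    then have "(\<Sum>j<p. \<bar>\<gamma> * (x j / s * u)\<bar> powr q) = \<gamma> powr q * \<bar>u\<bar> powr q / s powr q * lq_pow q p x"
      by (simp add: lq_pow_def sum_distrib_left)
    then show ?thesis unfolding sq using \<gamma> pow by simp
  qed
  finally have "char (distr M borel (Z i)) u = exp (- (\<bar>u\<bar> powr q)) * char F0 (\<sigma> / s * u)" .
  moreover have "expectation (\<lambda>\<omega>. cos (u * Z i \<omega>)) = phi0 (distr M borel (Z i)) u"
  proof -
    interpret D: real_distribution "distr M borel (Z i)" using Zm by (rule real_distribution_distr)
    show ?thesis unfolding D.phi0_eq_integral using Zm by (subst integral_distr) auto
  qed
  ultimately show "expectation (\<lambda>\<omega>. cos (u * Z i \<omega>)) = exp (- (\<bar>u\<bar> powr q)) * phi0 F0 (\<sigma> / s * u)"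
    by (simp add: phi0_def)
qed

end

text \<open>The row index k is the implicit index along which (n, p) tends to infinity. The
  disjuncts for level 0 express the convention of an infinite quantile: the normal distribution
  function never attains 1, so \<open>z_quant 0\<close> is no quantile and the bound is
  dropped.\<close>

theorem theorem3:
  fixes M :: "nat \<Rightarrow> 'a measure"
    and n p :: "nat \<Rightarrow> nat"
    and x :: "nat \<Rightarrow> nat \<Rightarrow> real"
    and \<sigma> \<gamma> :: "nat \<Rightarrow> real"
    and A :: "nat \<Rightarrow> nat \<Rightarrow> nat \<Rightarrow> 'a \<Rightarrow> real"
    and E :: "nat \<Rightarrow> nat \<Rightarrow> 'a \<Rightarrow> real"
    and q eps2 \<eta>0 \<rho>bar :: real
    and F0 :: "real measure"
    and cstar :: "real \<Rightarrow> real"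
  assumes q: "0 < q" "q \<le> 2"
    and prob: "\<And>k. prob_space (M k)"
    and n_lim: "filterlim n at_top sequentially"
    and p_lim: "filterlim p at_top sequentially"
    and x_nz: "\<And>k. \<exists>j < p k. x k j \<noteq> 0"
    and \<sigma>_pos: "\<And>k. \<sigma> k > 0"
    and \<gamma>_pos: "\<And>k. \<gamma> k > 0"
    and A_stable: "\<And>k i j. i < n k \<Longrightarrow> j < p k \<Longrightarrow>
                     is_stable q (\<gamma> k) (distr (M k) borel (A k i j))"
    and E_dist: "\<And>k i. i < n k \<Longrightarrow> distr (M k) borel (E k i) = F0"
    and indep: "\<And>k. prob_space.indep_vars (M k) (\<lambda>_. borel)
                  (\<lambda>u. case u of Inl (i, j) \<Rightarrow> A k i j | Inr i \<Rightarrow> E k i)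
                  ({Inl (i, j) | i j. i < n k \<and> j < p k} \<union> {Inr i | i. i < n k})"
    and F0_distr: "real_distribution F0"
    and F0_symm: "distr F0 borel uminus = F0"
    and F0_abs: "integrable F0 abs" "0 < integral\<^sup>L F0 abs"
    and F0_zeros: "\<And>t. char F0 t = 0 \<Longrightarrow>
                     \<exists>\<delta>>0. \<forall>s. 0 < \<bar>s - t\<bar> \<and> \<bar>s - t\<bar> < \<delta> \<longrightarrow> char F0 s \<noteq> 0"
    and A3: "\<rho>bar \<ge> 0"
      "(\<lambda>k. sqrt (real (n k)) * (\<sigma> k / (\<gamma> k * lq_norm q (p k) (x k)) - \<rho>bar))
         \<longlonglongrightarrow> 0"
    and eps2: "eps2 > 0"
    and A4: "\<And>c1 c2. is_minimizer q F0 (eps_q q eps2) \<rho>bar c1 \<Longrightarrow>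
                      is_minimizer q F0 (eps_q q eps2) \<rho>bar c2 \<Longrightarrow> c1 = c2"
    and cstar_min: "\<And>\<rho>. \<rho> \<ge> 0 \<Longrightarrow> is_minimizer q F0 (eps_q q eps2) \<rho> (cstar \<rho>)"
    and cstar_meas: "cstar \<in> borel_measurable borel"
    and \<eta>0: "\<eta>0 > 0" "\<And>\<eta>. 0 \<le> \<eta> \<Longrightarrow> \<eta> \<le> \<eta>0 \<Longrightarrow> phi0 F0 \<eta> > 1/2"
  shows
   "let y = (\<lambda>k \<omega> i. (\<Sum>j<p k. A k i j \<omega> * x k j) + \<sigma> k * E k i \<omega>);
        \<nu> = (\<lambda>k \<omega>. nu_opt q F0 cstar \<eta>0 (\<sigma> k) (\<gamma> k) (n k) (y k \<omega>));
        \<Omega> = (\<lambda>k \<omega>. omega_hat q F0 cstar \<eta>0 (\<sigma> k) (\<gamma> k) (n k) (y k \<omega>));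
        X = (\<lambda>k. lq_pow q (p k) (x k))
    in weak_conv_m
         (\<lambda>k. distr (M k) borel
                (\<lambda>\<omega>. sqrt (real (n k)) / sqrt (\<Omega> k \<omega>) * (\<nu> k \<omega> / X k - 1)))
         std_normal_distribution
     \<and> (\<forall>\<alpha> \<alpha>'. 0 \<le> \<alpha> \<and> \<alpha> \<le> 1/2 \<and> 0 \<le> \<alpha>' \<and> \<alpha>' \<le> 1/2 \<longrightarrow>
          (\<lambda>k. measure (M k) {\<omega> \<in> space (M k).
              (\<alpha> = 0 \<or>
                 (1 - sqrt (\<Omega> k \<omega>) * z_quant \<alpha> / sqrt (real (n k))) * \<nu> k \<omega> \<le> X k) \<and>
              (\<alpha>' = 0 \<or>
                 X k \<le> (1 + sqrt (\<Omega> k \<omega>) * z_quant \<alpha>' / sqrt (real (n k))) * \<nu> k \<omega>)})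
          \<longlonglongrightarrow> 1 - \<alpha> - \<alpha>')"
proof -
  define s where "s k = \<gamma> k * lq_norm q (p k) (x k)" for k
  define Z where "Z k i \<omega> = ((\<Sum>j<p k. A k i j \<omega> * x k j) + \<sigma> k * E k i \<omega>) / s k" for k i \<omega>
  note lm = prob_space.linear_model[OF prob q(1) x_nz \<sigma>_pos \<gamma>_pos A_stable E_dist indep]
  have pow_pos: "lq_pow q (p k) (x k) > 0" for k
    by (rule lm(1))
  have s_pos: "s k > 0" for k unfolding s_def by (rule lm(2))
  have Z_indep: "prob_space.indep_vars (M k) (\<lambda>_. borel) (Z k) {..<n k}" for k
    unfolding Z_def[abs_def] s_def by (rule lm(3))
  have Z_char: "(\<integral>\<omega>. cos (u * Z k i \<omega>) \<partial>M k) = exp (- (\<bar>u\<bar> powr q)) * phi0 F0 (\<sigma> k / s k * u)"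
    if "i < n k" for k i u
    unfolding Z_def[abs_def] s_def by (rule lm(4)) (use that in auto)
  have \<rho>_lim: "(\<lambda>k. \<sigma> k / s k) \<longlonglongrightarrow> \<rho>bar"
  proof -
    \<comment> \<open>Multiplying the rate in (A3) by 1 / sqrt n recovers plain convergence of the
      noise-to-signal ratio.\<close>
    have "(\<lambda>k. (sqrt (real (n k)) * (\<sigma> k / s k - \<rho>bar)) * (1 / sqrt (n k))) \<longlonglongrightarrow> 0 * 0"
      using A3(2) unfolding s_def by (intro tendsto_mult inverse_sqrt_tendsto_0 n_lim)
    moreover have "\<forall>\<^sub>F k in sequentially. (sqrt (real (n k)) * (\<sigma> k / s k - \<rho>bar)) * (1 / sqrt (n k)) = \<sigma> k / s k - \<rho>bar"
      using n_lim[unfolded filterlim_at_top, THEN spec, of 1] by eventually_elim simp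
    ultimately have "(\<lambda>k. \<sigma> k / s k - \<rho>bar) \<longlonglongrightarrow> 0" by (simp add: Lim_transform_eventually)
    then show ?thesis by (simp add: LIM_zero_iff)
  qed
  have e: "eps_q q eps2 \<ge> 0" "q = 2 \<Longrightarrow> eps_q q eps2 > 0" using eps2 by (auto simp: eps_q_def)
  have \<rho>_pos: "\<sigma> k / s k > 0" for k using \<sigma>_pos[of k] s_pos[of k] by simp
  have "noise_min q (eps_q q eps2) \<rho>bar F0 cstar"
    by (rule noise_min.intro) (fact q F0_distr F0_symm F0_zeros A3(1) e A4 cstar_min)+
  moreover have "stable_model_axioms q \<rho>bar F0 M n Z s \<gamma> (\<lambda>k. \<sigma> k / s k) \<eta>0"
    by (rule stable_model_axioms.intro)
      (fact prob Z_indep Z_char n_lim s_pos \<gamma>_pos \<rho>_pos \<rho>_lim F0_abs(1) \<eta>0)+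
  ultimately interpret S: stable_model q "eps_q q eps2" \<rho>bar F0 cstar M n Z s \<gamma> "\<lambda>k. \<sigma> k / s k" \<eta>0
    by (intro stable_model.intro)
  have y: "S.y k \<omega> i = (\<Sum>j<p k. A k i j \<omega> * x k j) + \<sigma> k * E k i \<omega>" for k \<omega> i
    using s_pos[of k] by (simp add: S.y_def Z_def)
  have \<sigma>: "\<sigma> k / s k * s k = \<sigma> k" for k using s_pos[of k] by simp
  have X: "S.X k = lq_pow q (p k) (x k)" for k
    using \<gamma>_pos[of k] pow_pos[of k] q by (simp add: S.X_def s_def lq_norm_def powr_powr)
  show ?thesis
    using S.T_weak_conv[OF cstar_meas] S.confidence_interval[OF cstar_meas]
    unfolding Let_def S.T_def[abs_def] S.\<nu>_def S.\<Omega>_def X \<sigma> y[abs_def] by blast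
qed

end
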